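(* For any formula $F$, the formulas $\mathrm{Rec}^{\aleph_0}_T F\rightarrow\mathrm{Rec}^{\aleph_0}_L F$ and $\mathrm{Rec}^{\aleph_0}_L F\rightarrow\mathrm{Rec}^{\aleph_0}_T F$ are uniformly valid.
   Context: Setting: Japaridze's computability logic, with games between the machine $\top$ and the environment $\bot$, and static games. A bitstring is essentially finite if it has only finitely many 1s. For a run $\Gamma$ and an infinite bitstring $x$, $\Gamma^{\preceq x}$ keeps only the moves $u.\beta$ with $u$ a finite prefix of $x$, with the prefix $u.$ removed. - $\mathrm{Rec}^{\aleph_0}_L A$ (new countable branching recurrence): a run is legal iff all its moves are $w.\alpha$ with $w$ a finite bitstring and $\Gamma^{\preceq x}$ is legal in $A$ for every infinite bitstring $x$. $\top$ wins a legal run $\Omega$ iff $\Omega^{\preceq v}$ is $\top$-won in $A$ for every infinite essentially finite $v$. - $\mathrm{Rec}^{\aleph_0}_T A$ (Japaridze's original countable branching recurrence): $\bot$ may make replicative moves $w{:}$ splitting a leaf thread $w$ of the current binary tree into threads $w0,w1$. Non-replicative moves $w.\alpha$ are made at nodes $w$ and must be legal in all threads extending $w$. $\top$ wins iff it wins $A$ in every thread given by an infinite essentially finite bitstring. - $\mathrm{Corec}^{\aleph_0}_L$, $\mathrm{Corec}^{\aleph_0}_T$ are the duals: $\mathrm{Corec}^{\aleph_0}A=\neg\mathrm{Rec}^{\aleph_0}\neg A$. - $\mathrm{Rec}A$ and $\mathrm{Corec}A$ (uncountable branching recurrence/corecurrence, new version): same legal runs as $\mathrm{Rec}^{\aleph_0}_L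 A$, with winning for all (resp. some) infinite bitstrings $x$. Formulas are built from atoms using $\neg,\wedge,\vee$ and any of these operators, with $F\rightarrow G$ abbreviating $\neg F\vee G$. An interpretation $^*$ sends atoms to static games and extends compositionally. A formula is uniformly valid iff one machine (e.g. an easy-play machine) wins $F^*$ for every interpretation $^*$. *)

theory Defs
  imports Main "HOL-Library.Sublist" "HOL-Library.Infinite_Set"
begin

section \<open>Runs\<close>

datatype player = Machine | Environment

fun opponent :: "player \<Rightarrow> player" where
  "opponent Machine = Environment"
| "opponent Environment = Machine"

type_synonym move = string
type_synonym labmove = "player \<times> move"

datatype (elems: 'a) seq = Fin "'a list" | Infin "nat \<Rightarrow> 'a"

type_synonym position = "labmove list"
type_synonym run = "labmove seq"

fun seq_nth :: "'a seq \<Rightarrow> nat \<Rightarrow> 'a option" where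
  "seq_nth (Fin xs) i = (if i < length xs then Some (xs ! i) else None)"
| "seq_nth (Infin f) i = Some (f i)"

fun initial_segment :: "'a list \<Rightarrow> 'a seq \<Rightarrow> bool" where
  "initial_segment xs (Fin ys) \<longleftrightarrow> prefix xs ys"
| "initial_segment xs (Infin f) \<longleftrightarrow> xs = map f [0..<length xs]"

text \<open>The limit of a chain of finite sequences, each a prefix of the next.\<close>

definition seq_limit :: "(nat \<Rightarrow> 'a list) \<Rightarrow> 'a seq" where
  "seq_limit P =
     (if \<exists>n. \<forall>m\<ge>n. P m = P n then Fin (P (LEAST n. \<forall>m\<ge>n. P m = P n))
      else Infin (\<lambda>i. P (LEAST n. i < length (P n)) ! i))"

fun seq_map_filter :: "('a \<Rightarrow> 'b option) \<Rightarrow> 'a seq \<Rightarrow> 'b seq" where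
  "seq_map_filter f (Fin xs) = Fin (List.map_filter f xs)"
| "seq_map_filter f (Infin g) = seq_limit (\<lambda>n. List.map_filter f (map g [0..<n]))"

definition negate_run :: "run \<Rightarrow> run" where
  "negate_run = map_seq (map_prod opponent id)"

text \<open>Keep the moves on which \<open>f\<close> is defined, replacing each by its image and keeping its label.\<close>

definition project :: "(move \<Rightarrow> move option) \<Rightarrow> run \<Rightarrow> run" where
  "project f = seq_map_filter (\<lambda>(p, \<mu>). map_option (Pair p) (f \<mu>))"

definition strip_prefix :: "string \<Rightarrow> move \<Rightarrow> move option" where
  "strip_prefix \<pi> \<mu> = (if prefix \<pi> \<mu> then Some (drop (length \<pi>) \<mu>) else None)"

section \<open>Games\<close>

record game =
  Lr :: "run set"
  Wn :: "run \<Rightarrow> player"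

text \<open>The last move of the shortest illegal initial segment is made by \<open>p\<close>.\<close>

definition illegal_by :: "player \<Rightarrow> run set \<Rightarrow> run \<Rightarrow> bool" where
  "illegal_by p L \<Gamma> \<longleftrightarrow>
     (\<exists>\<Phi> \<alpha>. initial_segment (\<Phi> @ [(p, \<alpha>)]) \<Gamma> \<and> Fin (\<Phi> @ [(p, \<alpha>)]) \<notin> L \<and>
        (\<forall>\<Psi>. strict_prefix \<Psi> (\<Phi> @ [(p, \<alpha>)]) \<longrightarrow> Fin \<Psi> \<in> L))"

definition is_game :: "game \<Rightarrow> bool" where
  "is_game A \<longleftrightarrow>
     (\<forall>\<Gamma>. \<Gamma> \<in> Lr A \<longleftrightarrow> (\<forall>\<Phi>. \<Phi> \<noteq> [] \<and> initial_segment \<Phi> \<Gamma> \<longrightarrow> Fin \<Phi> \<in> Lr A)) \<and>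
     (\<forall>\<Gamma> p. illegal_by p (Lr A) \<Gamma> \<longrightarrow> Wn A \<Gamma> = opponent p)"

text \<open>Game with legal runs \<open>L\<close> whose legal runs are won by the machine iff \<open>W\<close> holds; illegal
  runs are lost by the player responsible for the illegality.\<close>

definition make_game :: "run set \<Rightarrow> (run \<Rightarrow> bool) \<Rightarrow> game" where
  "make_game L W =
     \<lparr> Lr = L,
       Wn = (\<lambda>\<Gamma>. if \<Gamma> \<in> L then (if W \<Gamma> then Machine else Environment)
                  else if illegal_by Machine L \<Gamma> then Environment else Machine) \<rparr>"

subsection \<open>Static games\<close>

definition subsequence_of :: "player \<Rightarrow> run \<Rightarrow> run" where
  "subsequence_of p = seq_map_filter (\<lambda>l. if fst l = p then Some l else None)"

text \<open>The \<open>n\<close>-th (counting from 0) \<open>p\<close>-labelled move of the run sits at index \<open>i\<close>.\<close>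

definition nth_move_at :: "player \<Rightarrow> nat \<Rightarrow> run \<Rightarrow> nat \<Rightarrow> bool" where
  "nth_move_at p n \<Gamma> i \<longleftrightarrow>
     map_option fst (seq_nth \<Gamma> i) = Some p \<and>
     card {j. j < i \<and> map_option fst (seq_nth \<Gamma> j) = Some p} = n"

definition later_than :: "player \<Rightarrow> nat \<Rightarrow> nat \<Rightarrow> run \<Rightarrow> bool" where
  "later_than p n k \<Gamma> \<longleftrightarrow>
     (\<exists>i j. nth_move_at p n \<Gamma> i \<and> nth_move_at (opponent p) k \<Gamma> j \<and> j < i)"

text \<open>\<open>\<Omega>\<close> is a \<open>p\<close>-delay of \<open>\<Gamma>\<close>.\<close>

definition delay :: "player \<Rightarrow> run \<Rightarrow> run \<Rightarrow> bool" where
  "delay p \<Gamma> \<Omega> \<longleftrightarrow>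
     (\<forall>q. subsequence_of q \<Omega> = subsequence_of q \<Gamma>) \<and>
     (\<forall>n k. later_than p n k \<Gamma> \<longrightarrow> later_than p n k \<Omega>)"

definition static :: "game \<Rightarrow> bool" where
  "static A \<longleftrightarrow> is_game A \<and>
     (\<forall>p \<Gamma> \<Omega>. Wn A \<Gamma> = p \<and> delay p \<Gamma> \<Omega> \<longrightarrow> Wn A \<Omega> = p)"

section \<open>Game operations\<close>

subsection \<open>Negation, parallel conjunction and disjunction\<close>

definition game_neg :: "game \<Rightarrow> game" where
  "game_neg A = \<lparr> Lr = {\<Gamma>. negate_run \<Gamma> \<in> Lr A},
                  Wn = (\<lambda>\<Gamma>. opponent (Wn A (negate_run \<Gamma>))) \<rparr>"

definition par_legal :: "game \<Rightarrow> game \<Rightarrow> run set" where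
  "par_legal A B =
     {\<Gamma>. (\<forall>(p, \<mu>) \<in> elems \<Gamma>. prefix ''0.'' \<mu> \<or> prefix ''1.'' \<mu>) \<and>
          project (strip_prefix ''0.'') \<Gamma> \<in> Lr A \<and> project (strip_prefix ''1.'') \<Gamma> \<in> Lr B}"

definition game_and :: "game \<Rightarrow> game \<Rightarrow> game" where
  "game_and A B = make_game (par_legal A B)
     (\<lambda>\<Gamma>. Wn A (project (strip_prefix ''0.'') \<Gamma>) = Machine \<and>
           Wn B (project (strip_prefix ''1.'') \<Gamma>) = Machine)"

definition game_or :: "game \<Rightarrow> game \<Rightarrow> game" where
  "game_or A B = make_game (par_legal A B)
     (\<lambda>\<Gamma>. Wn A (project (strip_prefix ''0.'') \<Gamma>) = Machine \<or>
           Wn B (project (strip_prefix ''1.'') \<Gamma>) = Machine)"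

subsection \<open>Branching recurrences\<close>

type_synonym bitstring = "bool list"
type_synonym inf_bitstring = "nat \<Rightarrow> bool"

definition essentially_finite :: "inf_bitstring \<Rightarrow> bool" where
  "essentially_finite x \<longleftrightarrow> finite {n. x n}"

definition bit_char :: "bool \<Rightarrow> char" where
  "bit_char b = (if b then CHR ''1'' else CHR ''0'')"

definition move_at :: "bitstring \<Rightarrow> move \<Rightarrow> move" where
  "move_at w \<alpha> = map bit_char w @ ''.'' @ \<alpha>"

definition replicative :: "bitstring \<Rightarrow> move" where
  "replicative w = map bit_char w @ '':''"

fun strip_thread :: "inf_bitstring \<Rightarrow> move \<Rightarrow> move option" where
  "strip_thread x [] = None"
| "strip_thread x (c # cs) =
     (if c = CHR ''.'' then Some cs
      else if c = bit_char (x 0) then strip_thread (\<lambda>n. x (Suc n)) cs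
      else None)"

lemma strip_thread_eq_Some_iff:
  "strip_thread x \<mu> = Some \<beta> \<longleftrightarrow> (\<exists>n. \<mu> = move_at (map x [0..<n]) \<beta>)"
proof (induction x \<mu> rule: strip_thread.induct)
  case (1 x)
  then show ?case by (simp add: move_at_def)
next
  case (2 x c cs)
  have shift: "map x [0..<Suc n] = x 0 # map (\<lambda>n. x (Suc n)) [0..<n]" for n
    by (simp add: map_upt_Suc del: upt_Suc)
  have split: "(\<exists>n. P n) \<longleftrightarrow> P 0 \<or> (\<exists>n. P (Suc n))" for P :: "nat \<Rightarrow> bool"
    by (metis not0_implies_Suc)
  have nd: "bit_char b \<noteq> CHR ''.''" for b by (simp add: bit_char_def)
  show ?case
    by (subst split, simp only: shift) (use 2 nd in \<open>auto simp: move_at_def\<close>)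
qed

text \<open>\<open>\<Gamma>\<^sup>\<preceq>\<^sup>x\<close>. Replicative moves are not of the form \<open>u.\<beta>\<close> and hence are dropped.\<close>

definition thread :: "run \<Rightarrow> inf_bitstring \<Rightarrow> run" where
  "thread \<Gamma> x = project (strip_thread x) \<Gamma>"

definition rec_legal :: "game \<Rightarrow> run set" where
  "rec_legal A =
     {\<Gamma>. (\<forall>(p, \<mu>) \<in> elems \<Gamma>. \<exists>w \<alpha>. \<mu> = move_at w \<alpha>) \<and> (\<forall>x. thread \<Gamma> x \<in> Lr A)}"

definition game_rec :: "game \<Rightarrow> game" where
  "game_rec A = make_game (rec_legal A) (\<lambda>\<Gamma>. \<forall>x. Wn A (thread \<Gamma> x) = Machine)"

definition game_corec :: "game \<Rightarrow> game" where
  "game_corec A = make_game (rec_legal A) (\<lambda>\<Gamma>. \<exists>x. Wn A (thread \<Gamma> x) = Machine)"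

definition game_recL :: "game \<Rightarrow> game" where
  "game_recL A = make_game (rec_legal A)
     (\<lambda>\<Gamma>. \<forall>v. essentially_finite v \<longrightarrow> Wn A (thread \<Gamma> v) = Machine)"

definition game_corecL :: "game \<Rightarrow> game" where
  "game_corecL A = game_neg (game_recL (game_neg A))"

text \<open>The binary tree built up by the replicative moves of a position, as its set of nodes.\<close>

definition tree :: "position \<Rightarrow> bitstring set" where
  "tree \<Phi> = {[]} \<union> {w @ [b] | w b. (Environment, replicative w) \<in> set \<Phi>}"

definition leaf :: "bitstring set \<Rightarrow> bitstring \<Rightarrow> bool" where
  "leaf T w \<longleftrightarrow> w \<in> T \<and> (\<forall>b. w @ [b] \<notin> T)"

inductive prelegal :: "position \<Rightarrow> bool" where
  "prelegal []"
| "prelegal \<Phi> \<Longrightarrow> leaf (tree \<Phi>) w \<Longrightarrow> prelegal (\<Phi> @ [(Environment, replicative w)])"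
| "prelegal \<Phi> \<Longrightarrow> w \<in> tree \<Phi> \<Longrightarrow> prelegal (\<Phi> @ [(p, move_at w \<alpha>)])"

definition recT_legal :: "game \<Rightarrow> run set" where
  "recT_legal A =
     {\<Gamma>. (\<forall>\<Phi>. initial_segment \<Phi> \<Gamma> \<longrightarrow> prelegal \<Phi>) \<and> (\<forall>x. thread \<Gamma> x \<in> Lr A)}"

definition game_recT :: "game \<Rightarrow> game" where
  "game_recT A = make_game (recT_legal A)
     (\<lambda>\<Gamma>. \<forall>v. essentially_finite v \<longrightarrow> Wn A (thread \<Gamma> v) = Machine)"

definition game_corecT :: "game \<Rightarrow> game" where
  "game_corecT A = game_neg (game_recT (game_neg A))"

section \<open>Formulas and interpretations\<close>

datatype formula =
    Atom nat
  | Neg formula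
  | And formula formula
  | Or formula formula
  | RecL formula
  | CorecL formula
  | RecT formula
  | CorecT formula
  | Rec formula
  | Corec formula

abbreviation Imp :: "formula \<Rightarrow> formula \<Rightarrow> formula" where
  "Imp F G \<equiv> Or (Neg F) G"

primrec interp :: "(nat \<Rightarrow> game) \<Rightarrow> formula \<Rightarrow> game" where
  "interp I (Atom a) = I a"
| "interp I (Neg F) = game_neg (interp I F)"
| "interp I (And F G) = game_and (interp I F) (interp I G)"
| "interp I (Or F G) = game_or (interp I F) (interp I G)"
| "interp I (RecL F) = game_recL (interp I F)"
| "interp I (CorecL F) = game_corecL (interp I F)"
| "interp I (RecT F) = game_recT (interp I F)"
| "interp I (CorecT F) = game_corecT (interp I F)"
| "interp I (Rec F) = game_rec (interp I F)"
| "interp I (Corec F) = game_corec (interp I F)"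

section \<open>Easy-play machines\<close>

text \<open>An easy-play machine is a Turing machine with finitely many read/write work tapes and a
  read-only run tape spelling the current position; all tapes are infinite to the right. In a move
  state it makes the move written at the beginning of its first work tape, and in a permission state
  the environment may make at most one move. The states are the numbers below \<open>num_states\<close>, the
  start state being 0. There are no halting states.\<close>

datatype symbol = Blank | Label player | Chr char | Aux nat

datatype direction = GoLeft | Stay | GoRight

record epm =
  num_states :: nat
  num_tapes :: nat
  num_aux :: nat
  move_states :: "nat set"
  permission_states :: "nat set"
  transition :: "nat \<Rightarrow> symbol \<Rightarrow> symbol list \<Rightarrow> nat \<times> direction \<times> (symbol \<times> direction) list"

definition alphabet :: "epm \<Rightarrow> symbol set" where
  "alphabet M = {Blank} \<union> range Label \<union> range Chr \<union> Aux ` {..<num_aux M}"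

definition is_epm :: "epm \<Rightarrow> bool" where
  "is_epm M \<longleftrightarrow>
     0 < num_states M \<and> 0 < num_tapes M \<and>
     (\<forall>q a as. q < num_states M \<and> a \<in> alphabet M \<and> set as \<subseteq> alphabet M \<and> length as = num_tapes M \<longrightarrow>
        (case transition M q a as of (q', d, ws) \<Rightarrow>
           q' < num_states M \<and> length ws = num_tapes M \<and> fst ` set ws \<subseteq> alphabet M))"

type_synonym tape = "(nat \<Rightarrow> symbol) \<times> nat"

record config =
  state :: nat
  pos :: position
  run_head :: nat
  tapes :: "tape list"

definition initial_config :: "epm \<Rightarrow> config" where
  "initial_config M =
     \<lparr> state = 0, pos = [], run_head = 0, tapes = replicate (num_tapes M) (\<lambda>_. Blank, 0) \<rparr>"

definition run_tape :: "position \<Rightarrow> nat \<Rightarrow> symbol" where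
  "run_tape \<Phi> i =
     (let s = concat (map (\<lambda>(p, \<alpha>). Label p # map Chr \<alpha>) \<Phi>)
      in if i < length s then s ! i else Blank)"

fun move_head :: "direction \<Rightarrow> nat \<Rightarrow> nat" where
  "move_head GoLeft h = h - 1"
| "move_head Stay h = h"
| "move_head GoRight h = Suc h"

fun read_tape :: "tape \<Rightarrow> symbol" where
  "read_tape (t, h) = t h"

fun write_tape :: "tape \<Rightarrow> symbol \<times> direction \<Rightarrow> tape" where
  "write_tape (t, h) (a, d) = (t(h := a), move_head d h)"

text \<open>The longest string of characters at the beginning of the tape; on a tape with finitely many
  non-blank cells it is always delimited by some cell not holding a character.\<close>

definition tape_word :: "tape \<Rightarrow> string" where
  "tape_word t =
     map (\<lambda>i. THE c. fst t i = Chr c) [0..<(LEAST n. fst t n \<notin> range Chr)]"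

text \<open>One computation step; \<open>r\<close> is the response of the environment, which matters only in
  permission states.\<close>

definition step :: "epm \<Rightarrow> move option \<Rightarrow> config \<Rightarrow> config" where
  "step M r C =
     (let (q, d, ws) = transition M (state C) (run_tape (pos C) (run_head C)) (map read_tape (tapes C))
      in \<lparr> state = q,
           pos = pos C
             @ (if state C \<in> move_states M then [(Machine, tape_word (hd (tapes C)))] else [])
             @ (if state C \<in> permission_states M
                then (case r of None \<Rightarrow> [] | Some \<beta> \<Rightarrow> [(Environment, \<beta>)]) else []),
           run_head = move_head d (run_head C),
           tapes = map2 write_tape (tapes C) ws \<rparr>)"

primrec branch :: "epm \<Rightarrow> (nat \<Rightarrow> move option) \<Rightarrow> nat \<Rightarrow> config" where
  "branch M env 0 = initial_config M"
| "branch M env (Suc n) = step M (env n) (branch M env n)"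

definition fair :: "epm \<Rightarrow> (nat \<Rightarrow> config) \<Rightarrow> bool" where
  "fair M B \<longleftrightarrow> (\<exists>\<^sub>\<infinity>n. state (B n) \<in> permission_states M)"

definition spelled_run :: "(nat \<Rightarrow> config) \<Rightarrow> run" where
  "spelled_run B = seq_limit (\<lambda>n. pos (B n))"

definition wins :: "epm \<Rightarrow> game \<Rightarrow> bool" where
  "wins M A \<longleftrightarrow>
     (\<forall>env. let B = branch M env; \<Gamma> = spelled_run B
            in Wn A \<Gamma> = Machine \<and> (fair M B \<or> illegal_by Environment (Lr A) \<Gamma>))"

definition uniformly_valid :: "formula \<Rightarrow> bool" where
  "uniformly_valid F \<longleftrightarrow>
     (\<exists>M. is_epm M \<and> (\<forall>I. (\<forall>a. static (I a)) \<longrightarrow> wins M (interp I F)))"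

end

theory Submission
  imports Defs
begin

text \<open>In both directions the machine copies moves between the two components, answering each move of
  the environment at once; hence corresponding threads carry literally the same run of the game. For \<open>Rec\<^sub>T F \<rightarrow> Rec\<^sub>L F\<close> the machine
  controls the splits of the left tree and keeps it complete and deep enough, so that thread \<open>x\<close>
  corresponds to thread \<open>x\<close>. For \<open>Rec\<^sub>L F \<rightarrow> Rec\<^sub>T F\<close> every leaf \<open>u\<close> of the right tree is matched with a
  left address \<open>g\<close> that arises from \<open>u\<close> by inserting zeros; the left threads matched with essentially
  finite right threads are therefore essentially finite. Both strategies are implemented by programs
  on stacks, which are compiled to easy-play machines.\<close>


section \<open>Initial segments and limits of chains\<close>

text \<open>In Rec_L a move may address a node of any depth, in Rec_T only a node of the current
  tree, and in the second implication the environment alone splits the right tree. A move deep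
  inside the left cone matched with a right leaf would thus distinguish left threads that share one
  right leaf. The cure is to shrink the cone first, to an address longer than any node the move can
  mention; the length of the move's text is such a bound. The left threads that drop out are
  abandoned: they only have to stay legal, because each right thread needs just one left thread with
  the same run. That thread arises in the limit, from the chain of entries over a fixed right
  thread. The environment may break the rules at any time, so invariants are claimed only up to that
  point. And since validity asks for a machine with finitely many states, the unbounded data, leaves
  and entries, have to be spelled on tapes.\<close>

lemma initial_segment_Nil [simp]: "initial_segment [] \<Gamma>"
  by (cases \<Gamma>) auto

lemma initial_segment_Infin_iff:
  "initial_segment xs (Infin f) \<longleftrightarrow> (\<forall>i<length xs. xs ! i = f i)"
  unfolding initial_segment.simps by (subst list_eq_iff_nth_eq) simp

lemma initial_segment_prefix:
  assumes "initial_segment ys \<Gamma>" "prefix xs ys" shows "initial_segment xs \<Gamma>"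
proof (cases \<Gamma>)
  case (Fin zs)
  then show ?thesis using assms by auto
next
  case (Infin f)
  then show ?thesis using assms unfolding Infin initial_segment_Infin_iff
    by (auto simp: prefix_def nth_append split: if_splits)
qed

lemma initial_segment_map_upt: "initial_segment (map f [0..<n]) (Infin f)"
  by simp

lemma initial_segment_Infin_ex: "initial_segment xs (Infin f) \<longleftrightarrow> (\<exists>n. xs = map f [0..<n])"
proof
  assume "initial_segment xs (Infin f)"
  then show "\<exists>n. xs = map f [0..<n]" unfolding initial_segment.simps by (rule exI)
next
  assume "\<exists>n. xs = map f [0..<n]"
  then show "initial_segment xs (Infin f)" by (elim exE) simp
qed

lemma not_same_initial_segments_Fin_Infin:
  assumes "\<And>zs. initial_segment zs (Fin xs) \<longleftrightarrow> initial_segment zs (Infin f)"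
  shows False
proof -
  have "prefix (map f [0..<Suc (length xs)]) xs"
    using assms[of "map f [0..<Suc (length xs)]"] by (simp del: upt_Suc)
  then have "length (map f [0..<Suc (length xs)]) \<le> length xs" by (rule prefix_length_le)
  then show False by simp
qed

text \<open>A finite sequence bounds the length of its initial segments, an infinite one does not;
  within each kind the segments fix all members. Equalities between runs defined by limits are
  reduced to this criterion.\<close>

lemma seq_eqI:
  assumes "\<And>xs. initial_segment xs \<Gamma> \<longleftrightarrow> initial_segment xs \<Delta>"
  shows "\<Gamma> = \<Delta>"
proof (cases \<Gamma>)
  case xs: (Fin xs)
  show ?thesis
  proof (cases \<Delta>)
    case (Fin ys)
    then show ?thesis using xs assms[of xs] assms[of ys] by (auto intro: prefix_order.antisym)
  next
    case (Infin f)
    show ?thesis using not_same_initial_segments_Fin_Infin[of xs f] assms unfolding xs Infin by blast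
  qed
next
  case f: (Infin f)
  show ?thesis
  proof (cases \<Delta>)
    case (Fin ys)
    show ?thesis using not_same_initial_segments_Fin_Infin[of ys f] assms unfolding f Fin by blast
  next
    case (Infin g)
    have "f n = g n" for n
    proof -
      have "initial_segment (map f [0..<Suc n]) (Infin g)"
        using assms initial_segment_map_upt unfolding f Infin by blast
      then show ?thesis unfolding initial_segment_Infin_iff by (auto simp del: upt_Suc)
    qed
    then show ?thesis using f Infin by auto
  qed
qed

definition chain :: "(nat \<Rightarrow> 'a list) \<Rightarrow> bool" where
  "chain P \<longleftrightarrow> (\<forall>n. prefix (P n) (P (Suc n)))"

lemma chain_mono: 
  assumes "chain P" "m \<le> n" shows "prefix (P m) (P n)"
  using assms(2) by (induction rule: dec_induct) (use assms(1) in \<open>auto simp: chain_def intro: prefix_order.trans\<close>)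

text \<open>Replaces the two-case definition of \<open>seq_limit\<close> by one criterion, for which
  it is irrelevant whether the chain becomes stationary.\<close>

lemma initial_segment_seq_limit:
  assumes "chain P"
  shows "initial_segment xs (seq_limit P) \<longleftrightarrow> (\<exists>n. prefix xs (P n))"
proof (cases "\<exists>n. \<forall>m\<ge>n. P m = P n")
  case True
  define N where "N = (LEAST n. \<forall>m\<ge>n. P m = P n)"
  have N: "\<forall>m\<ge>N. P m = P N" unfolding N_def by (rule LeastI_ex[OF True])
  have "prefix (P n) (P N)" for n
    using chain_mono[OF assms, of n "max n N"] N by (metis max.cobounded1 max.cobounded2)
  moreover have "seq_limit P = Fin (P N)" unfolding seq_limit_def N_def using True by simp
  ultimately show ?thesis by (auto intro: prefix_order.trans)
next
  case False
  \<comment> \<open>A chain that never becomes stationary grows properly after each stage, so its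
    lengths exceed every bound and each index is eventually filled.\<close>
  have unbounded: "\<exists>n. i < length (P n)" for i
  proof (induction i)
    case 0
    obtain m where "P m \<noteq> P 0" using False by blast
    then have "P m \<noteq> []" using chain_mono[OF assms, of 0 m] by auto
    then show ?case by blast
  next
    case (Suc i)
    then obtain n where n: "i < length (P n)" by blast
    obtain m where m: "m \<ge> n" "P m \<noteq> P n" using False by blast
    then have "strict_prefix (P n) (P m)"
      using chain_mono[OF assms m(1)] by (simp add: strict_prefix_def)
    then show ?case using n prefix_length_less[of "P n" "P m"]
      by (metis Suc_leI le_less_trans)
  qed
  define f where "f = (\<lambda>i. P (LEAST n. i < length (P n)) ! i)"
  have f: "P n ! i = f i" if "i < length (P n)" for n i
  proof -
    define m where "m = (LEAST n. i < length (P n))"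
    have "i < length (P m)" unfolding m_def by (rule LeastI[of _ n]) (rule that)
    moreover have "m \<le> n" unfolding m_def by (rule Least_le) (rule that)
    ultimately show ?thesis using chain_mono[OF assms, of m n] unfolding f_def m_def[symmetric]
      by (auto simp: prefix_def nth_append)
  qed
  have lim: "seq_limit P = Infin f" using False by (simp add: seq_limit_def f_def)
  show ?thesis
  proof
    assume "initial_segment xs (seq_limit P)"
    then have xs: "\<forall>i<length xs. xs ! i = f i" unfolding lim initial_segment_Infin_iff .
    obtain n where n: "length xs < length (P n)" using unbounded by blast
    have "xs = take (length xs) (P n)"
      by (rule nth_equalityI) (use xs n f[of _ n] in auto)
    then show "\<exists>n. prefix xs (P n)" by (metis take_is_prefix)
  next
    assume "\<exists>n. prefix xs (P n)"
    then obtain n zs where n: "P n = xs @ zs" by (auto simp: prefix_def)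
    have "xs ! i = f i" if "i < length xs" for i
      using f[of i n] that by (simp add: n nth_append)
    then show "initial_segment xs (seq_limit P)"
      unfolding lim initial_segment_Infin_iff by blast
  qed
qed

lemma map_filter_append: "List.map_filter f (xs @ ys) = List.map_filter f xs @ List.map_filter f ys"
  by (simp add: List.map_filter_def)

lemma chain_map_filter: "chain P \<Longrightarrow> chain (\<lambda>n. List.map_filter f (P n))"
  unfolding chain_def prefix_def by (metis map_filter_append)

lemma chain_map_upt: "chain (\<lambda>n. map f [0..<n])"
  by (simp add: chain_def)

lemma initial_segment_seq_map_filter:
  "initial_segment xs (seq_map_filter f \<Gamma>) \<longleftrightarrow>
     (\<exists>ys. initial_segment ys \<Gamma> \<and> prefix xs (List.map_filter f ys))"
proof (cases \<Gamma>)
  case (Fin zs)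
  have "prefix (List.map_filter f ys) (List.map_filter f zs)" if "prefix ys zs" for ys
    using that by (auto simp: prefix_def map_filter_append)
  then show ?thesis using Fin by (auto intro: prefix_order.trans)
next
  case (Infin g)
  have "initial_segment xs (seq_map_filter f \<Gamma>) \<longleftrightarrow> (\<exists>n. prefix xs (List.map_filter f (map g [0..<n])))"
    unfolding Infin seq_map_filter.simps
    by (rule initial_segment_seq_limit[OF chain_map_filter[OF chain_map_upt]])
  also have "\<dots> \<longleftrightarrow> (\<exists>ys. initial_segment ys \<Gamma> \<and> prefix xs (List.map_filter f ys))"
    unfolding Infin initial_segment_Infin_ex by blast
  finally show ?thesis .
qed

text \<open>Filtering is monotone for prefixes, so both sides have the same initial segments. This
  allows components and threads of an infinite play to be computed stage by stage.\<close>

lemma seq_map_filter_seq_limit: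
  assumes "chain P"
  shows "seq_map_filter f (seq_limit P) = seq_limit (\<lambda>n. List.map_filter f (P n))"
proof (rule seq_eqI)
  fix xs
  have "prefix (List.map_filter f ys) (List.map_filter f zs)" if "prefix ys zs" for ys zs
    using that by (auto simp: prefix_def map_filter_append)
  then show "initial_segment xs (seq_map_filter f (seq_limit P)) \<longleftrightarrow>
      initial_segment xs (seq_limit (\<lambda>n. List.map_filter f (P n)))"
    unfolding initial_segment_seq_map_filter initial_segment_seq_limit[OF assms]
      initial_segment_seq_limit[OF chain_map_filter[OF assms]]
    by (blast intro: prefix_order.trans)
qed

text \<open>Mutual cofinality is what relates the run of a machine, indexed by computation steps, to
  a play, indexed by rounds.\<close>

lemma seq_limit_subseq:
  assumes "chain P" "chain Q" "\<And>n. \<exists>m. prefix (P n) (Q m)" "\<And>n. \<exists>m. prefix (Q n) (P m)"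
  shows "seq_limit P = seq_limit Q"
proof (rule seq_eqI)
  fix xs
  show "initial_segment xs (seq_limit P) \<longleftrightarrow> initial_segment xs (seq_limit Q)"
    unfolding assms(1,2)[THEN initial_segment_seq_limit]
    using assms(3,4) by (meson prefix_order.trans)
qed

text \<open>\<open>negate_run\<close> is defined by \<open>map_seq\<close>; seen as a filter it
  commutes with limits just as the projections do.\<close>

lemma map_seq_conv_map_filter: "map_seq f \<Gamma> = seq_map_filter (Some \<circ> f) \<Gamma>"
proof (cases \<Gamma>)
  case (Fin xs)
  then show ?thesis by (simp add: List.map_filter_def)
next
  case (Infin g)
  have mf: "List.map_filter (Some \<circ> f) (map g [0..<n]) = map (f \<circ> g) [0..<n]" for n
    by (simp add: List.map_filter_def comp_def)
  have "initial_segment xs (Infin (f \<circ> g)) \<longleftrightarrow> (\<exists>n. prefix xs (map (f \<circ> g) [0..<n]))" for xs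
  proof
    assume "initial_segment xs (Infin (f \<circ> g))"
    then show "\<exists>n. prefix xs (map (f \<circ> g) [0..<n])"
      unfolding initial_segment_Infin_ex by (elim exE, hypsubst) (rule exI, rule prefix_order.refl)
  next
    assume "\<exists>n. prefix xs (map (f \<circ> g) [0..<n])"
    then show "initial_segment xs (Infin (f \<circ> g))"
      using initial_segment_prefix[OF initial_segment_map_upt] by (elim exE)
  qed
  moreover have "chain (\<lambda>n. map (f \<circ> g) [0..<n])" by (rule chain_map_upt)
  ultimately have "Infin (f \<circ> g) = seq_limit (\<lambda>n. map (f \<circ> g) [0..<n])"
    by (intro seq_eqI) (simp only: initial_segment_seq_limit)
  then show ?thesis unfolding Infin seq_map_filter.simps mf by simp
qed


section \<open>Prefix-closed sets of legal runs\<close>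

definition lproject :: "(move \<Rightarrow> move option) \<Rightarrow> position \<Rightarrow> position" where
  "lproject f = List.map_filter (\<lambda>(p, \<mu>). map_option (Pair p) (f \<mu>))"

definition lnegate :: "position \<Rightarrow> position" where
  "lnegate = map (map_prod opponent id)"

lemma lproject_Nil [simp]: "lproject f [] = []"
  by (simp add: lproject_def List.map_filter_def)

lemma lproject_append [simp]: "lproject f (\<Phi> @ \<Psi>) = lproject f \<Phi> @ lproject f \<Psi>"
  by (simp add: lproject_def map_filter_append)

lemma lproject_Cons [simp]:
  "lproject f ((p, \<mu>) # \<Phi>) = (case f \<mu> of None \<Rightarrow> [] | Some \<nu> \<Rightarrow> [(p, \<nu>)]) @ lproject f \<Phi>"
  by (simp add: lproject_def List.map_filter_def split: option.split)

lemma lnegate_Nil [simp]: "lnegate [] = []"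
  by (simp add: lnegate_def)

lemma lnegate_append [simp]: "lnegate (\<Phi> @ \<Psi>) = lnegate \<Phi> @ lnegate \<Psi>"
  by (simp add: lnegate_def)

lemma lnegate_Cons [simp]: "lnegate ((p, \<mu>) # \<Phi>) = (opponent p, \<mu>) # lnegate \<Phi>"
  by (simp add: lnegate_def)

lemma project_Fin: "project f (Fin \<Phi>) = Fin (lproject f \<Phi>)"
  by (simp add: project_def lproject_def)

lemma project_seq_limit:
  "chain P \<Longrightarrow> project f (seq_limit P) = seq_limit (\<lambda>n. lproject f (P n))"
  by (simp add: project_def lproject_def seq_map_filter_seq_limit)

lemma chain_lproject: "chain P \<Longrightarrow> chain (\<lambda>n. lproject f (P n))"
  unfolding lproject_def by (rule chain_map_filter)

lemma initial_segment_project: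
  "initial_segment \<Phi> \<Gamma> \<Longrightarrow> initial_segment (lproject f \<Phi>) (project f \<Gamma>)"
  unfolding project_def lproject_def initial_segment_seq_map_filter by blast

lemma lnegate_conv_map_filter: "lnegate = List.map_filter (Some \<circ> map_prod opponent id)"
  by (simp add: lnegate_def fun_eq_iff List.map_filter_def)

lemma negate_run_Fin: "negate_run (Fin \<Phi>) = Fin (lnegate \<Phi>)"
  by (simp add: negate_run_def lnegate_def)

lemma negate_run_seq_limit: "chain P \<Longrightarrow> negate_run (seq_limit P) = seq_limit (\<lambda>n. lnegate (P n))"
  by (simp add: negate_run_def map_seq_conv_map_filter seq_map_filter_seq_limit lnegate_conv_map_filter)

lemma chain_lnegate: "chain P \<Longrightarrow> chain (\<lambda>n. lnegate (P n))"
  unfolding lnegate_conv_map_filter by (rule chain_map_filter)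

lemma initial_segment_negate_run:
  "initial_segment \<Phi> \<Gamma> \<Longrightarrow> initial_segment (lnegate \<Phi>) (negate_run \<Gamma>)"
  unfolding negate_run_def map_seq_conv_map_filter lnegate_conv_map_filter initial_segment_seq_map_filter
  by blast

lemma initial_segment_elems:
  assumes "initial_segment \<Phi> \<Gamma>" shows "set \<Phi> \<subseteq> elems \<Gamma>"
proof (cases \<Gamma>)
  case (Fin xs)
  then show ?thesis using assms by (auto dest: set_mono_prefix)
next
  case (Infin f)
  then show ?thesis using assms unfolding Infin initial_segment_Infin_ex by auto
qed

text \<open>The property carried through the induction on formulas: projections and negation send
  initial segments to initial segments, so each game operation preserves it. It makes an illegality
  permanent.\<close>

definition prefix_closed :: "run set \<Rightarrow> bool" where
  "prefix_closed L \<longleftrightarrow> (\<forall>\<Gamma>\<in>L. \<forall>\<Phi>. initial_segment \<Phi> \<Gamma> \<longrightarrow> Fin \<Phi> \<in> L)"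

lemma prefix_closedD: "prefix_closed L \<Longrightarrow> \<Gamma> \<in> L \<Longrightarrow> initial_segment \<Phi> \<Gamma> \<Longrightarrow> Fin \<Phi> \<in> L"
  by (auto simp: prefix_closed_def)

lemma prefix_closed_Fin: "prefix_closed L \<Longrightarrow> Fin \<Psi> \<in> L \<Longrightarrow> prefix \<Phi> \<Psi> \<Longrightarrow> Fin \<Phi> \<in> L"
  by (erule prefix_closedD) auto

lemma prefix_closed_is_game:
  assumes "is_game A" shows "prefix_closed (Lr A)"
  unfolding prefix_closed_def
proof (intro ballI allI impI)
  fix \<Gamma> \<Phi> assume \<Gamma>: "\<Gamma> \<in> Lr A" and \<Phi>: "initial_segment \<Phi> \<Gamma>"
  have iff: "\<Delta> \<in> Lr A \<longleftrightarrow> (\<forall>\<Psi>. \<Psi> \<noteq> [] \<and> initial_segment \<Psi> \<Delta> \<longrightarrow> Fin \<Psi> \<in> Lr A)" for \<Delta>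
    using assms unfolding is_game_def by blast
  show "Fin \<Phi> \<in> Lr A"
  proof (cases "\<Phi> = []")
    \<comment> \<open>\<open>is_game\<close> quantifies over nonempty initial segments; the empty
      position is legal because it has none.\<close>
    case True
    then show ?thesis by (subst iff) auto
  next
    case False
    then show ?thesis using \<Gamma> \<Phi> iff[of \<Gamma>] by blast
  qed
qed

lemma prefix_closed_neg: "prefix_closed (Lr A) \<Longrightarrow> prefix_closed (Lr (game_neg A))"
  unfolding prefix_closed_def game_neg_def
  using initial_segment_negate_run by (auto simp: negate_run_Fin)

lemma prefix_closed_par_legal:
  assumes "prefix_closed (Lr A)" "prefix_closed (Lr B)"
  shows "prefix_closed (par_legal A B)"
  unfolding prefix_closed_def
proof (intro ballI allI impI)
  fix \<Gamma> \<Phi> assume *: "\<Gamma> \<in> par_legal A B" "initial_segment \<Phi> \<Gamma>"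
  show "Fin \<Phi> \<in> par_legal A B"
    using * initial_segment_elems[OF *(2)] initial_segment_project[OF *(2)]
      prefix_closedD[OF assms(1)] prefix_closedD[OF assms(2)]
    unfolding par_legal_def mem_Collect_eq project_Fin seq.set by blast
qed

lemma prefix_closed_rec_legal:
  assumes "prefix_closed (Lr A)" shows "prefix_closed (rec_legal A)"
  unfolding prefix_closed_def
proof (intro ballI allI impI)
  fix \<Gamma> \<Phi> assume *: "\<Gamma> \<in> rec_legal A" "initial_segment \<Phi> \<Gamma>"
  show "Fin \<Phi> \<in> rec_legal A"
    using * initial_segment_elems[OF *(2)] initial_segment_project[OF *(2)] prefix_closedD[OF assms(1)]
    unfolding rec_legal_def mem_Collect_eq thread_def project_Fin seq.set by blast
qed

lemma prefix_closed_recT_legal: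
  assumes "prefix_closed (Lr A)" shows "prefix_closed (recT_legal A)"
  unfolding prefix_closed_def
proof (intro ballI allI impI)
  fix \<Gamma> \<Phi> assume *: "\<Gamma> \<in> recT_legal A" "initial_segment \<Phi> \<Gamma>"
  show "Fin \<Phi> \<in> recT_legal A"
    using * initial_segment_prefix[OF *(2)] initial_segment_project[OF *(2)] prefix_closedD[OF assms(1)]
    unfolding recT_legal_def mem_Collect_eq thread_def project_Fin initial_segment.simps by blast
qed

lemma Lr_make_game [simp]: "Lr (make_game L W) = L"
  by (simp add: make_game_def)

lemma prefix_closed_interp:
  assumes "\<And>a. static (I a)" shows "prefix_closed (Lr (interp I F))"
  using assms
  by (induction F)
    (simp_all add: prefix_closed_is_game static_def prefix_closed_neg prefix_closed_par_legal
      prefix_closed_rec_legal prefix_closed_recT_legal game_and_def game_or_def game_rec_def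
      game_corec_def game_recL_def game_recT_def game_corecL_def game_corecT_def)

lemma Fin_Nil_interp:
  assumes "\<And>a. static (I a)" shows "Fin [] \<in> Lr (interp I F)"
proof -
  have "Fin [] \<in> Lr A" if "is_game A" for A
  proof -
    have "Fin [] \<in> Lr A \<longleftrightarrow> (\<forall>\<Phi>. \<Phi> \<noteq> [] \<and> initial_segment \<Phi> (Fin []) \<longrightarrow> Fin \<Phi> \<in> Lr A)"
      using that unfolding is_game_def by blast
    then show ?thesis by simp
  qed
  moreover have "prelegal []" by (rule prelegal.intros)
  ultimately show ?thesis using assms
    by (induction F)
      (simp_all add: static_def par_legal_def rec_legal_def recT_legal_def game_neg_def negate_run_Fin
        thread_def project_Fin game_and_def game_or_def game_rec_def
        game_corec_def game_recL_def game_recT_def game_corecL_def game_corecT_def)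
qed

lemma prelegal_prefix: "prelegal \<Phi> \<Longrightarrow> prefix \<Psi> \<Phi> \<Longrightarrow> prelegal \<Psi>"
proof (induction arbitrary: \<Psi> rule: prelegal.induct)
  case 1
  then show ?case by (simp add: prelegal.intros)
next
  case (2 \<Phi> w)
  then show ?case by (auto intro: prelegal.intros)
next
  case (3 \<Phi> w p \<alpha>)
  then show ?case by (auto intro: prelegal.intros)
qed

abbreviation lthread :: "position \<Rightarrow> inf_bitstring \<Rightarrow> position" where
  "lthread \<Phi> x \<equiv> lproject (strip_thread x) \<Phi>"

lemma thread_Fin: "thread (Fin \<Phi>) x = Fin (lthread \<Phi> x)"
  by (simp add: thread_def project_Fin)

lemma Fin_recT_legal: "Fin \<Phi> \<in> recT_legal A \<longleftrightarrow> prelegal \<Phi> \<and> (\<forall>x. Fin (lthread \<Phi> x) \<in> Lr A)"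
  using prelegal_prefix by (auto simp: recT_legal_def thread_Fin)

lemma Fin_rec_legal:
  "Fin \<Phi> \<in> rec_legal A \<longleftrightarrow>
     (\<forall>(p, \<mu>) \<in> set \<Phi>. \<exists>w \<alpha>. \<mu> = move_at w \<alpha>) \<and> (\<forall>x. Fin (lthread \<Phi> x) \<in> Lr A)"
  by (simp add: rec_legal_def thread_Fin)

section \<open>Reactive strategies\<close>

text \<open>A strategy answers each move of the environment with a finite list of moves before the
  environment can move again.\<close>

primrec play ::
  "('s \<Rightarrow> move \<Rightarrow> move list \<times> 's) \<Rightarrow> 's \<Rightarrow> (nat \<Rightarrow> move option) \<Rightarrow> nat \<Rightarrow> position \<times> 's" where
  "play \<rho> s r 0 = ([], s)"
| "play \<rho> s r (Suc n) = (case play \<rho> s r n of (\<Phi>, t) \<Rightarrow>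
     (case r n of None \<Rightarrow> (\<Phi>, t)
      | Some \<beta> \<Rightarrow> (\<Phi> @ (Environment, \<beta>) # map (Pair Machine) (fst (\<rho> t \<beta>)), snd (\<rho> t \<beta>))))"

text \<open>Rounds in which the environment passes repeat the position, so the limit is a finite run
  if it moves only finitely often.\<close>

definition play_run :: "('s \<Rightarrow> move \<Rightarrow> move list \<times> 's) \<Rightarrow> 's \<Rightarrow> (nat \<Rightarrow> move option) \<Rightarrow> run" where
  "play_run \<rho> s r = seq_limit (\<lambda>n. fst (play \<rho> s r n))"

lemma chain_play: "chain (\<lambda>n. fst (play \<rho> s r n))"
  by (auto simp: chain_def split: prod.split option.split)

text \<open>The obligations on reactions arise only while the environment plays legally. Afterwards
  any reaction is fine, since prefix closure leaves the first illegality with the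
  environment.\<close>

locale safe_strategy =
  fixes L :: "run set" and \<rho> :: "'s \<Rightarrow> move \<Rightarrow> move list \<times> 's" and s0 :: 's
    and Inv :: "position \<Rightarrow> 's \<Rightarrow> bool"
  assumes closed: "prefix_closed L"
    and empty_legal: "Fin [] \<in> L"
    and Inv_init: "Inv [] s0"
    and react_legal: "\<lbrakk>Inv \<Phi> s; Fin \<Phi> \<in> L; Fin (\<Phi> @ [(Environment, \<beta>)]) \<in> L\<rbrakk> \<Longrightarrow>
      Fin (\<Phi> @ (Environment, \<beta>) # map (Pair Machine) (fst (\<rho> s \<beta>))) \<in> L"
    and react_Inv: "\<lbrakk>Inv \<Phi> s; Fin \<Phi> \<in> L; Fin (\<Phi> @ [(Environment, \<beta>)]) \<in> L\<rbrakk> \<Longrightarrow>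
      Inv (\<Phi> @ (Environment, \<beta>) # map (Pair Machine) (fst (\<rho> s \<beta>))) (snd (\<rho> s \<beta>))"
begin

text \<open>Plays only grow, so an offence of the environment remains a prefix of all later stages;
  until one occurs, the obligations renew the invariant.\<close>

lemma play_legal_or_environment_illegal:
  "(Fin (fst (play \<rho> s0 r n)) \<in> L \<and> Inv (fst (play \<rho> s0 r n)) (snd (play \<rho> s0 r n))) \<or>
   (\<exists>\<Psi> \<beta>. prefix (\<Psi> @ [(Environment, \<beta>)]) (fst (play \<rho> s0 r n)) \<and> Fin \<Psi> \<in> L \<and>
      Fin (\<Psi> @ [(Environment, \<beta>)]) \<notin> L)"
proof (induction n)
  case 0
  then show ?case by (simp add: empty_legal Inv_init)
next
  case (Suc n)
  obtain \<Phi> t where p: "play \<rho> s0 r n = (\<Phi>, t)" by fastforce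
  show ?case
  proof (cases "r n")
    case None
    then show ?thesis using Suc by (simp add: p)
  next
    case (Some \<beta>)
    have pre: "prefix (\<Phi> @ [(Environment, \<beta>)]) (fst (play \<rho> s0 r (Suc n)))"
      "prefix \<Phi> (fst (play \<rho> s0 r (Suc n)))"
      by (simp_all add: p Some)
    show ?thesis
    proof (cases "Fin \<Phi> \<in> L \<and> Inv \<Phi> t")
      case False
      then show ?thesis using Suc pre(2) unfolding p by (auto intro: prefix_order.trans)
    next
      case True
      then show ?thesis using pre(1) react_legal[of \<Phi> t \<beta>] react_Inv[of \<Phi> t \<beta>]
        by (cases "Fin (\<Phi> @ [(Environment, \<beta>)]) \<in> L") (auto simp: p Some)
    qed
  qed
qed

lemma not_illegal_by_Machine: "\<not> illegal_by Machine L (play_run \<rho> s0 r)"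
proof
  assume "illegal_by Machine L (play_run \<rho> s0 r)"
  then obtain \<Phi> \<alpha> n where \<Phi>: "prefix (\<Phi> @ [(Machine, \<alpha>)]) (fst (play \<rho> s0 r n))"
      "Fin (\<Phi> @ [(Machine, \<alpha>)]) \<notin> L"
      "\<And>\<Psi>. strict_prefix \<Psi> (\<Phi> @ [(Machine, \<alpha>)]) \<Longrightarrow> Fin \<Psi> \<in> L"
    unfolding illegal_by_def play_run_def initial_segment_seq_limit[OF chain_play] by blast
  then have "Fin (fst (play \<rho> s0 r n)) \<notin> L" using prefix_closed_Fin[OF closed] by blast
  then obtain \<Psi> \<beta> where \<Psi>: "prefix (\<Psi> @ [(Environment, \<beta>)]) (fst (play \<rho> s0 r n))"
      "Fin \<Psi> \<in> L" "Fin (\<Psi> @ [(Environment, \<beta>)]) \<notin> L"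
    using play_legal_or_environment_illegal[of r n] by blast
  \<comment> \<open>Both offences are prefixes of one position, hence comparable, and their last
    moves carry different labels, so one is strictly shorter. That one would be both illegal and
    legal.\<close>
  consider "prefix (\<Psi> @ [(Environment, \<beta>)]) (\<Phi> @ [(Machine, \<alpha>)])"
    | "prefix (\<Phi> @ [(Machine, \<alpha>)]) (\<Psi> @ [(Environment, \<beta>)])"
    using \<Phi>(1) \<Psi>(1) prefix_same_cases by blast
  then show False
  proof cases
    case 1
    then show False using \<Phi>(3)[of "\<Psi> @ [(Environment, \<beta>)]"] \<Psi>(3) by (auto simp: strict_prefix_def)
  next
    case 2
    then have "prefix (\<Phi> @ [(Machine, \<alpha>)]) \<Psi>" by auto
    then show False using \<Phi>(2) \<Psi>(2) prefix_closed_Fin[OF closed] by blast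
  qed
qed

lemma Inv_play:
  assumes "play_run \<rho> s0 r \<in> L"
  shows "Fin (fst (play \<rho> s0 r n)) \<in> L \<and> Inv (fst (play \<rho> s0 r n)) (snd (play \<rho> s0 r n))"
proof -
  have "Fin \<Phi> \<in> L" if "prefix \<Phi> (fst (play \<rho> s0 r n))" for \<Phi>
    using prefix_closedD[OF closed assms] that
    unfolding play_run_def initial_segment_seq_limit[OF chain_play] by blast
  then show ?thesis using play_legal_or_environment_illegal[of r n] by blast
qed

end

section \<open>The two components of an implication\<close>

definition left_of :: "position \<Rightarrow> position" where
  "left_of \<Phi> = lnegate (lproject (strip_prefix ''0.'') \<Phi>)"

definition right_of :: "position \<Rightarrow> position" where
  "right_of \<Phi> = lproject (strip_prefix ''1.'') \<Phi>"

text \<open>Since \<open>left_of\<close> swaps the labels back, it is a position of the antecedent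
  itself. There the machine's moves count as moves of the environment, who alone may split the tree
  of Rec_T.\<close>

lemma Fin_par_legal_neg:
  "Fin \<Phi> \<in> par_legal (game_neg A) B \<longleftrightarrow>
     (\<forall>(p, \<mu>) \<in> set \<Phi>. prefix ''0.'' \<mu> \<or> prefix ''1.'' \<mu>) \<and>
     Fin (left_of \<Phi>) \<in> Lr A \<and> Fin (right_of \<Phi>) \<in> Lr B"
  by (simp add: par_legal_def game_neg_def project_Fin negate_run_Fin left_of_def right_of_def)

lemma thread_left_seq_limit:
  assumes "chain P"
  shows "thread (negate_run (project (strip_prefix ''0.'') (seq_limit P))) x =
    seq_limit (\<lambda>n. lthread (left_of (P n)) x)"
  by (simp add: thread_def left_of_def assms project_seq_limit negate_run_seq_limit chain_lproject
      chain_lnegate)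

lemma thread_right_seq_limit:
  assumes "chain P"
  shows "thread (project (strip_prefix ''1.'') (seq_limit P)) x =
    seq_limit (\<lambda>n. lthread (right_of (P n)) x)"
  by (simp add: thread_def right_of_def assms project_seq_limit chain_lproject)

text \<open>\<open>make_game\<close> awards an illegal run to the machine unless the machine is to
  blame, so the winning conditions have to be compared on legal runs only.\<close>

lemma Wn_or_neg_eq_Machine:
  assumes "\<not> illegal_by Machine (par_legal (game_neg (make_game L V)) (make_game L' W)) \<Gamma>"
    and "\<lbrakk>\<Gamma> \<in> par_legal (game_neg (make_game L V)) (make_game L' W);
      V (negate_run (project (strip_prefix ''0.'') \<Gamma>))\<rbrakk> \<Longrightarrow> W (project (strip_prefix ''1.'') \<Gamma>)"
  shows "Wn (game_or (game_neg (make_game L V)) (make_game L' W)) \<Gamma> = Machine"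
  using assms by (auto simp: game_or_def make_game_def game_neg_def par_legal_def)


section \<open>Syntax of moves\<close>

lemma bit_char_simps [simp]:
  "bit_char b = bit_char c \<longleftrightarrow> b = c" "bit_char b \<noteq> CHR ''.''" "CHR ''.'' \<noteq> bit_char b"
  "bit_char b \<noteq> CHR '':''" "CHR '':'' \<noteq> bit_char b"
  by (auto simp: bit_char_def)

lemma map_bit_char_eq_iff [simp]: "map bit_char v = map bit_char w \<longleftrightarrow> v = w"
  by (simp add: inj_def inj_map_eq_map)

lemma replicative_eq_iff [simp]: "replicative v = replicative w \<longleftrightarrow> v = w"
  by (simp add: replicative_def)

lemma move_at_neq_replicative [simp]: "move_at w \<alpha> \<noteq> replicative v" "replicative v \<noteq> move_at w \<alpha>"
proof -
  have "CHR ''.'' \<in> set (move_at w \<alpha>)" "CHR ''.'' \<notin> set (replicative v)"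
    by (auto simp: move_at_def replicative_def)
  then show "move_at w \<alpha> \<noteq> replicative v" "replicative v \<noteq> move_at w \<alpha>" by metis+
qed

lemma strip_thread_replicative [simp]: "strip_thread x (replicative w) = None"
proof (cases "strip_thread x (replicative w)")
  case (Some \<beta>)
  then show ?thesis by (auto simp: strip_thread_eq_Some_iff)
qed

lemma strip_prefix_01 [simp]:
  "strip_prefix ''0.'' (CHR ''0'' # CHR ''.'' # \<alpha>) = Some \<alpha>"
  "strip_prefix ''1.'' (CHR ''1'' # CHR ''.'' # \<alpha>) = Some \<alpha>"
  "strip_prefix ''0.'' (CHR ''1'' # \<alpha>) = None"
  "strip_prefix ''1.'' (CHR ''0'' # \<alpha>) = None"
  by (simp_all add: strip_prefix_def)

lemma left_of_append [simp]: "left_of (\<Phi> @ \<Psi>) = left_of \<Phi> @ left_of \<Psi>"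
  by (simp add: left_of_def)

lemma right_of_append [simp]: "right_of (\<Phi> @ \<Psi>) = right_of \<Phi> @ right_of \<Psi>"
  by (simp add: right_of_def)

lemma left_of_Nil [simp]: "left_of [] = []"
  by (simp add: left_of_def)

lemma right_of_Nil [simp]: "right_of [] = []"
  by (simp add: right_of_def)

lemma left_of_Cons [simp]:
  "left_of ((p, CHR ''0'' # CHR ''.'' # \<alpha>) # \<Phi>) = (opponent p, \<alpha>) # left_of \<Phi>"
  "left_of ((p, CHR ''1'' # CHR ''.'' # \<alpha>) # \<Phi>) = left_of \<Phi>"
  by (simp_all add: left_of_def)

lemma right_of_Cons [simp]:
  "right_of ((p, CHR ''1'' # CHR ''.'' # \<alpha>) # \<Phi>) = (p, \<alpha>) # right_of \<Phi>"
  "right_of ((p, CHR ''0'' # CHR ''.'' # \<alpha>) # \<Phi>) = right_of \<Phi>"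
  by (simp_all add: right_of_def)

lemma prefix_01_cases:
  assumes "prefix ''0.'' \<beta> \<or> prefix ''1.'' \<beta>"
  obtains (left) \<gamma> where "\<beta> = CHR ''0'' # CHR ''.'' # \<gamma>" | (right) \<gamma> where "\<beta> = CHR ''1'' # CHR ''.'' # \<gamma>"
  using assms by (auto simp: prefix_def)

lemma tree_append:
  "tree (\<Phi> @ \<Psi>) = tree \<Phi> \<union> {w @ [b] | w b. (Environment, replicative w) \<in> set \<Psi>}"
  by (auto simp: tree_def)

lemma prelegal_snocE:
  assumes "prelegal (\<Phi> @ [(p, \<mu>)])"
  obtains (replicate) w where "p = Environment" "\<mu> = replicative w" "leaf (tree \<Phi>) w"
  | (move) w \<alpha> where "\<mu> = move_at w \<alpha>" "w \<in> tree \<Phi>"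
  using assms by (cases rule: prelegal.cases) auto

section \<open>From Rec\_T to Rec\_L\<close>

text \<open>The machine keeps the left tree complete, splitting all its leaves once for every character of a
  move of the environment. The node of every move made on the right then exists on the left,
  so that moves can be copied verbatim.\<close>

definition expand :: "bitstring list \<Rightarrow> bitstring list" where
  "expand ls = map (\<lambda>w. w @ [False]) ls @ map (\<lambda>w. w @ [True]) ls"

primrec expansions :: "nat \<Rightarrow> bitstring list \<Rightarrow> move list \<times> bitstring list" where
  "expansions 0 ls = ([], ls)"
| "expansions (Suc k) ls =
     (map (\<lambda>w. ''0.'' @ replicative w) ls @ fst (expansions k (expand ls)), snd (expansions k (expand ls)))"

fun flip_side :: "move \<Rightarrow> move" where
  "flip_side [] = []"
| "flip_side (c # cs) = (if c = CHR ''0'' then CHR ''1'' else CHR ''0'') # cs"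

text \<open>The text of a legal move is longer than the node it addresses, so this many rounds of
  splitting suffice, whichever side the move was made on. The splits precede the copy, which may
  need the new nodes.\<close>

definition react_TL :: "bitstring list \<Rightarrow> move \<Rightarrow> move list \<times> bitstring list" where
  "react_TL ls \<beta> = (fst (expansions (length \<beta>) ls) @ [flip_side \<beta>], snd (expansions (length \<beta>) ls))"

definition complete_tree :: "nat \<Rightarrow> position \<Rightarrow> bitstring list \<Rightarrow> bool" where
  "complete_tree n \<Phi> ls \<longleftrightarrow> prelegal \<Phi> \<and> tree \<Phi> = {w. length w \<le> n} \<and> distinct ls \<and> set ls = {w. length w = n}"

text \<open>Splitting a leaf adds nodes below that leaf only, so the other nodes of length
  \<open>n\<close> stay leaves. Distinctness matters because a node that has been split may not be
  split again.\<close>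

lemma prelegal_replicate_leaves:
  assumes "prelegal \<Phi>" "tree \<Phi> = {w. length w \<le> n}" "distinct ls" "set ls \<subseteq> {w. length w = n}"
  shows "prelegal (\<Phi> @ map (\<lambda>w. (Environment, replicative w)) ls)"
  using assms(3,4)
proof (induction ls rule: rev_induct)
  case Nil
  then show ?case using assms(1) by simp
next
  case (snoc w ls)
  have "leaf (tree (\<Phi> @ map (\<lambda>w. (Environment, replicative w)) ls)) w"
    using snoc.prems assms(2) by (auto simp: leaf_def tree_append)
  then show ?case using prelegal.intros(2)[of "\<Phi> @ map (\<lambda>w. (Environment, replicative w)) ls" w] snoc
    by simp
qed

lemma complete_tree_expand:
  assumes "complete_tree n \<Phi> ls"
  shows "complete_tree (Suc n) (\<Phi> @ map (\<lambda>w. (Environment, replicative w)) ls) (expand ls)"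
proof -
  have ex: "length w = Suc n \<longleftrightarrow> (\<exists>v b. w = v @ [b] \<and> length v = n)" for w :: bitstring
    by (cases w rule: rev_cases) auto
  have "set (expand ls) = {w. length w = Suc n}"
    using assms unfolding complete_tree_def expand_def ex by (auto simp: ex_bool_eq)
  moreover have "distinct (expand ls)"
    using assms by (auto simp: complete_tree_def expand_def distinct_map inj_on_def)
  moreover have "tree (\<Phi> @ map (\<lambda>w. (Environment, replicative w)) ls) = {w. length w \<le> Suc n}"
  proof -
    have "{w @ [b] | w b. (Environment, replicative w) \<in> set (map (\<lambda>w. (Environment, replicative w)) ls)}
        = {w. length w = Suc n}"
      using assms unfolding complete_tree_def ex by auto
    then show ?thesis using assms unfolding complete_tree_def tree_append by auto
  qed
  moreover have "prelegal (\<Phi> @ map (\<lambda>w. (Environment, replicative w)) ls)"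
    using assms unfolding complete_tree_def by (intro prelegal_replicate_leaves) auto
  ultimately show ?thesis by (simp add: complete_tree_def)
qed

lemma left_of_replicative:
  "left_of (map (\<lambda>w. (Machine, CHR ''0'' # CHR ''.'' # replicative w)) ls) =
     map (\<lambda>w. (Environment, replicative w)) ls"
  by (induction ls) auto

lemma right_of_replicative:
  "right_of (map (\<lambda>w. (Machine, CHR ''0'' # CHR ''.'' # replicative w)) ls) = []"
  by (induction ls) auto

lemma lthread_replicative: "lthread (map (\<lambda>w. (Environment, replicative w)) ls) x = []"
  by (induction ls) auto

lemma expansions_complete_tree:
  "complete_tree n \<Phi> ls \<Longrightarrow>
     complete_tree (n + k) (\<Phi> @ left_of (map (Pair Machine) (fst (expansions k ls)))) (snd (expansions k ls))"
proof (induction k arbitrary: n \<Phi> ls)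
  case 0
  then show ?case by simp
next
  case (Suc k)
  from Suc.IH[OF complete_tree_expand[OF Suc.prems]] show ?case
    by (simp add: comp_def left_of_replicative)
qed

lemma right_of_expansions: "right_of (map (Pair Machine) (fst (expansions k ls))) = []"
  by (induction k arbitrary: ls) (simp_all add: comp_def right_of_replicative)

lemma lthread_expansions: "lthread (left_of (map (Pair Machine) (fst (expansions k ls)))) x = []"
  by (induction k arbitrary: ls) (simp_all add: comp_def left_of_replicative lthread_replicative)

lemma prefix_expansions: "\<mu> \<in> set (fst (expansions k ls)) \<Longrightarrow> prefix ''0.'' \<mu>"
  by (induction k arbitrary: ls) (auto simp: prefix_def)

definition Inv_TL :: "position \<Rightarrow> bitstring list \<Rightarrow> bool" where
  "Inv_TL \<Phi> ls \<longleftrightarrow> (\<exists>n. complete_tree n (left_of \<Phi>) ls) \<and> (\<forall>x. lthread (left_of \<Phi>) x = lthread (right_of \<Phi>) x)"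

abbreviation (input) legal_TL :: "game \<Rightarrow> run set" where
  "legal_TL A \<equiv> par_legal (game_neg (game_recT A)) (game_recL A)"

lemma Lr_game_recT [simp]: "Lr (game_recT A) = recT_legal A"
  by (simp add: game_recT_def)

lemma Lr_game_recL [simp]: "Lr (game_recL A) = rec_legal A"
  by (simp add: game_recL_def)

lemma complete_tree_move:
  "complete_tree n \<Phi> ls \<Longrightarrow> length w \<le> n \<Longrightarrow> complete_tree n (\<Phi> @ [(p, move_at w \<alpha>)]) ls"
  by (auto simp: complete_tree_def tree_append intro: prelegal.intros)

lemma react_TL_step:
  assumes Inv: "Inv_TL \<Phi> ls" and legal: "Fin \<Phi> \<in> legal_TL A"
    and legal': "Fin (\<Phi> @ [(Environment, \<beta>)]) \<in> legal_TL A"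
  defines "\<Phi>' \<equiv> \<Phi> @ (Environment, \<beta>) # map (Pair Machine) (fst (react_TL ls \<beta>))"
  shows "Fin \<Phi>' \<in> legal_TL A" and "Inv_TL \<Phi>' (snd (react_TL ls \<beta>))"
proof -
  obtain n where n: "complete_tree n (left_of \<Phi>) ls" and
    eq: "\<And>x. lthread (left_of \<Phi>) x = lthread (right_of \<Phi>) x"
    using Inv by (auto simp: Inv_TL_def)
  define \<Psi> where "\<Psi> = map (Pair Machine) (fst (expansions (length \<beta>) ls))"
  have \<Phi>': "\<Phi>' = \<Phi> @ (Environment, \<beta>) # \<Psi> @ [(Machine, flip_side \<beta>)]"
    by (simp add: \<Phi>'_def \<Psi>_def react_TL_def)
  have \<Psi>: "right_of \<Psi> = []" "\<And>x. lthread (left_of \<Psi>) x = []" "\<forall>(p, \<mu>)\<in>set \<Psi>. prefix ''0.'' \<mu>"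
    using prefix_expansions unfolding \<Psi>_def by (auto simp: right_of_expansions lthread_expansions)
  have "prefix ''0.'' \<beta> \<or> prefix ''1.'' \<beta>"
    using legal' by (simp add: Fin_par_legal_neg)
  then have "Fin \<Phi>' \<in> legal_TL A \<and> Inv_TL \<Phi>' (snd (react_TL ls \<beta>))"
  proof (cases rule: prefix_01_cases)
    case (left \<gamma>)
    from legal' have pl: "prelegal (left_of \<Phi> @ [(Machine, \<gamma>)])"
      and th: "\<And>x. Fin (lthread (left_of \<Phi> @ [(Machine, \<gamma>)]) x) \<in> Lr A"
      by (simp_all add: Fin_par_legal_neg Fin_recT_legal left)
    \<comment> \<open>In the antecedent the environment's move is labelled \<open>Machine\<close>,
      and only \<open>Environment\<close> may replicate; this excludes the other case.\<close>
    from pl obtain w \<alpha> where \<gamma>: "\<gamma> = move_at w \<alpha>" "w \<in> tree (left_of \<Phi>)"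
      by (cases rule: prelegal_snocE) auto
    then have "complete_tree n (left_of \<Phi> @ [(Machine, \<gamma>)]) ls"
      using complete_tree_move[OF n] n unfolding complete_tree_def by auto
    from expansions_complete_tree[OF this, of "length \<beta>"]
    have c: "complete_tree (n + length \<beta>) (left_of \<Phi> @ (Machine, \<gamma>) # left_of \<Psi>) (snd (react_TL ls \<beta>))"
      by (simp add: \<Psi>_def react_TL_def)
    then show ?thesis using legal legal' eq th \<Psi>
      by (auto simp: \<Phi>' left Fin_par_legal_neg Inv_TL_def Fin_rec_legal Fin_recT_legal complete_tree_def \<gamma>)
  next
    case (right \<gamma>)
    from legal' have mv: "\<exists>w \<alpha>. \<gamma> = move_at w \<alpha>"
      and th: "\<And>x. Fin (lthread (right_of \<Phi> @ [(Environment, \<gamma>)]) x) \<in> Lr A"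
      by (simp_all add: Fin_par_legal_neg Fin_rec_legal right)
    from mv obtain w \<alpha> where \<gamma>: "\<gamma> = move_at w \<alpha>" by blast
    have "complete_tree (n + length \<beta>) (left_of \<Phi> @ left_of \<Psi>) (snd (react_TL ls \<beta>))"
      using expansions_complete_tree[OF n, of "length \<beta>"] by (simp add: \<Psi>_def react_TL_def)
    \<comment> \<open>The bits of \<open>w\<close> are part of the text of \<beta>, so after
      \<open>length \<beta>\<close> rounds of splitting \<open>w\<close> is a node of the left
      tree.\<close>
    then have c: "complete_tree (n + length \<beta>) ((left_of \<Phi> @ left_of \<Psi>) @ [(Environment, \<gamma>)]) (snd (react_TL ls \<beta>))"
      unfolding \<gamma> by (rule complete_tree_move) (simp add: right \<gamma> move_at_def)
    then show ?thesis using legal legal' eq th \<Psi>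
      by (auto simp: \<Phi>' right Fin_par_legal_neg Inv_TL_def Fin_rec_legal Fin_recT_legal complete_tree_def)
  qed
  then show "Fin \<Phi>' \<in> legal_TL A" and "Inv_TL \<Phi>' (snd (react_TL ls \<beta>))" by auto
qed

lemma play_TL_wins:
  assumes "prefix_closed (Lr A)" and "Fin [] \<in> Lr A"
  shows "Wn (game_or (game_neg (game_recT A)) (game_recL A)) (play_run react_TL [[]] r) = Machine"
proof -
  interpret safe_strategy "legal_TL A" react_TL "[[]]" Inv_TL
  proof
    show "prefix_closed (legal_TL A)"
      using assms(1) by (intro prefix_closed_par_legal prefix_closed_neg)
        (simp_all add: prefix_closed_rec_legal prefix_closed_recT_legal)
    show "Fin [] \<in> legal_TL A"
      by (simp add: Fin_par_legal_neg Fin_rec_legal Fin_recT_legal assms(2) prelegal.intros)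
    show "Inv_TL [] [[]]"
      by (auto simp: Inv_TL_def complete_tree_def tree_def prelegal.intros intro!: exI[of _ 0])
  qed (fact react_TL_step)+
  show ?thesis
    unfolding game_recT_def game_recL_def
  proof (rule Wn_or_neg_eq_Machine, fold game_recT_def game_recL_def)
    show "\<not> illegal_by Machine (legal_TL A) (play_run react_TL [[]] r)"
      by (rule not_illegal_by_Machine)
  next
    assume "play_run react_TL [[]] r \<in> legal_TL A"
    then have "thread (negate_run (project (strip_prefix ''0.'') (play_run react_TL [[]] r))) x =
        thread (project (strip_prefix ''1.'') (play_run react_TL [[]] r)) x" for x
      using Inv_play[of r] unfolding play_run_def thread_left_seq_limit[OF chain_play]
        thread_right_seq_limit[OF chain_play] Inv_TL_def by simp
    then show "\<forall>v. essentially_finite v \<longrightarrow>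
          Wn A (thread (negate_run (project (strip_prefix ''0.'') (play_run react_TL [[]] r))) v) = Machine \<Longrightarrow>
        \<forall>v. essentially_finite v \<longrightarrow>
          Wn A (thread (project (strip_prefix ''1.'') (play_run react_TL [[]] r)) v) = Machine"
      by simp
  qed
qed


section \<open>From Rec\_L to Rec\_T\<close>

text \<open>Every leaf of the right tree is matched with a cone of left threads. An entry lists the bits of
  the left address of such a cone, with \<open>None\<close> for the zeros that were appended to it as padding;
  dropping these yields the address of the leaf. Since every address is padded before each reply,
  the moves of the environment on the left never separate the threads of a cone.\<close>

type_synonym entry = "bool option list"

definition left_addr :: "entry \<Rightarrow> bitstring" where
  "left_addr = map (\<lambda>b. b = Some True)"

definition right_addr :: "entry \<Rightarrow> bitstring" where
  "right_addr = List.map_filter id"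

lemma left_addr_simps [simp]:
  "left_addr [] = []" "left_addr (b # e) = (b = Some True) # left_addr e"
  "left_addr (e @ e') = left_addr e @ left_addr e'"
  "length (left_addr e) = length e"
  by (simp_all add: left_addr_def)

lemma right_addr_simps [simp]:
  "right_addr [] = []" "right_addr (None # e) = right_addr e" "right_addr (Some b # e) = b # right_addr e"
  "right_addr (e @ e') = right_addr e @ right_addr e'"
  "right_addr (replicate k None) = []"
  by (simp_all add: right_addr_def List.map_filter_def filter_replicate)

text \<open>Padding contributes zeros on the left and nothing on the right. This equality of the
  numbers of ones is the source of essential finiteness in the limit.\<close>

lemma length_filter_addr: "length (filter id (left_addr e)) = length (filter id (right_addr e))"
proof (induction e)
  case (Cons b e)
  then show ?case by (cases b) auto
qed simp

text \<open>A dot may be met anywhere along the address, since a move at a node concerns all leaves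
  below it. A colon counts only once the address is used up, since a split concerns exactly one
  leaf; met earlier it is a mismatch.\<close>

fun advance :: "bitstring \<Rightarrow> string \<Rightarrow> string option" where
  "advance [] cs = Some cs"
| "advance (b # u) [] = None"
| "advance (b # u) (c # cs) =
     (if c = bit_char b then advance u cs else if c = CHR ''.'' then Some (c # cs) else None)"

text \<open>The flag tells on which side the environment moved, \<open>True\<close> meaning the
  right. So \<open>key d\<close> is the address to be matched and \<open>key (\<not> d)\<close> the
  one used in the reply.\<close>

definition key :: "bool \<Rightarrow> entry \<Rightarrow> bitstring" where
  "key d e = (if d then right_addr e else left_addr e)"

definition reply :: "bool \<Rightarrow> string \<Rightarrow> entry \<Rightarrow> move list" where
  "reply d \<gamma> e = (case advance (key d e) \<gamma> of Some (c # \<alpha>) \<Rightarrow>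
     if c = CHR ''.'' then [bit_char (\<not> d) # CHR ''.'' # move_at (key (\<not> d) e) \<alpha>] else [] | _ \<Rightarrow> [])"

definition splits :: "bool \<Rightarrow> string \<Rightarrow> entry \<Rightarrow> bool" where
  "splits d \<gamma> e \<longleftrightarrow> (\<exists>\<alpha>. advance (key d e) \<gamma> = Some (CHR '':'' # \<alpha>))"

definition split_entries :: "(entry \<Rightarrow> bool) \<Rightarrow> entry list \<Rightarrow> entry list" where
  "split_entries Q s =
     map (\<lambda>e. if Q e then e @ [Some False] else e) s @ map (\<lambda>e. e @ [Some True]) (filter Q s)"

definition answer :: "bool \<Rightarrow> string \<Rightarrow> entry list \<Rightarrow> move list \<times> entry list" where
  "answer d \<gamma> s = (concat (map (reply d \<gamma>) s), split_entries (splits d \<gamma>) s)"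

definition pad :: "nat \<Rightarrow> entry list \<Rightarrow> entry list" where
  "pad k = map (\<lambda>e. e @ replicate k None)"

text \<open>Padding precedes matching, so that a left move is compared with addresses longer than
  its node.\<close>

definition react_LT :: "entry list \<Rightarrow> move \<Rightarrow> move list \<times> entry list" where
  "react_LT s \<beta> =
     (if prefix ''0.'' \<beta> then answer False (drop 2 \<beta>) (pad (length \<beta>) s)
      else if prefix ''1.'' \<beta> then answer True (drop 2 \<beta>) (pad (length \<beta>) s)
      else ([], pad (length \<beta>) s))"

section \<open>Matching addresses against the two kinds of moves\<close>

lemma advance_move_at:
  "advance u (move_at w \<alpha>) = Some (CHR ''.'' # \<delta>) \<longleftrightarrow> prefix w u \<and> \<delta> = \<alpha>"
proof (induction u arbitrary: w)
  case Nil
  show ?case by (cases w) (auto simp: move_at_def)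
next
  case (Cons b u)
  show ?case
  proof (cases w)
    case Nil
    then show ?thesis by (auto simp: move_at_def)
  next
    case (Cons a w')
    then show ?thesis using Cons.IH[of w'] by (auto simp: move_at_def)
  qed
qed

lemma advance_move_at_no_colon: "advance u (move_at w \<alpha>) \<noteq> Some (CHR '':'' # \<delta>)"
proof (induction u arbitrary: w)
  case Nil
  show ?case by (cases w) (auto simp: move_at_def)
next
  case (Cons b u)
  show ?case
  proof (cases w)
    case Nil
    then show ?thesis by (auto simp: move_at_def)
  next
    case (Cons a w')
    then show ?thesis using Cons.IH[of w'] by (auto simp: move_at_def)
  qed
qed

lemma advance_replicative:
  "advance u (replicative w) = Some (CHR '':'' # \<delta>) \<longleftrightarrow> w = u \<and> \<delta> = []"
  "advance u (replicative w) \<noteq> Some (CHR ''.'' # \<delta>)"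
proof (induction u arbitrary: w)
  case Nil
  show "advance [] (replicative w) = Some (CHR '':'' # \<delta>) \<longleftrightarrow> w = [] \<and> \<delta> = []" for w
    by (cases w) (auto simp: replicative_def)
  show "advance [] (replicative w) \<noteq> Some (CHR ''.'' # \<delta>)" for w
    by (cases w) (auto simp: replicative_def)
next
  case (Cons b u)
  show "advance (b # u) (replicative w) = Some (CHR '':'' # \<delta>) \<longleftrightarrow> w = b # u \<and> \<delta> = []" for w
    by (cases w) (use Cons in \<open>auto simp: replicative_def\<close>)
  show "advance (b # u) (replicative w) \<noteq> Some (CHR ''.'' # \<delta>)" for w
    by (cases w) (use Cons in \<open>auto simp: replicative_def\<close>)
qed

lemma no_reply:
  "(\<And>\<delta>. m \<noteq> Some (CHR ''.'' # \<delta>)) \<Longrightarrow>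
     (case m of Some (c # \<alpha>) \<Rightarrow> if c = CHR ''.'' then f \<alpha> else [] | _ \<Rightarrow> []) = []"
  by (simp split: option.split list.split)

lemma answer_move_at:
  "answer d (move_at w \<alpha>) s =
     (map (\<lambda>e. bit_char (\<not> d) # CHR ''.'' # move_at (key (\<not> d) e) \<alpha>) (filter (\<lambda>e. prefix w (key d e)) s), s)"
proof -
  have "reply d (move_at w \<alpha>) e =
      (if prefix w (key d e) then [bit_char (\<not> d) # CHR ''.'' # move_at (key (\<not> d) e) \<alpha>] else [])" for e
  proof (cases "prefix w (key d e)")
    case True
    then have "advance (key d e) (move_at w \<alpha>) = Some (CHR ''.'' # \<alpha>)" by (simp add: advance_move_at)
    then show ?thesis using True by (simp add: reply_def)
  next
    case False
    then have "advance (key d e) (move_at w \<alpha>) \<noteq> Some (CHR ''.'' # \<delta>)" for \<delta>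
      by (simp add: advance_move_at)
    then have "reply d (move_at w \<alpha>) e = []" unfolding reply_def by (rule no_reply)
    then show ?thesis using False by simp
  qed
  then have "concat (map (reply d (move_at w \<alpha>)) s) =
     map (\<lambda>e. bit_char (\<not> d) # CHR ''.'' # move_at (key (\<not> d) e) \<alpha>) (filter (\<lambda>e. prefix w (key d e)) s)"
    by (induction s) auto
  then show ?thesis by (simp add: answer_def splits_def advance_move_at_no_colon split_entries_def)
qed

lemma answer_replicative:
  "answer d (replicative w) s = ([], split_entries (\<lambda>e. key d e = w) s)"
proof -
  have "reply d (replicative w) e = []" for e
    unfolding reply_def by (rule no_reply) (rule advance_replicative(2))
  moreover have "splits d (replicative w) = (\<lambda>e. key d e = w)"
    by (auto simp: splits_def advance_replicative(1))
  ultimately show ?thesis by (simp add: answer_def)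
qed

section \<open>Finite addresses on infinite threads\<close>

definition on_path :: "bitstring \<Rightarrow> inf_bitstring \<Rightarrow> bool" where
  "on_path w x \<longleftrightarrow> (\<forall>i<length w. w ! i = x i)"

lemma on_path_iff: "on_path w x \<longleftrightarrow> w = map x [0..<length w]"
  using initial_segment_Infin_iff[of w x] unfolding on_path_def initial_segment.simps by (rule sym)

lemma on_path_prefix: "on_path w x \<Longrightarrow> prefix v w \<Longrightarrow> on_path v x"
  unfolding on_path_def initial_segment_Infin_iff[symmetric] by (rule initial_segment_prefix)

lemma on_path_comparable:
  assumes "on_path v x" "on_path w x" "length v \<le> length w" shows "prefix v w"
proof -
  have "v = take (length v) w"
    by (rule nth_equalityI) (use assms in \<open>auto simp: on_path_def\<close>)
  then show ?thesis by (metis take_is_prefix)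
qed

lemma on_path_not_parallel: "on_path v x \<Longrightarrow> on_path w x \<Longrightarrow> \<not> v \<parallel> w"
  using on_path_comparable[of v x w] on_path_comparable[of w x v] linear[of "length v" "length w"]
  by (auto simp: parallel_def)

lemma ex_on_path: "\<exists>x. on_path w x"
  by (rule exI[of _ "\<lambda>i. w ! i"]) (simp add: on_path_def)

lemma on_path_snoc: "on_path (w @ [b]) x \<longleftrightarrow> on_path w x \<and> b = x (length w)"
  by (auto simp: on_path_def nth_append less_Suc_eq)

lemma strip_thread_move_at: "strip_thread x (move_at w \<alpha>) = (if on_path w x then Some \<alpha> else None)"
proof (cases "on_path w x")
  case True
  then have "w = map x [0..<length w]" by (simp only: on_path_iff)
  then have "strip_thread x (move_at w \<alpha>) = Some \<alpha>"
    unfolding strip_thread_eq_Some_iff by (intro exI[of _ "length w"]) (rule arg_cong)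
  then show ?thesis using True by simp
next
  case False
  have "strip_thread x (move_at w \<alpha>) \<noteq> Some \<beta>" for \<beta>
  proof
    assume "strip_thread x (move_at w \<alpha>) = Some \<beta>"
    then obtain n where n: "move_at w \<alpha> = move_at (map x [0..<n]) \<beta>"
      unfolding strip_thread_eq_Some_iff by blast
    have "takeWhile (\<lambda>c. c \<noteq> CHR ''.'') (move_at v \<delta>) = map bit_char v" for v \<delta>
      by (induction v) (auto simp: move_at_def)
    then have "map bit_char w = map bit_char (map x [0..<n])" using n by metis
    then have "w = map x [0..<n]" by (simp only: map_bit_char_eq_iff)
    then show False using False by (simp add: on_path_def)
  qed
  then show ?thesis using False by (cases "strip_thread x (move_at w \<alpha>)") auto
qed

text \<open>Incomparability on the left keeps the cones disjoint; on the right it makes the entry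
  over a thread unique. It survives every extension of the entries, hence padding and
  splitting.\<close>

definition independent :: "entry \<Rightarrow> entry \<Rightarrow> bool" where
  "independent e e' \<longleftrightarrow> left_addr e \<parallel> left_addr e' \<and> right_addr e \<parallel> right_addr e'"

lemma independent_sym: "independent e e' \<Longrightarrow> independent e' e"
  by (auto simp: independent_def parallel_def)

lemma independent_append: "independent e e' \<Longrightarrow> independent (e @ d) (e' @ d')"
  by (auto simp: independent_def intro: parallel_append)

lemma independent_split: "independent (e @ [Some False]) (e @ [Some True])"
  by (simp add: independent_def parallel_def)

lemma sorted_wrt_independentD:
  "sorted_wrt independent s \<Longrightarrow> e \<in> set s \<Longrightarrow> e' \<in> set s \<Longrightarrow> e \<noteq> e' \<Longrightarrow> independent e e'"
  by (induction s) (auto intro: independent_sym)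

lemma unique_left_entry:
  assumes "sorted_wrt independent s" "e \<in> set s" "e' \<in> set s"
    "on_path (left_addr e) x" "on_path (left_addr e') x"
  shows "e = e'"
  using sorted_wrt_independentD[OF assms(1-3)] on_path_not_parallel[OF assms(4,5)]
  by (auto simp: independent_def)

lemma unique_right_entry:
  assumes "sorted_wrt independent s" "e \<in> set s" "e' \<in> set s"
    "on_path (right_addr e) x" "on_path (right_addr e') x"
  shows "e = e'"
  using sorted_wrt_independentD[OF assms(1-3)] on_path_not_parallel[OF assms(4,5)]
  by (auto simp: independent_def)

text \<open>The right addresses are the leaves of a full binary tree. The left cones are merely
  disjoint, because padding gives up the sibling cones.\<close>

definition covering :: "entry list \<Rightarrow> bool" where
  "covering s \<longleftrightarrow> sorted_wrt independent s \<and> (\<forall>y. \<exists>e\<in>set s. on_path (right_addr e) y)"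

definition right_nodes :: "entry list \<Rightarrow> bitstring set" where
  "right_nodes s = {w. \<exists>e\<in>set s. prefix w (right_addr e)}"

lemma covering_pad: "covering s \<Longrightarrow> covering (pad k s)"
  by (auto simp: covering_def pad_def sorted_wrt_map intro: independent_append
      elim!: sorted_wrt_mono_rel[rotated])

lemma right_nodes_pad [simp]: "right_nodes (pad k s) = right_nodes s"
  by (simp add: right_nodes_def pad_def)

lemma covering_split:
  assumes "covering s" shows "covering (split_entries Q s)"
proof -
  have sorted: "sorted_wrt independent s" using assms by (simp add: covering_def)
  have "sorted_wrt independent (split_entries Q s)"
    unfolding split_entries_def sorted_wrt_append
  proof (intro conjI ballI)
    show "sorted_wrt independent (map (\<lambda>e. if Q e then e @ [Some False] else e) s)"
      unfolding sorted_wrt_map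
      by (rule sorted_wrt_mono_rel[OF _ sorted])
        (use independent_append[where d = "[]"] independent_append[where d' = "[]"] independent_append in auto)
    show "sorted_wrt independent (map (\<lambda>e. e @ [Some True]) (filter Q s))"
      unfolding sorted_wrt_map
      by (rule sorted_wrt_mono_rel[OF _ sorted_wrt_filter[OF sorted]]) (rule independent_append)
    fix a b assume "a \<in> set (map (\<lambda>e. if Q e then e @ [Some False] else e) s)"
      "b \<in> set (map (\<lambda>e. e @ [Some True]) (filter Q s))"
    then obtain e e' where e: "e \<in> set s" "a = (if Q e then e @ [Some False] else e)"
      "e' \<in> set s" "Q e'" "b = e' @ [Some True]" by auto
    show "independent a b"
    proof (cases "e = e'")
      case True
      then show ?thesis using e independent_split by simp
    next
      case False
      then have "independent e e'" using sorted e sorted_wrt_independentD by blast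
      then show ?thesis unfolding e(2,5)
        using independent_append[of e e' "[]" "[Some True]"] independent_append[of e e'] by simp
    qed
  qed
  moreover have "\<exists>e\<in>set (split_entries Q s). on_path (right_addr e) y" for y
  proof -
    obtain e where e: "e \<in> set s" "on_path (right_addr e) y" using assms by (auto simp: covering_def)
    consider "\<not> Q e" | "Q e" "y (length (right_addr e))" | "Q e" "\<not> y (length (right_addr e))" by blast
    then show ?thesis
    proof cases
      case 1
      then show ?thesis using e by (intro bexI[of _ e]) (auto simp: split_entries_def)
    next
      case 2
      then show ?thesis using e by (intro bexI[of _ "e @ [Some True]"]) (auto simp: split_entries_def on_path_snoc)
    next
      case 3
      then show ?thesis using e by (intro bexI[of _ "e @ [Some False]"]) (auto simp: split_entries_def on_path_snoc)
    qed
  qed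
  ultimately show ?thesis by (simp add: covering_def)
qed

lemma prefix_pad: "e' \<in> set (pad k s) \<Longrightarrow> \<exists>e\<in>set s. prefix e e'"
  unfolding pad_def by (auto intro: prefixI)

lemma prefix_split_entries: "e' \<in> set (split_entries Q s) \<Longrightarrow> \<exists>e\<in>set s. prefix e e'"
  by (auto simp: split_entries_def split: if_splits)

text \<open>Since entries only get longer, those over a fixed right thread form a chain, from which
  the matching left thread is obtained.\<close>

lemma prefix_react_LT:
  assumes "e' \<in> set (snd (react_LT s \<beta>))" shows "\<exists>e\<in>set s. prefix e e'"
proof -
  have "\<exists>e\<in>set (pad (length \<beta>) s). prefix e e'"
    using assms prefix_split_entries
    by (cases "e' \<in> set (pad (length \<beta>) s)") (auto simp: react_LT_def answer_def split: if_splits)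
  then show ?thesis using prefix_pad prefix_order.trans by metis
qed


section \<open>What a batch of replies contributes to one thread\<close>

lemma lthread_moves_none:
  "(\<And>e. e \<in> set es \<Longrightarrow> \<not> on_path (f e) x) \<Longrightarrow> lthread (map (\<lambda>e. (p, move_at (f e) \<alpha>)) es) x = []"
  by (induction es) (auto simp: strip_thread_move_at)

lemma lthread_moves_one:
  assumes "sorted_wrt (\<lambda>e e'. f e \<parallel> f e') es" "e \<in> set es" "on_path (f e) x"
  shows "lthread (map (\<lambda>e. (p, move_at (f e) \<alpha>)) es) x = [(p, \<alpha>)]"
  using assms
proof (induction es)
  case (Cons a es)
  show ?case
  proof (cases "on_path (f a) x")
    case True
    have "\<not> on_path (f e') x" if "e' \<in> set es" for e'
      using Cons.prems(1) that on_path_not_parallel[OF True] by auto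
    then show ?thesis using True by (simp add: strip_thread_move_at lthread_moves_none)
  next
    case False
    then show ?thesis using Cons by (auto simp: strip_thread_move_at)
  qed
qed simp

text \<open>A thread through the address of \<open>e\<close> meets no other address, by
  incomparability, so it receives the copy meant for \<open>e\<close> and never a second
  one.\<close>

lemma lthread_replies:
  assumes "sorted_wrt independent s" "e \<in> set s" "on_path (key d e) x"
  shows "lthread (map (\<lambda>e. (p, move_at (key d e) \<alpha>)) (filter Q s)) x = (if Q e then [(p, \<alpha>)] else [])"
proof (cases "Q e")
  case True
  have "sorted_wrt (\<lambda>e e'. key d e \<parallel> key d e') (filter Q s)"
    by (rule sorted_wrt_mono_rel[OF _ sorted_wrt_filter[OF assms(1)]]) (auto simp: independent_def key_def)
  then show ?thesis using True assms(2,3) by (simp add: lthread_moves_one)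
next
  case False
  have "\<not> on_path (key d e') x" if "e' \<in> set (filter Q s)" for e'
    using that False assms unique_left_entry[OF assms(1,2), of e' x] unique_right_entry[OF assms(1,2), of e' x]
    by (auto simp: key_def split: if_splits)
  then have "lthread (map (\<lambda>e. (p, move_at (key d e) \<alpha>)) (filter Q s)) x = []"
    by (rule lthread_moves_none)
  then show ?thesis using False by simp
qed

lemma prelegal_moves:
  assumes "prelegal \<Phi>" "\<And>e. e \<in> set es \<Longrightarrow> f e \<in> tree \<Phi>"
  shows "prelegal (\<Phi> @ map (\<lambda>e. (p, move_at (f e) \<alpha>)) es) \<and>
    tree (\<Phi> @ map (\<lambda>e. (p, move_at (f e) \<alpha>)) es) = tree \<Phi>"
proof
  show "tree (\<Phi> @ map (\<lambda>e. (p, move_at (f e) \<alpha>)) es) = tree \<Phi>" by (auto simp: tree_append)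
  show "prelegal (\<Phi> @ map (\<lambda>e. (p, move_at (f e) \<alpha>)) es)"
    using assms(2)
  proof (induction es rule: rev_induct)
    case Nil
    then show ?case using assms(1) by simp
  next
    case (snoc e es)
    have "f e \<in> tree (\<Phi> @ map (\<lambda>e. (p, move_at (f e) \<alpha>)) es)"
      using snoc.prems by (auto simp: tree_append)
    then show ?case using prelegal.intros(3) snoc by fastforce
  qed
qed

section \<open>The invariant and its preservation\<close>

definition synchronized :: "position \<Rightarrow> position \<Rightarrow> entry list \<Rightarrow> bool" where
  "synchronized \<Lambda> R s \<longleftrightarrow> (\<forall>e\<in>set s. \<forall>x y. on_path (left_addr e) x \<longrightarrow> on_path (right_addr e) y \<longrightarrow>
     lthread \<Lambda> x = lthread R y)"

definition Inv_LT :: "position \<Rightarrow> entry list \<Rightarrow> bool" where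
  "Inv_LT \<Phi> s \<longleftrightarrow> covering s \<and> tree (right_of \<Phi>) = right_nodes s \<and>
     synchronized (left_of \<Phi>) (right_of \<Phi>) s"

text \<open>\<open>synchronized\<close> speaks of all threads of a cone at once; a longer entry has
  smaller cones on both sides and inherits the equality.\<close>

lemma synchronized_extend:
  assumes "synchronized \<Lambda> R s" "\<And>e'. e' \<in> set s' \<Longrightarrow> \<exists>e\<in>set s. prefix e e'"
  shows "synchronized \<Lambda> R s'"
  unfolding synchronized_def
proof (intro ballI allI impI)
  fix e' x y assume *: "e' \<in> set s'" "on_path (left_addr e') x" "on_path (right_addr e') y"
  then obtain e d where e: "e \<in> set s" "e' = e @ d" using assms(2) by (metis prefix_def)
  have "on_path (left_addr e) x" "on_path (right_addr e) y"
    using * e by (auto intro: on_path_prefix)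
  then show "lthread \<Lambda> x = lthread R y" using assms(1) e(1) by (auto simp: synchronized_def)
qed

abbreviation (input) legal_LT :: "game \<Rightarrow> run set" where
  "legal_LT A \<equiv> par_legal (game_neg (game_recL A)) (game_recT A)"

lemma right_threads_legal:
  assumes "covering s" "synchronized \<Lambda> R s" "\<And>x. Fin (lthread \<Lambda> x) \<in> Lr A"
  shows "Fin (lthread R y) \<in> Lr A"
proof -
  obtain e where e: "e \<in> set s" "on_path (right_addr e) y" using assms(1) by (auto simp: covering_def)
  obtain x where "on_path (left_addr e) x" using ex_on_path by blast
  then show ?thesis using e assms(2,3) by (metis synchronized_def)
qed

text \<open>The last hypothesis is for abandoned threads: lying in no cone, they have no right
  counterpart from which to borrow legality.\<close>

lemma left_threads_legal:
  assumes "synchronized \<Lambda> R s" "\<And>y. Fin (lthread R y) \<in> Lr A"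
    and "(\<And>e. e \<in> set s \<Longrightarrow> \<not> on_path (left_addr e) x) \<Longrightarrow> Fin (lthread \<Lambda> x) \<in> Lr A"
  shows "Fin (lthread \<Lambda> x) \<in> Lr A"
proof (cases "\<exists>e\<in>set s. on_path (left_addr e) x")
  case True
  then obtain e where e: "e \<in> set s" "on_path (left_addr e) x" by blast
  obtain y where "on_path (right_addr e) y" using ex_on_path by blast
  then show ?thesis using e assms(1,2) by (metis synchronized_def)
qed (use assms(3) in blast)

lemma react_LT_left:
  assumes Inv: "Inv_LT \<Phi> s" and legal: "Fin \<Phi> \<in> legal_LT A"
    and legal': "Fin (\<Phi> @ [(Environment, \<beta>)]) \<in> legal_LT A" and \<beta>: "\<beta> = CHR ''0'' # CHR ''.'' # \<gamma>"
  defines "\<Phi>' \<equiv> \<Phi> @ (Environment, \<beta>) # map (Pair Machine) (fst (react_LT s \<beta>))"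
  shows "Fin \<Phi>' \<in> legal_LT A \<and> Inv_LT \<Phi>' (snd (react_LT s \<beta>))"
proof -
  define s1 where "s1 = pad (length \<beta>) s"
  have cov: "covering s1" using Inv by (simp add: Inv_LT_def s1_def covering_pad)
  then have sorted: "sorted_wrt independent s1" by (simp add: covering_def)
  have tree: "tree (right_of \<Phi>) = right_nodes s1" using Inv by (simp add: Inv_LT_def s1_def)
  have sync: "synchronized (left_of \<Phi>) (right_of \<Phi>) s1"
    by (rule synchronized_extend[where s = s]) (use Inv in \<open>auto simp: Inv_LT_def s1_def prefix_pad\<close>)
  obtain w \<alpha> where \<gamma>: "\<gamma> = move_at w \<alpha>"
    using legal' by (auto simp: Fin_par_legal_neg Fin_rec_legal \<beta>)
  define es where "es = filter (\<lambda>e. prefix w (left_addr e)) s1"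
  have react: "react_LT s \<beta> = (map (\<lambda>e. CHR ''1'' # CHR ''.'' # move_at (right_addr e) \<alpha>) es, s1)"
    by (simp add: react_LT_def \<beta> \<gamma> answer_move_at es_def key_def s1_def bit_char_def)
  define R where "R = right_of \<Phi> @ map (\<lambda>e. (Machine, move_at (right_addr e) \<alpha>)) es"
  have right: "right_of \<Phi>' = R" "left_of \<Phi>' = left_of \<Phi> @ [(Machine, \<gamma>)]"
  proof -
    have "right_of (map (\<lambda>e. (Machine, CHR ''1'' # CHR ''.'' # move_at (right_addr e) \<alpha>)) es) =
        map (\<lambda>e. (Machine, move_at (right_addr e) \<alpha>)) es"
      "left_of (map (\<lambda>e. (Machine, CHR ''1'' # CHR ''.'' # move_at (right_addr e) \<alpha>)) es) = []"
      by (induction es) auto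
    then show "right_of \<Phi>' = R" "left_of \<Phi>' = left_of \<Phi> @ [(Machine, \<gamma>)]"
      unfolding \<Phi>'_def react R_def by (simp_all add: comp_def \<beta>)
  qed
  have sync': "synchronized (left_of \<Phi>') R s1"
    unfolding synchronized_def
  proof (intro ballI allI impI)
    fix e x y assume e: "e \<in> set s1" and x: "on_path (left_addr e) x" and y: "on_path (right_addr e) y"
    \<comment> \<open>Here the padding pays off: the bits of \<open>w\<close> are part of \<beta>,
      and every entry was extended by \<open>length \<beta>\<close>. So \<open>w\<close> cannot lie
      strictly inside a cone; it hits all of its threads or none.\<close>
    have "length w \<le> length (left_addr e)"
      using e by (auto simp: s1_def pad_def \<beta> \<gamma> move_at_def)
    then have "on_path w x \<longleftrightarrow> prefix w (left_addr e)"
      using x on_path_comparable on_path_prefix by blast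
    moreover have "lthread (map (\<lambda>e. (Machine, move_at (right_addr e) \<alpha>)) es) y =
        (if prefix w (left_addr e) then [(Machine, \<alpha>)] else [])"
      using lthread_replies[OF sorted e, of True y Machine \<alpha> "\<lambda>e. prefix w (left_addr e)"] y
      by (simp add: key_def es_def)
    ultimately show "lthread (left_of \<Phi>') x = lthread R y"
      using sync e x y by (simp add: right R_def \<gamma> strip_thread_move_at synchronized_def)
  qed
  \<comment> \<open>The machine cannot enlarge the right tree; its replies are legal because right
    addresses are nodes already.\<close>
  have "right_addr e \<in> tree (right_of \<Phi>)" if "e \<in> set es" for e
    using that unfolding tree by (auto simp: es_def right_nodes_def)
  then have pl: "prelegal R \<and> tree R = right_nodes s1"
    using prelegal_moves[of "right_of \<Phi>" es right_addr Machine \<alpha>] legal tree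
    by (auto simp: R_def Fin_par_legal_neg Fin_recT_legal)
  have left_legal: "Fin (left_of \<Phi>') \<in> rec_legal A"
    using legal' by (simp add: right Fin_par_legal_neg \<beta>)
  then have "Fin (lthread R y) \<in> Lr A" for y
    using right_threads_legal[OF cov sync', of A] by (auto simp: Fin_rec_legal)
  then have "Fin R \<in> recT_legal A" using pl by (simp add: Fin_recT_legal)
  moreover have "\<forall>(p, \<mu>)\<in>set \<Phi>'. prefix ''0.'' \<mu> \<or> prefix ''1.'' \<mu>"
    using legal' by (auto simp: \<Phi>'_def Fin_par_legal_neg react)
  ultimately show ?thesis
    using left_legal pl cov sync' by (simp add: Fin_par_legal_neg Inv_LT_def right(1) react)
qed

lemma react_LT_right:
  assumes Inv: "Inv_LT \<Phi> s" and legal: "Fin \<Phi> \<in> legal_LT A"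
    and legal': "Fin (\<Phi> @ [(Environment, \<beta>)]) \<in> legal_LT A" and \<beta>: "\<beta> = CHR ''1'' # CHR ''.'' # \<gamma>"
  defines "\<Phi>' \<equiv> \<Phi> @ (Environment, \<beta>) # map (Pair Machine) (fst (react_LT s \<beta>))"
  shows "Fin \<Phi>' \<in> legal_LT A \<and> Inv_LT \<Phi>' (snd (react_LT s \<beta>))"
proof -
  define s1 where "s1 = pad (length \<beta>) s"
  have cov: "covering s1" using Inv by (simp add: Inv_LT_def s1_def covering_pad)
  then have sorted: "sorted_wrt independent s1" by (simp add: covering_def)
  have tree: "tree (right_of \<Phi>) = right_nodes s1" using Inv by (simp add: Inv_LT_def s1_def)
  have sync: "synchronized (left_of \<Phi>) (right_of \<Phi>) s1"
    by (rule synchronized_extend[where s = s]) (use Inv in \<open>auto simp: Inv_LT_def s1_def prefix_pad\<close>)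
  have right_legal: "Fin (right_of \<Phi> @ [(Environment, \<gamma>)]) \<in> recT_legal A"
    using legal' by (simp add: Fin_par_legal_neg \<beta>)
  then have "prelegal (right_of \<Phi> @ [(Environment, \<gamma>)])" by (simp add: Fin_recT_legal)
  then show ?thesis
  proof (cases rule: prelegal_snocE)
    case (move w \<alpha>)
    note \<gamma> = move(1)
    define es where "es = filter (\<lambda>e. prefix w (right_addr e)) s1"
    have react: "react_LT s \<beta> = (map (\<lambda>e. CHR ''0'' # CHR ''.'' # move_at (left_addr e) \<alpha>) es, s1)"
      by (simp add: react_LT_def \<beta> \<gamma> answer_move_at es_def key_def s1_def bit_char_def)
    define \<Lambda> where "\<Lambda> = left_of \<Phi> @ map (\<lambda>e. (Environment, move_at (left_addr e) \<alpha>)) es"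
    have left: "left_of \<Phi>' = \<Lambda>" "right_of \<Phi>' = right_of \<Phi> @ [(Environment, \<gamma>)]"
    proof -
      have "left_of (map (\<lambda>e. (Machine, CHR ''0'' # CHR ''.'' # move_at (left_addr e) \<alpha>)) es) =
          map (\<lambda>e. (Environment, move_at (left_addr e) \<alpha>)) es"
        "right_of (map (\<lambda>e. (Machine, CHR ''0'' # CHR ''.'' # move_at (left_addr e) \<alpha>)) es) = []"
        by (induction es) auto
      then show "left_of \<Phi>' = \<Lambda>" "right_of \<Phi>' = right_of \<Phi> @ [(Environment, \<gamma>)]"
        unfolding \<Phi>'_def react \<Lambda>_def by (simp_all add: comp_def \<beta>)
    qed
    have sync': "synchronized \<Lambda> (right_of \<Phi>') s1"
      unfolding synchronized_def
    proof (intro ballI allI impI)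
      fix e x y assume e: "e \<in> set s1" and x: "on_path (left_addr e) x" and y: "on_path (right_addr e) y"
      \<comment> \<open>The argument by length is replaced by legality: \<open>w\<close> is a node
        of the right tree, hence a prefix of some right address. If it lay strictly below the right
        address of \<open>e\<close>, two right addresses would be comparable.\<close>
      have "on_path w y \<longleftrightarrow> prefix w (right_addr e)"
      proof
        assume w: "on_path w y"
        obtain e' where e': "e' \<in> set s1" "prefix w (right_addr e')"
          using move(2) by (auto simp: tree right_nodes_def)
        show "prefix w (right_addr e)"
        proof (rule ccontr)
          assume "\<not> prefix w (right_addr e)"
          then have "prefix (right_addr e) w"
            using on_path_comparable[OF w y] on_path_comparable[OF y w]
              linear[of "length w" "length (right_addr e)"] by argo
          then have "prefix (right_addr e) (right_addr e')" using e'(2) prefix_order.trans by blast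
          then have "e = e'" using sorted_wrt_independentD[OF sorted e e'(1)]
            by (auto simp: independent_def parallel_def)
          then show False using e'(2) \<open>\<not> prefix w (right_addr e)\<close> by simp
        qed
      qed (use y on_path_prefix in blast)
      moreover have "lthread (map (\<lambda>e. (Environment, move_at (left_addr e) \<alpha>)) es) x =
          (if prefix w (right_addr e) then [(Environment, \<alpha>)] else [])"
        using lthread_replies[OF sorted e, of False x Environment \<alpha> "\<lambda>e. prefix w (right_addr e)"] x
        by (simp add: key_def es_def)
      ultimately show "lthread \<Lambda> x = lthread (right_of \<Phi>') y"
        using sync e x y by (simp add: left \<Lambda>_def \<gamma> strip_thread_move_at synchronized_def)
    qed
    have "Fin (lthread \<Lambda> x) \<in> Lr A" for x
    proof (rule left_threads_legal[OF sync'])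
      show "Fin (lthread (right_of \<Phi>') y) \<in> Lr A" for y
        using right_legal by (simp add: Fin_recT_legal left)
      \<comment> \<open>Replies go to cones only, so an abandoned thread keeps its old, legal
        run.\<close>
      assume "\<And>e. e \<in> set s1 \<Longrightarrow> \<not> on_path (left_addr e) x"
      then have "lthread \<Lambda> x = lthread (left_of \<Phi>) x"
        using lthread_moves_none[of es left_addr x Environment \<alpha>] by (simp add: \<Lambda>_def es_def)
      then show "Fin (lthread \<Lambda> x) \<in> Lr A" using legal by (simp add: Fin_par_legal_neg Fin_rec_legal)
    qed
    then have "Fin \<Lambda> \<in> rec_legal A"
      using legal by (auto simp: Fin_rec_legal \<Lambda>_def Fin_par_legal_neg)
    moreover have "\<forall>(p, \<mu>)\<in>set \<Phi>'. prefix ''0.'' \<mu> \<or> prefix ''1.'' \<mu>"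
      using legal' by (auto simp: \<Phi>'_def Fin_par_legal_neg react)
    moreover have "tree (right_of \<Phi>') = right_nodes s1"
      by (auto simp: left tree_append \<gamma> tree)
    ultimately show ?thesis
      using right_legal cov sync' by (simp add: Fin_par_legal_neg Inv_LT_def left react)
  next
    case (replicate w)
    note \<gamma> = replicate(2)
    define s2 where "s2 = split_entries (\<lambda>e. right_addr e = w) s1"
    have react: "react_LT s \<beta> = ([], s2)"
      by (simp add: react_LT_def \<beta> \<gamma> answer_replicative key_def s1_def s2_def)
    have left: "left_of \<Phi>' = left_of \<Phi>" "right_of \<Phi>' = right_of \<Phi> @ [(Environment, \<gamma>)]"
      unfolding \<Phi>'_def react by (simp_all add: \<beta>)
    have lth: "lthread (right_of \<Phi>') y = lthread (right_of \<Phi>) y" for y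
      by (simp add: left \<gamma>)
    have sync': "synchronized (left_of \<Phi>') (right_of \<Phi>') s2"
      using synchronized_extend[OF sync prefix_split_entries]
      unfolding synchronized_def lth left(1) s2_def .
    obtain e where e: "e \<in> set s1" "prefix w (right_addr e)"
      using replicate(3) by (auto simp: leaf_def tree right_nodes_def)
    \<comment> \<open>No node of the tree lies below a leaf, so a right address that passes through
      \<open>w\<close> ends there.\<close>
    have w: "right_addr e = w"
    proof (rule ccontr)
      assume "right_addr e \<noteq> w"
      then obtain b u where "right_addr e = w @ b # u"
        using e(2) by (cases "drop (length w) (right_addr e)") (auto simp: prefix_def)
      then have "w @ [b] \<in> tree (right_of \<Phi>)"
        unfolding tree right_nodes_def using e(1) by (auto intro!: bexI[of _ e])
      then show False using replicate(3) by (simp add: leaf_def)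
    qed
    have "right_nodes s2 = right_nodes s1 \<union> {w @ [b] | b. True}"
    proof (intro equalityI subsetI)
      fix v assume "v \<in> right_nodes s2"
      then show "v \<in> right_nodes s1 \<union> {w @ [b] | b. True}"
        by (auto simp: right_nodes_def s2_def split_entries_def split: if_splits)
    next
      fix v assume "v \<in> right_nodes s1 \<union> {w @ [b] | b. True}"
      then consider e' where "e' \<in> set s1" "prefix v (right_addr e')" | b where "v = w @ [b]"
        by (auto simp: right_nodes_def)
      then show "v \<in> right_nodes s2"
      proof cases
        case 1
        have "(if right_addr e' = w then e' @ [Some False] else e') \<in> set s2"
          using 1(1) by (auto simp: s2_def split_entries_def)
        moreover have "prefix v (right_addr (if right_addr e' = w then e' @ [Some False] else e'))"
          using 1(2) by auto
        ultimately show ?thesis unfolding right_nodes_def by blast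
      next
        case (2 b)
        have "e @ [Some b] \<in> set s2"
          using e(1) w by (cases b) (auto simp: s2_def split_entries_def)
        moreover have "prefix v (right_addr (e @ [Some b]))" using 2 w by simp
        ultimately show ?thesis unfolding right_nodes_def by blast
      qed
    qed
    moreover have "tree (right_of \<Phi>') = tree (right_of \<Phi>) \<union> {w @ [b] | b. True}"
      by (auto simp: left tree_append \<gamma>)
    ultimately have "tree (right_of \<Phi>') = right_nodes s2" by (simp add: tree)
    moreover have "covering s2" using cov by (simp add: s2_def covering_split)
    ultimately show ?thesis using legal' sync' by (simp add: Inv_LT_def react \<Phi>'_def)
  qed
qed

lemma react_LT_step:
  assumes Inv: "Inv_LT \<Phi> s" and legal: "Fin \<Phi> \<in> legal_LT A"
    and legal': "Fin (\<Phi> @ [(Environment, \<beta>)]) \<in> legal_LT A"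
  shows "Fin (\<Phi> @ (Environment, \<beta>) # map (Pair Machine) (fst (react_LT s \<beta>))) \<in> legal_LT A"
    and "Inv_LT (\<Phi> @ (Environment, \<beta>) # map (Pair Machine) (fst (react_LT s \<beta>))) (snd (react_LT s \<beta>))"
proof -
  have "prefix ''0.'' \<beta> \<or> prefix ''1.'' \<beta>"
    using legal' by (simp add: Fin_par_legal_neg)
  then have "Fin (\<Phi> @ (Environment, \<beta>) # map (Pair Machine) (fst (react_LT s \<beta>))) \<in> legal_LT A \<and>
    Inv_LT (\<Phi> @ (Environment, \<beta>) # map (Pair Machine) (fst (react_LT s \<beta>))) (snd (react_LT s \<beta>))"
    by (cases rule: prefix_01_cases)
      (use react_LT_left[OF assms] react_LT_right[OF assms] in blast)+
  then show "Fin (\<Phi> @ (Environment, \<beta>) # map (Pair Machine) (fst (react_LT s \<beta>))) \<in> legal_LT A"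
    and "Inv_LT (\<Phi> @ (Environment, \<beta>) # map (Pair Machine) (fst (react_LT s \<beta>))) (snd (react_LT s \<beta>))"
    by auto
qed

text \<open>Any finite set of ones of the limit shows up in a single left address, which has as many
  ones as its right address, an initial piece of \<open>v\<close>. So the number of ones of
  \<open>v\<close> bounds all these sets.\<close>

lemma essentially_finite_limit:
  assumes chain: "chain e" and v: "essentially_finite v" "\<And>n. on_path (right_addr (e n)) v"
  shows "\<exists>x. essentially_finite x \<and> (\<forall>n. on_path (left_addr (e n)) x)"
proof (intro exI conjI allI)
  define g where "g n = left_addr (e n)" for n
  \<comment> \<open>Indices beyond all left addresses get zero; this matters if the chain stops
    growing.\<close>
  define x where "x i \<longleftrightarrow> (\<exists>n. i < length (g n) \<and> g n ! i)" for i
  have g_mono: "prefix (g m) (g n)" if "m \<le> n" for m n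
    using chain_mono[OF chain that] by (auto simp: g_def prefix_def)
  have gx: "g n ! i \<longleftrightarrow> x i" if "i < length (g n)" for n i
  proof
    assume "x i"
    then obtain m where m: "i < length (g m)" "g m ! i" by (auto simp: x_def)
    show "g n ! i"
      using g_mono[of m n] g_mono[of n m] m that by (cases "m \<le> n") (auto simp: prefix_def nth_append)
  qed (use that in \<open>auto simp: x_def\<close>)
  show "on_path (left_addr (e n)) x" for n
    using gx[of _ n] by (simp add: on_path_def g_def)
  have card_le: "card T \<le> card {i. v i}" if T: "finite T" "T \<subseteq> {i. x i}" for T
  proof -
    have "\<exists>n. \<forall>i\<in>T. i < length (g n)"
      using T
    proof (induction T rule: finite_induct)
      case (insert i T)
      then obtain m n where mn: "\<forall>i\<in>T. i < length (g n)" "i < length (g m)" by (auto simp: x_def)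
      have "length (g n) \<le> length (g (max m n))" "length (g m) \<le> length (g (max m n))"
        using g_mono[of n "max m n"] g_mono[of m "max m n"] by (auto dest: prefix_length_le)
      then show ?case using mn by (intro exI[of _ "max m n"]) force
    qed simp
    then obtain n where n: "\<forall>i\<in>T. i < length (g n)" by blast
    have "card T \<le> card {i. i < length (g n) \<and> g n ! i}"
      by (rule card_mono) (use n T gx[of _ n] in auto)
    also have "\<dots> = length (filter id (g n))"
      by (simp add: length_filter_conv_card)
    also have "\<dots> = length (filter id (right_addr (e n)))"
      by (simp add: g_def length_filter_addr)
    also have "\<dots> = card {i. i < length (right_addr (e n)) \<and> right_addr (e n) ! i}"
      by (simp add: length_filter_conv_card)
    also have "\<dots> \<le> card {i. v i}"
      by (rule card_mono) (use v(1) v(2)[of n] in \<open>auto simp: essentially_finite_def on_path_def\<close>)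
    finally show ?thesis .
  qed
  show "essentially_finite x"
    unfolding essentially_finite_def
    by (rule finite_if_finite_subsets_card_bdd[of _ "card {i. v i}", THEN conjunct1]) (use card_le in blast)
qed

lemma play_LT_wins:
  assumes "prefix_closed (Lr A)" and "Fin [] \<in> Lr A"
  shows "Wn (game_or (game_neg (game_recL A)) (game_recT A)) (play_run react_LT [[]] r) = Machine"
proof -
  interpret safe_strategy "legal_LT A" react_LT "[[]]" Inv_LT
  proof
    show "prefix_closed (legal_LT A)"
      using assms(1) by (intro prefix_closed_par_legal prefix_closed_neg)
        (simp_all add: prefix_closed_rec_legal prefix_closed_recT_legal)
    show "Fin [] \<in> legal_LT A"
      by (simp add: Fin_par_legal_neg Fin_rec_legal Fin_recT_legal assms(2) prelegal.intros)
    show "Inv_LT [] [[]]"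
      by (simp add: Inv_LT_def covering_def right_nodes_def synchronized_def tree_def on_path_def)
  qed (fact react_LT_step)+
  define P where "P n = fst (play react_LT [[]] r n)" for n
  define S where "S n = snd (play react_LT [[]] r n)" for n
  have run: "play_run react_LT [[]] r = seq_limit P"
    by (simp add: play_run_def P_def[abs_def])
  have chain_P: "chain P" unfolding P_def by (rule chain_play)
  show ?thesis
    unfolding game_recT_def game_recL_def
  proof (rule Wn_or_neg_eq_Machine, fold game_recT_def game_recL_def)
    show "\<not> illegal_by Machine (legal_LT A) (play_run react_LT [[]] r)"
      by (rule not_illegal_by_Machine)
  next
    assume legal: "play_run react_LT [[]] r \<in> legal_LT A"
      and won: "\<forall>v. essentially_finite v \<longrightarrow>
        Wn A (thread (negate_run (project (strip_prefix ''0.'') (play_run react_LT [[]] r))) v) = Machine"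
    have Inv: "Inv_LT (P n) (S n)" for n
      using Inv_play[OF legal] by (simp add: P_def S_def)
    show "\<forall>v. essentially_finite v \<longrightarrow>
        Wn A (thread (project (strip_prefix ''1.'') (play_run react_LT [[]] r)) v) = Machine"
    proof (intro allI impI)
      fix v assume v: "essentially_finite v"
      have "\<exists>e\<in>set (S n). on_path (right_addr e) v" for n
        using Inv[of n] by (auto simp: Inv_LT_def covering_def)
      then obtain e where e: "\<And>n. e n \<in> set (S n)" "\<And>n. on_path (right_addr (e n)) v" by metis
      have "prefix (e n) (e (Suc n))" for n
      proof -
        have "\<exists>d\<in>set (S n). prefix d (e (Suc n))"
          using e(1)[of "Suc n"] prefix_react_LT unfolding S_def
          by (auto split: option.splits prod.splits)
        then obtain d where d: "d \<in> set (S n)" "prefix d (e (Suc n))" by blast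
        then have "on_path (right_addr d) v"
          using e(2)[of "Suc n"] by (auto simp: prefix_def intro: on_path_prefix)
        \<comment> \<open>At each stage only one entry lies over \<open>v\<close>, so the entry
          chosen next extends the one chosen before.\<close>
        then have "d = e n"
          using unique_right_entry[of "S n" d "e n" v] d(1) e Inv[of n] by (simp add: Inv_LT_def covering_def)
        then show ?thesis using d(2) by simp
      qed
      then have "chain e" by (simp add: chain_def)
      then obtain x where x: "essentially_finite x" "\<And>n. on_path (left_addr (e n)) x"
        using essentially_finite_limit[of e v] v e(2) by blast
      have "lthread (left_of (P n)) x = lthread (right_of (P n)) v" for n
        using Inv[of n] e(1)[of n] e(2)[of n] x(2)[of n] unfolding Inv_LT_def synchronized_def by blast
      then have "thread (negate_run (project (strip_prefix ''0.'') (play_run react_LT [[]] r))) x =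
          thread (project (strip_prefix ''1.'') (play_run react_LT [[]] r)) v"
        unfolding run thread_left_seq_limit[OF chain_P] thread_right_seq_limit[OF chain_P] by simp
      then show "Wn A (thread (project (strip_prefix ''1.'') (play_run react_LT [[]] r)) v) = Machine"
        using won x(1) by metis
    qed
  qed
qed


section \<open>Structured programs for easy-play machines\<close>

text \<open>An action maps the scanned symbols (run tape, work tapes) to a move of the head of the run tape
  and, for every work tape, the symbol to be written and a head move.\<close>

type_synonym action = "symbol \<Rightarrow> (nat \<Rightarrow> symbol) \<Rightarrow> direction \<times> (nat \<Rightarrow> symbol \<times> direction)"
type_synonym condition = "symbol \<Rightarrow> (nat \<Rightarrow> symbol) \<Rightarrow> bool"
type_synonym memory = "position \<times> nat \<times> tape list"

datatype cmd = Prim action | Emit | Permit | Seq cmd cmd | Ite condition cmd cmd | While condition cmd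

definition scan :: "tape list \<Rightarrow> nat \<Rightarrow> symbol" where
  "scan ts i = (if i < length ts then read_tape (ts ! i) else Blank)"

fun act :: "action \<Rightarrow> memory \<Rightarrow> memory" where
  "act f (\<Phi>, h, ts) = (case f (run_tape \<Phi> h) (scan ts) of (d, w) \<Rightarrow>
     (\<Phi>, move_head d h, map (\<lambda>i. write_tape (ts ! i) (w i)) [0..<length ts]))"

fun test :: "condition \<Rightarrow> memory \<Rightarrow> bool" where
  "test c (\<Phi>, h, ts) = c (run_tape \<Phi> h) (scan ts)"

text \<open>The absence of a rule for \<open>Permit\<close> makes derivations independent of the
  environment: a body that has one finishes its whole reply before the environment can move
  again.\<close>

inductive exec :: "cmd \<Rightarrow> memory \<Rightarrow> memory \<Rightarrow> bool" where
  exec_Prim: "exec (Prim f) C (act f C)"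
| exec_Emit: "exec Emit (\<Phi>, h, ts) (\<Phi> @ [(Machine, tape_word (hd ts))], h, ts)"
| exec_Seq: "exec P C C1 \<Longrightarrow> exec Q C1 C2 \<Longrightarrow> exec (Seq P Q) C C2"
| exec_Ite_True: "test c C \<Longrightarrow> exec P C C' \<Longrightarrow> exec (Ite c P Q) C C'"
| exec_Ite_False: "\<not> test c C \<Longrightarrow> exec Q C C' \<Longrightarrow> exec (Ite c P Q) C C'"
| exec_While_False: "\<not> test c C \<Longrightarrow> exec (While c P) C C"
| exec_While_True: "test c C \<Longrightarrow> exec P C C1 \<Longrightarrow> exec (While c P) C1 C2 \<Longrightarrow> exec (While c P) C C2"

subsection \<open>Compilation\<close>

definition idle :: action where
  "idle a r = (Stay, \<lambda>i. (r i, Stay))"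

text \<open>The states of the compiled machine are the lists of commands that are still to be executed.\<close>

fun continue :: "cmd list \<Rightarrow> symbol \<Rightarrow> (nat \<Rightarrow> symbol) \<Rightarrow> cmd list" where
  "continue [] a r = []"
| "continue (Seq P Q # ks) a r = P # Q # ks"
| "continue (Ite c P Q # ks) a r = (if c a r then P else Q) # ks"
| "continue (While c P # ks) a r = (if c a r then P # While c P # ks else ks)"
| "continue (P # ks) a r = ks"

fun action_of :: "cmd list \<Rightarrow> action" where
  "action_of (Prim f # ks) = f"
| "action_of ks = idle"

text \<open>A finite set closed under \<open>continue\<close>, given by recursion on the command so
  that finiteness is immediate. The empty remainder of the first part of a sequence turns into
  \<open>[Q]\<close>, the start of the second; a loop body returns to its loop in the same
  way.\<close>

primrec conts :: "cmd \<Rightarrow> cmd list set" where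
  "conts (Prim f) = {[Prim f], []}"
| "conts Emit = {[Emit], []}"
| "conts Permit = {[Permit], []}"
| "conts (Seq P Q) = {[Seq P Q]} \<union> (\<lambda>l. l @ [Q]) ` conts P \<union> conts Q"
| "conts (Ite c P Q) = {[Ite c P Q]} \<union> conts P \<union> conts Q"
| "conts (While c P) = {[While c P], []} \<union> (\<lambda>l. l @ [While c P]) ` conts P"

lemma finite_conts: "finite (conts P)"
  by (induction P) auto

lemma self_in_conts: "[P] \<in> conts P"
  by (cases P) auto

lemma continue_append: "l \<noteq> [] \<Longrightarrow> continue (l @ ks) a r = continue l a r @ ks"
  by (cases "(l, a, r)" rule: continue.cases) auto

lemma continue_in_conts: "l \<in> conts P \<Longrightarrow> continue l a r \<in> conts P"
proof (induction P arbitrary: l)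
  case (Seq P Q)
  show ?case
  proof (cases "\<exists>k\<in>conts P. l = k @ [Q]")
    case True
    then obtain k where k: "k \<in> conts P" "l = k @ [Q]" by blast
    have "continue [Q] a r \<in> conts Q" using Seq.IH(2) self_in_conts by blast
    then show ?thesis using k Seq.IH(1)[OF k(1)] continue_append[of k "[Q]"]
      by (cases "k = []") auto
  next
    case False
    then show ?thesis using Seq self_in_conts[of P] by force
  qed
next
  case (Ite c P Q)
  then show ?case using self_in_conts[of P] self_in_conts[of Q] by auto
next
  case (While c P)
  show ?case
  proof (cases "\<exists>k\<in>conts P. l = k @ [While c P]")
    case True
    then obtain k where k: "k \<in> conts P" "l = k @ [While c P]" by blast
    show ?thesis using k While.IH[OF k(1)] continue_append[of k "[While c P]"] self_in_conts[of P]
      by (cases "k = []") auto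
  next
    case False
    then show ?thesis using While self_in_conts[of P] by auto
  qed
qed auto

text \<open>Compiled machines have no auxiliary symbols, so this keeps what is written inside their
  alphabet.\<close>

definition action_ok :: "action \<Rightarrow> bool" where
  "action_ok f \<longleftrightarrow> (\<forall>a r. a \<notin> range Aux \<longrightarrow> (\<forall>i. r i \<notin> range Aux) \<longrightarrow> (\<forall>i. fst (snd (f a r) i) \<notin> range Aux))"

primrec cmd_ok :: "cmd \<Rightarrow> bool" where
  "cmd_ok (Prim f) = action_ok f"
| "cmd_ok Emit = True"
| "cmd_ok Permit = True"
| "cmd_ok (Seq P Q) = (cmd_ok P \<and> cmd_ok Q)"
| "cmd_ok (Ite c P Q) = (cmd_ok P \<and> cmd_ok Q)"
| "cmd_ok (While c P) = cmd_ok P"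

lemma cmd_ok_conts: "cmd_ok P \<Longrightarrow> l \<in> conts P \<Longrightarrow> Q \<in> set l \<Longrightarrow> cmd_ok Q"
  by (induction P arbitrary: l) auto

lemma action_ok_action_of:
  assumes "cmd_ok P" "l \<in> conts P" shows "action_ok (action_of l)"
proof -
  have "action_ok idle" by (simp add: action_ok_def idle_def)
  moreover have "action_ok f" if "l = Prim f # ks" for f ks
    using cmd_ok_conts[OF assms, of "Prim f"] that by simp
  ultimately show ?thesis by (cases l rule: action_of.cases) simp_all
qed

text \<open>Putting \<open>[P]\<close> in front makes it state 0, the start state. It occurs again
  in the tail, but \<open>encode\<close> takes the least index.\<close>

definition state_list :: "cmd \<Rightarrow> cmd list list" where
  "state_list P = [P] # (SOME ls. set ls = conts P)"

definition encode :: "cmd \<Rightarrow> cmd list \<Rightarrow> nat" where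
  "encode P l = (LEAST i. i < length (state_list P) \<and> state_list P ! i = l)"

definition compile :: "nat \<Rightarrow> cmd \<Rightarrow> epm" where
  "compile K P =
     \<lparr> num_states = length (state_list P),
       num_tapes = K,
       num_aux = 0,
       move_states = {q. q < length (state_list P) \<and> (\<exists>ks. state_list P ! q = Emit # ks)},
       permission_states = {q. q < length (state_list P) \<and> (\<exists>ks. state_list P ! q = Permit # ks)},
       transition = (\<lambda>q a as.
         let l = state_list P ! q; r = (\<lambda>i. if i < length as then as ! i else Blank)
         in (encode P (continue l a r), fst (action_of l a r), map (snd (action_of l a r)) [0..<length as])) \<rparr>"

lemma set_state_list: "set (state_list P) = conts P"
proof -
  have "set (SOME ls. set ls = conts P) = conts P"
    using finite_list[OF finite_conts[of P]] by (rule someI_ex)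
  then show ?thesis using self_in_conts[of P] by (auto simp: state_list_def)
qed

lemma encode:
  assumes "l \<in> conts P"
  shows "encode P l < length (state_list P)" "state_list P ! encode P l = l"
proof -
  have "\<exists>i. i < length (state_list P) \<and> state_list P ! i = l"
    using assms unfolding set_state_list[symmetric] in_set_conv_nth .
  from LeastI_ex[OF this] show "encode P l < length (state_list P)" "state_list P ! encode P l = l"
    unfolding encode_def by auto
qed

lemma encode_self: "encode P [P] = 0"
  unfolding encode_def by (rule Least_eq_0) (simp add: state_list_def)

lemma is_epm_compile:
  assumes "cmd_ok P" "0 < K" shows "is_epm (compile K P)"
proof -
  have alphabet: "alphabet (compile K P) = - range Aux"
  proof (rule set_eqI)
    show "a \<in> alphabet (compile K P) \<longleftrightarrow> a \<in> - range Aux" for a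
      by (cases a) (auto simp: alphabet_def compile_def)
  qed
  have "case transition (compile K P) q a as of (q', d, ws) \<Rightarrow>
      q' < num_states (compile K P) \<and> length ws = num_tapes (compile K P) \<and> fst ` set ws \<subseteq> alphabet (compile K P)"
    if q: "q < num_states (compile K P)" and a: "a \<in> alphabet (compile K P)"
      and as: "set as \<subseteq> alphabet (compile K P)" "length as = num_tapes (compile K P)" for q a as
  proof -
    define l where "l = state_list P ! q"
    define r where "r = (\<lambda>i. if i < length as then as ! i else Blank)"
    have l: "l \<in> conts P" using q by (auto simp: compile_def l_def set_state_list[symmetric])
    have "r i \<notin> range Aux" for i
    proof (cases "i < length as")
      case True
      then have "as ! i \<in> - range Aux" using as(1) nth_mem unfolding alphabet by blast
      then show ?thesis using True by (simp add: r_def)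
    qed (auto simp: r_def)
    then have "fst (snd (action_of l a r) i) \<notin> range Aux" for i
      using action_ok_action_of[OF assms(1) l] a unfolding action_ok_def alphabet by blast
    then have "fst ` set (map (snd (action_of l a r)) [0..<length as]) \<subseteq> - range Aux"
      by (simp add: image_subset_iff)
    moreover have "transition (compile K P) q a as =
        (encode P (continue l a r), fst (action_of l a r), map (snd (action_of l a r)) [0..<length as])"
      by (simp add: compile_def Let_def l_def r_def)
    moreover have "num_states (compile K P) = length (state_list P)" by (simp add: compile_def)
    ultimately show ?thesis using encode(1)[OF continue_in_conts[OF l, of a r]] as(2)
      unfolding alphabet by simp
  qed
  then show ?thesis using assms(2) unfolding is_epm_def by (auto simp: compile_def state_list_def)
qed

definition snapshot :: "cmd \<Rightarrow> cmd list \<Rightarrow> memory \<Rightarrow> config" where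
  "snapshot P l C = \<lparr> state = encode P l, pos = fst C, run_head = fst (snd C), tapes = snd (snd C) \<rparr>"

lemma map2_write_tape:
  "map2 write_tape ts (map w [0..<length ts]) = map (\<lambda>i. write_tape (ts ! i) (w i)) [0..<length ts]"
  by (rule nth_equalityI) auto

lemma step_snapshot:
  assumes "l \<in> conts P"
  shows "step (compile K P) r (snapshot P l (\<Phi>, h, ts)) =
    snapshot P (continue l (run_tape \<Phi> h) (scan ts))
      (\<Phi> @ (if \<exists>ks. l = Emit # ks then [(Machine, tape_word (hd ts))] else [])
         @ (if \<exists>ks. l = Permit # ks then (case r of None \<Rightarrow> [] | Some \<beta> \<Rightarrow> [(Environment, \<beta>)]) else []),
       snd (act (action_of l) (\<Phi>, h, ts)))"
proof -
  have "(\<lambda>i. if i < length (map read_tape ts) then map read_tape ts ! i else Blank) = scan ts"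
    by (auto simp: scan_def)
  then show ?thesis using encode[OF assms]
    by (simp add: step_def snapshot_def compile_def Let_def map2_write_tape del: length_map split: prod.split)
      (simp add: map2_write_tape)
qed

lemma act_idle: "act idle C = C"
proof (cases C)
  case (fields \<Phi> h ts)
  have "write_tape t (read_tape t, Stay) = t" for t by (cases t) auto
  then have "map (\<lambda>i. write_tape (ts ! i) (scan ts i, Stay)) [0..<length ts] = map ((!) ts) [0..<length ts]"
    by (intro map_cong) (auto simp: scan_def)
  then show ?thesis by (simp add: fields idle_def map_nth)
qed

lemma fst_act: "fst (act f C) = fst C"
  by (cases C) (auto split: prod.split)

lemma step_snapshot_quiet:
  assumes "l \<in> conts P" "\<And>ks. l \<noteq> Emit # ks" "\<And>ks. l \<noteq> Permit # ks"
  shows "step (compile K P) r (snapshot P l C) =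
    snapshot P (continue l (run_tape (fst C) (fst (snd C))) (scan (snd (snd C)))) (act (action_of l) C)"
proof (cases C)
  case (fields \<Phi> h ts)
  show ?thesis using step_snapshot[OF assms(1), of K r \<Phi> h ts] assms(2,3) fst_act[of "action_of l" C]
    unfolding fields by (cases "act (action_of l) (\<Phi>, h, ts)") auto
qed

text \<open>Outside \<open>Permit\<close> a step ignores the response of the environment, so one
  derivation is simulated under every \<open>env\<close>, with the pending commands
  \<open>ks\<close> carried along.\<close>

lemma exec_branch:
  assumes "exec Q C C'" "branch (compile K P) env n = snapshot P (Q # ks) C" "Q # ks \<in> conts P"
  shows "\<exists>m. branch (compile K P) env (n + m) = snapshot P ks C' \<and> ks \<in> conts P"
  using assms
proof (induction arbitrary: n ks rule: exec.induct)
  case (exec_Prim f C)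
  have "branch (compile K P) env (n + 1) = snapshot P ks (act f C)"
    using exec_Prim by (simp add: step_snapshot_quiet)
  moreover have "ks \<in> conts P" using continue_in_conts[OF exec_Prim(2)] by simp
  ultimately show ?case by blast
next
  case (exec_Emit \<Phi> h ts)
  have "branch (compile K P) env (n + 1) = snapshot P ks (\<Phi> @ [(Machine, tape_word (hd ts))], h, ts)"
    using exec_Emit act_idle[of "(\<Phi>, h, ts)"] step_snapshot[OF exec_Emit(2), of K "env n" \<Phi> h ts]
    by (simp del: act.simps)
  moreover have "ks \<in> conts P" using continue_in_conts[OF exec_Emit(2)] by simp
  ultimately show ?case by blast
next
  case (exec_Seq A C C1 B C2)
  have "branch (compile K P) env (Suc n) = snapshot P (A # B # ks) C"
    using exec_Seq.prems by (simp add: step_snapshot_quiet act_idle)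
  moreover have "A # B # ks \<in> conts P" using continue_in_conts[OF exec_Seq.prems(2)] by simp
  ultimately obtain m where m: "branch (compile K P) env (Suc n + m) = snapshot P (B # ks) C1" "B # ks \<in> conts P"
    using exec_Seq.IH(1) by blast
  obtain m' where "branch (compile K P) env (Suc n + m + m') = snapshot P ks C2 \<and> ks \<in> conts P"
    using exec_Seq.IH(2)[OF m] by blast
  then show ?case by (intro exI[of _ "Suc (m + m')"]) (simp add: add.assoc)
next
  case (exec_Ite_True c C A C' B)
  have "branch (compile K P) env (Suc n) = snapshot P (A # ks) C"
    using exec_Ite_True.prems exec_Ite_True.hyps(1) by (cases C) (simp add: step_snapshot_quiet act_idle del: act.simps)
  moreover have "A # ks \<in> conts P"
    using continue_in_conts[OF exec_Ite_True.prems(2), of "run_tape (fst C) (fst (snd C))" "scan (snd (snd C))"]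
      exec_Ite_True.hyps(1) by (cases C) simp
  ultimately obtain m where "branch (compile K P) env (Suc n + m) = snapshot P ks C' \<and> ks \<in> conts P"
    using exec_Ite_True.IH by blast
  then show ?case by (intro exI[of _ "Suc m"]) simp
next
  case (exec_Ite_False c C B C' A)
  have "branch (compile K P) env (Suc n) = snapshot P (B # ks) C"
    using exec_Ite_False.prems exec_Ite_False.hyps(1) by (cases C) (simp add: step_snapshot_quiet act_idle del: act.simps)
  moreover have "B # ks \<in> conts P"
    using continue_in_conts[OF exec_Ite_False.prems(2), of "run_tape (fst C) (fst (snd C))" "scan (snd (snd C))"]
      exec_Ite_False.hyps(1) by (cases C) simp
  ultimately obtain m where "branch (compile K P) env (Suc n + m) = snapshot P ks C' \<and> ks \<in> conts P"
    using exec_Ite_False.IH by blast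
  then show ?case by (intro exI[of _ "Suc m"]) simp
next
  case (exec_While_False c C A)
  have "branch (compile K P) env (n + 1) = snapshot P ks C"
    using exec_While_False by (cases C) (simp add: step_snapshot_quiet act_idle del: act.simps)
  moreover have "ks \<in> conts P"
    using continue_in_conts[OF exec_While_False.prems(2), of "run_tape (fst C) (fst (snd C))" "scan (snd (snd C))"]
      exec_While_False.hyps(1) by (cases C) simp
  ultimately show ?case by blast
next
  case (exec_While_True c C A C1 C2)
  have "branch (compile K P) env (Suc n) = snapshot P (A # While c A # ks) C"
    using exec_While_True.prems exec_While_True.hyps(1) by (cases C) (simp add: step_snapshot_quiet act_idle del: act.simps)
  moreover have "A # While c A # ks \<in> conts P"
    using continue_in_conts[OF exec_While_True.prems(2), of "run_tape (fst C) (fst (snd C))" "scan (snd (snd C))"]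
      exec_While_True.hyps(1) by (cases C) simp
  ultimately obtain m where m: "branch (compile K P) env (Suc n + m) = snapshot P (While c A # ks) C1"
      "While c A # ks \<in> conts P"
    using exec_While_True.IH(1) by blast
  obtain m' where "branch (compile K P) env (Suc n + m + m') = snapshot P ks C2 \<and> ks \<in> conts P"
    using exec_While_True.IH(2)[OF m] by blast
  then show ?case by (intro exI[of _ "Suc (m + m')"]) (simp add: add.assoc)
qed

subsection \<open>Machines that run a strategy\<close>

definition strategy_program :: "cmd \<Rightarrow> cmd \<Rightarrow> cmd" where
  "strategy_program init body = Seq init (While (\<lambda>_ _. True) (Seq Permit body))"

definition add_move :: "move option \<Rightarrow> memory \<Rightarrow> memory" where
  "add_move m C = (fst C @ (case m of None \<Rightarrow> [] | Some \<beta> \<Rightarrow> [(Environment, \<beta>)]), snd C)"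

definition next_round :: "('s \<Rightarrow> move \<Rightarrow> move list \<times> 's) \<Rightarrow> move option \<Rightarrow> position \<times> 's \<Rightarrow> position \<times> 's" where
  "next_round \<rho> m p = (case m of None \<Rightarrow> p
     | Some \<beta> \<Rightarrow> (fst p @ (Environment, \<beta>) # map (Pair Machine) (fst (\<rho> (snd p) \<beta>)), snd (\<rho> (snd p) \<beta>)))"

lemma play_Suc: "play \<rho> s r (Suc n) = next_round \<rho> (r n) (play \<rho> s r n)"
  by (simp add: next_round_def split: prod.split option.split)

lemma chain_branch: "chain (\<lambda>n. pos (branch M env n))"
  by (simp add: chain_def step_def Let_def split: prod.split)

lemma strategy_program_runs_strategy:
  fixes \<rho> :: "'s \<Rightarrow> move \<Rightarrow> move list \<times> 's"
  assumes init: "exec init ([], 0, replicate K (\<lambda>_. Blank, 0)) (repr ([], s0))"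
    and pos: "\<And>p. fst (repr p) = fst p"
    and body: "\<And>p m. exec body (add_move m (repr p)) (repr (next_round \<rho> m p))"
  defines "M \<equiv> compile K (strategy_program init body)"
  shows "\<exists>r. spelled_run (branch M env) = play_run \<rho> s0 r \<and> fair M (branch M env)"
proof -
  define P where "P = strategy_program init body"
  define W where "W = While (\<lambda>_ _. True) (Seq Permit body)"
  have P: "P = Seq init W" by (simp add: P_def W_def strategy_program_def)
  have M: "M = compile K P" by (simp add: M_def P_def)
  have conts: "[P] \<in> conts P" "[init, W] \<in> conts P" "[W] \<in> conts P" "[Seq Permit body, W] \<in> conts P"
      "[Permit, body, W] \<in> conts P" "[body, W] \<in> conts P"
    using self_in_conts[of init] self_in_conts[of body] by (force simp: P W_def)+
  have quiet: "branch M env (Suc n) = snapshot P l' C"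
    if "branch M env n = snapshot P l C" "l \<in> conts P" "\<And>ks. l \<noteq> Emit # ks" "\<And>ks. l \<noteq> Permit # ks"
      "action_of l = idle" "\<And>a r. continue l a r = l'" for n l l' C
    using that by (simp add: M step_snapshot_quiet act_idle)
  have "branch M env 0 = snapshot P [P] ([], 0, replicate K (\<lambda>_. Blank, 0))"
    by (simp add: M initial_config_def snapshot_def encode_self) (simp add: compile_def)
  then have "branch M env (Suc 0) = snapshot P [init, W] ([], 0, replicate K (\<lambda>_. Blank, 0))"
    by (rule quiet) (use conts in \<open>auto simp: P\<close>)
  then obtain t0 where t0: "branch M env t0 = snapshot P [W] (repr ([], s0))"
    using exec_branch[OF init] conts(2) unfolding M by blast
  \<comment> \<open>Unfolding \<open>While\<close> and then \<open>Seq\<close> takes two steps, so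
    the permission state is reached at time \<open>t + 2\<close> and \<open>env (t + 2)\<close> is
    the response that counts.\<close>
  have round: "\<exists>t'>t. \<exists>m. branch M env t' = snapshot P [W] (repr (next_round \<rho> m p)) \<and>
      state (branch M env (t + 2)) \<in> permission_states M"
    if t: "branch M env t = snapshot P [W] (repr p)" for t p
  proof -
    have "branch M env (Suc t) = snapshot P [Seq Permit body, W] (repr p)"
      by (rule quiet[OF t]) (use conts in \<open>auto simp: W_def\<close>)
    then have t2: "branch M env (Suc (Suc t)) = snapshot P [Permit, body, W] (repr p)"
      by (rule quiet) (use conts in \<open>auto simp: W_def\<close>)
    then have "branch M env (Suc (Suc (Suc t))) = snapshot P [body, W] (add_move (env (Suc (Suc t))) (repr p))"
      using step_snapshot[OF conts(5), of K "env (Suc (Suc t))" "fst (repr p)" "fst (snd (repr p))" "snd (snd (repr p))"]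
        act_idle[of "repr p"] unfolding M by (simp add: add_move_def del: act.simps)
    then obtain k where "branch M env (Suc (Suc (Suc t)) + k) =
        snapshot P [W] (repr (next_round \<rho> (env (Suc (Suc t))) p))"
      using exec_branch[OF body] conts(6) unfolding M by blast
    moreover have "state (branch M env (t + 2)) \<in> permission_states M"
    proof -
      have "state (branch M env (t + 2)) = encode P [Permit, body, W]"
        using t2 by (simp add: snapshot_def del: branch.simps)
      then show ?thesis using encode[OF conts(5)] by (simp add: M compile_def)
    qed
    ultimately show ?thesis by (intro exI[of _ "Suc (Suc (Suc t)) + k"]) auto
  qed
  \<comment> \<open>\<open>f n\<close> pairs the time of the n-th arrival at the loop head with the
    play so far. The time depends on the lengths of the earlier replies, hence dependent
    choice.\<close>
  have "\<exists>f. \<forall>n. branch M env (fst (f n)) = snapshot P [W] (repr (snd (f n))) \<and> (n = 0 \<longrightarrow> snd (f n) = ([], s0)) \<and>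
      fst (f n) < fst (f (Suc n)) \<and> (\<exists>m. snd (f (Suc n)) = next_round \<rho> m (snd (f n))) \<and>
      state (branch M env (fst (f n) + 2)) \<in> permission_states M"
  proof -
    have "\<exists>f. \<forall>n. (branch M env (fst (f n)) = snapshot P [W] (repr (snd (f n))) \<and> (n = 0 \<longrightarrow> snd (f n) = ([], s0))) \<and>
      (fst (f n) < fst (f (Suc n)) \<and> (\<exists>m. snd (f (Suc n)) = next_round \<rho> m (snd (f n))) \<and>
      state (branch M env (fst (f n) + 2)) \<in> permission_states M)"
    proof (rule dependent_nat_choice)
      show "\<exists>x. branch M env (fst x) = snapshot P [W] (repr (snd x)) \<and> ((0::nat) = 0 \<longrightarrow> snd x = ([], s0))"
        using t0 by (intro exI[of _ "(t0, ([], s0))"]) simp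
    next
      fix x :: "nat \<times> position \<times> 's" and n :: nat
      assume "branch M env (fst x) = snapshot P [W] (repr (snd x)) \<and> (n = 0 \<longrightarrow> snd x = ([], s0))"
      then obtain t' m where "t' > fst x" "branch M env t' = snapshot P [W] (repr (next_round \<rho> m (snd x)))"
        "state (branch M env (fst x + 2)) \<in> permission_states M"
        using round by blast
      then show "\<exists>y. (branch M env (fst y) = snapshot P [W] (repr (snd y)) \<and> (Suc n = 0 \<longrightarrow> snd y = ([], s0))) \<and>
          fst x < fst y \<and> (\<exists>m. snd y = next_round \<rho> m (snd x)) \<and>
          state (branch M env (fst x + 2)) \<in> permission_states M"
        by (intro exI[of _ "(t', next_round \<rho> m (snd x))"]) auto
    qed
    then show ?thesis by simp
  qed
  then obtain f where f: "\<And>n. branch M env (fst (f n)) = snapshot P [W] (repr (snd (f n)))" "snd (f 0) = ([], s0)"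
      "\<And>n. fst (f n) < fst (f (Suc n))" "\<And>n. \<exists>m. snd (f (Suc n)) = next_round \<rho> m (snd (f n))"
      "\<And>n. state (branch M env (fst (f n) + 2)) \<in> permission_states M"
    by blast
  obtain r where r: "\<And>n. snd (f (Suc n)) = next_round \<rho> (r n) (snd (f n))" using f(4) by metis
  have play: "play \<rho> s0 r n = snd (f n)" for n
    by (induction n) (simp_all add: f(2) r play_Suc del: play.simps(2))
  have pos_f: "pos (branch M env (fst (f n))) = fst (play \<rho> s0 r n)" for n
    by (simp add: f(1) play snapshot_def pos)
  have n_le: "n \<le> fst (f n)" for n
  proof (induction n)
    case (Suc n)
    then show ?case using f(3)[of n] by simp
  qed simp
  have "spelled_run (branch M env) = play_run \<rho> s0 r"
    unfolding spelled_run_def play_run_def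
  proof (rule seq_limit_subseq[OF chain_branch chain_play])
    \<comment> \<open>Arrival times increase strictly, so computation step \<open>n\<close> comes no
      later than the n-th arrival.\<close>
    show "\<exists>m. prefix (pos (branch M env n)) (fst (play \<rho> s0 r m))" for n
      using chain_mono[OF chain_branch[of M env] n_le[of n]] unfolding pos_f by blast
    show "\<exists>m. prefix (fst (play \<rho> s0 r n)) (pos (branch M env m))" for n
      unfolding pos_f[symmetric] by blast
  qed
  moreover have "fair M (branch M env)"
    unfolding fair_def INFM_nat_le
  proof
    fix n
    show "\<exists>m\<ge>n. state (branch M env m) \<in> permission_states M"
      using f(5)[of n] n_le[of n] by (intro exI[of _ "fst (f n) + 2"]) simp
  qed
  ultimately show ?thesis by blast
qed


subsection \<open>Symbolic execution\<close>

lemma exec_deterministic: "exec P C C' \<Longrightarrow> exec P C C'' \<Longrightarrow> C' = C''"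
proof (induction arbitrary: C'' rule: exec.induct)
  case (exec_Prim f C)
  then show ?case by (auto elim: exec.cases)
next
  case (exec_Emit \<Phi> h ts)
  then show ?case by (auto elim: exec.cases)
next
  case (exec_Seq P C C1 Q C2)
  from exec_Seq.prems show ?case by cases (use exec_Seq.IH in blast)
next
  case (exec_Ite_True c C P C' Q)
  from exec_Ite_True.prems show ?case by cases (use exec_Ite_True in blast)+
next
  case (exec_Ite_False c C Q C' P)
  from exec_Ite_False.prems show ?case by cases (use exec_Ite_False in blast)+
next
  case (exec_While_False c C P)
  from exec_While_False.prems show ?case by cases (use exec_While_False in blast)+
next
  case (exec_While_True c C P C1 C2)
  from exec_While_True.prems show ?case by cases (use exec_While_True in blast)+
qed

text \<open>By determinism the effect of a program can be stated as an equation
  \<open>wp P C R = R C'\<close> for all \<open>R\<close>. Such equations chain by rewriting, with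
  termination included.\<close>

definition wp :: "cmd \<Rightarrow> memory \<Rightarrow> (memory \<Rightarrow> bool) \<Rightarrow> bool" where
  "wp P C R \<longleftrightarrow> (\<exists>C'. exec P C C' \<and> R C')"

lemma wp_eq: "exec P C C' \<Longrightarrow> wp P C R = R C'"
  unfolding wp_def using exec_deterministic by blast

lemma exec_wp: "exec P C C' \<longleftrightarrow> wp P C (\<lambda>x. x = C')"
  unfolding wp_def by blast

lemma wp_Seq [simp]: "wp (Seq P Q) C R = wp P C (\<lambda>C1. wp Q C1 R)"
  unfolding wp_def by (blast intro: exec_Seq elim: exec.cases[of "Seq P Q"])

lemma wp_Ite [simp]: "wp (Ite c P Q) C R = (if test c C then wp P C R else wp Q C R)"
  unfolding wp_def by (auto intro: exec.intros elim: exec.cases[of "Ite c P Q"])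

lemma wp_While: "wp (While c P) C R = (if test c C then wp P C (\<lambda>C1. wp (While c P) C1 R) else R C)"
proof (cases "test c C")
  case True
  then have "exec (While c P) C C' \<longleftrightarrow> (\<exists>C1. exec P C C1 \<and> exec (While c P) C1 C')" for C'
    by (blast intro: exec_While_True elim: exec.cases[of "While c P"])
  then show ?thesis using True unfolding wp_def by meson
next
  case False
  then show ?thesis by (simp add: wp_eq[OF exec_While_False])
qed

lemma wp_Emit [simp]: "wp Emit (\<Phi>, h, ts) R = R (\<Phi> @ [(Machine, tape_word (hd ts))], h, ts)"
  by (rule wp_eq[OF exec_Emit])

definition single :: "direction \<Rightarrow> nat \<Rightarrow> (symbol \<Rightarrow> (nat \<Rightarrow> symbol) \<Rightarrow> symbol) \<Rightarrow> direction \<Rightarrow> cmd" where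
  "single e j v d = Prim (\<lambda>a r. (e, \<lambda>i. if i = j then (v a r, d) else (r i, Stay)))"

lemma wp_single [simp]:
  assumes "j < length ts"
  shows "wp (single e j v d) (\<Phi>, h, ts) R =
    R (\<Phi>, move_head e h, ts[j := write_tape (ts ! j) (v (run_tape \<Phi> h) (scan ts), d)])"
proof -
  have id: "write_tape t (read_tape t, Stay) = t" for t by (cases t) auto
  have "act (\<lambda>a r. (e, \<lambda>i. if i = j then (v a r, d) else (r i, Stay))) (\<Phi>, h, ts) =
    (\<Phi>, move_head e h, ts[j := write_tape (ts ! j) (v (run_tape \<Phi> h) (scan ts), d)])"
    by (auto intro!: nth_equalityI simp: nth_list_update scan_def id)
  then show ?thesis unfolding single_def
    by (simp add: wp_eq[OF exec_Prim] del: act.simps)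
qed

lemma cmd_ok_single:
  "(\<And>a r. a \<notin> range Aux \<Longrightarrow> (\<And>i. r i \<notin> range Aux) \<Longrightarrow> v a r \<notin> range Aux) \<Longrightarrow> cmd_ok (single e j v d)"
  by (auto simp: single_def action_ok_def)

subsection \<open>Stacks\<close>

text \<open>Stack \<open>i\<close> lives on work tape \<open>i + 2\<close>: its bottom is the blank cell 0, and the head scans its top.
  Tape 0 holds the move under construction, followed by the head. Since its cell 0 cannot carry a
  marker, tape 1 does, and the two heads move in parallel.\<close>

definition stack_tape :: "symbol list \<Rightarrow> tape" where
  "stack_tape xs = (\<lambda>n. if 0 < n \<and> n \<le> length xs then rev xs ! (n - 1) else Blank, length xs)"

definition out_tape :: "string \<Rightarrow> tape" where
  "out_tape w = (\<lambda>n. if n < length w then Chr (w ! n) else Blank, length w)"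

definition marked_tape :: "nat \<Rightarrow> tape" where
  "marked_tape n = (\<lambda>i. if i = 0 then Label Machine else Blank, n)"

definition mem :: "position \<Rightarrow> nat \<Rightarrow> string \<Rightarrow> symbol list list \<Rightarrow> memory" where
  "mem \<Phi> h w ss = (\<Phi>, h, out_tape w # marked_tape (length w) # map stack_tape ss)"

fun top :: "symbol list \<Rightarrow> symbol" where
  "top [] = Blank"
| "top (x # xs) = x"

lemma read_stack_tape [simp]: "read_tape (stack_tape xs) = top xs"
  by (cases xs) (auto simp: stack_tape_def nth_append)

lemma pop_stack_tape: "write_tape (stack_tape xs) (Blank, GoLeft) = stack_tape (tl xs)"
  by (cases xs) (auto simp: stack_tape_def fun_eq_iff nth_append)

lemma push_stack_tape:
  "write_tape (write_tape (stack_tape xs) (top xs, GoRight)) (c, Stay) = stack_tape (c # xs)"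
proof -
  have "fst (stack_tape xs) (snd (stack_tape xs)) = top xs"
    using read_stack_tape[of xs] by (cases "stack_tape xs") simp
  then show ?thesis by (auto simp: stack_tape_def fun_eq_iff nth_append)
qed

definition pop :: "nat \<Rightarrow> cmd" where
  "pop i = single Stay (i + 2) (\<lambda>_ _. Blank) GoLeft"

text \<open>An action writes before it moves the head, hence two actions: rewrite the top while
  stepping right, then fill the new cell.\<close>

definition push :: "nat \<Rightarrow> symbol \<Rightarrow> cmd" where
  "push i c = Seq (single Stay (i + 2) (\<lambda>_ r. r (i + 2)) GoRight) (single Stay (i + 2) (\<lambda>_ _. c) Stay)"

definition copy :: "nat \<Rightarrow> nat \<Rightarrow> cmd" where
  "copy i k = Seq (single Stay (k + 2) (\<lambda>_ r. r (k + 2)) GoRight) (single Stay (k + 2) (\<lambda>_ r. r (i + 2)) Stay)"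

definition read_run :: "nat \<Rightarrow> cmd" where
  "read_run k = Seq (single Stay (k + 2) (\<lambda>_ r. r (k + 2)) GoRight) (single GoRight (k + 2) (\<lambda>a _. a) Stay)"

definition skip_run :: cmd where
  "skip_run = single GoRight 0 (\<lambda>_ r. r 0) Stay"

definition put_out :: "((nat \<Rightarrow> symbol) \<Rightarrow> symbol) \<Rightarrow> cmd" where
  "put_out v = Seq (single Stay 0 (\<lambda>_. v) GoRight) (single Stay 1 (\<lambda>_ r. r 1) GoRight)"

definition out :: "char \<Rightarrow> cmd" where
  "out c = put_out (\<lambda>_. Chr c)"

definition out_top :: "nat \<Rightarrow> cmd" where
  "out_top i = put_out (\<lambda>r. r (i + 2))"

text \<open>The loop erases on its way back until tape 1 shows the marker; the final write clears
  cell 0, where the loop has stopped.\<close>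

definition rewind :: cmd where
  "rewind = Seq (While (\<lambda>_ r. r 1 = Blank)
       (Seq (single Stay 0 (\<lambda>_ _. Blank) GoLeft) (single Stay 1 (\<lambda>_ r. r 1) GoLeft)))
     (single Stay 0 (\<lambda>_ _. Blank) Stay)"

definition flush :: cmd where
  "flush = Seq Emit rewind"

lemma wp_pop [simp]:
  "i < length ss \<Longrightarrow> wp (pop i) (mem \<Phi> h w ss) R = R (mem \<Phi> h w (ss[i := tl (ss ! i)]))"
  by (simp add: pop_def mem_def pop_stack_tape map_update)

lemma wp_push [simp]:
  "i < length ss \<Longrightarrow> wp (push i c) (mem \<Phi> h w ss) R = R (mem \<Phi> h w (ss[i := c # ss ! i]))"
  by (simp add: push_def mem_def push_stack_tape map_update scan_def)

lemma wp_copy [simp]: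
  "i < length ss \<Longrightarrow> k < length ss \<Longrightarrow> i \<noteq> k \<Longrightarrow>
     wp (copy i k) (mem \<Phi> h w ss) R = R (mem \<Phi> h w (ss[k := top (ss ! i) # ss ! k]))"
  by (simp add: copy_def mem_def push_stack_tape map_update scan_def)

lemma wp_read_run [simp]:
  "k < length ss \<Longrightarrow>
     wp (read_run k) (mem \<Phi> h w ss) R = R (mem \<Phi> (Suc h) w (ss[k := run_tape \<Phi> h # ss ! k]))"
  by (simp add: read_run_def mem_def push_stack_tape map_update scan_def)

lemma out_tape_unchanged: "write_tape (out_tape w) (read_tape (out_tape w), Stay) = out_tape w"
  by (cases "out_tape w") simp

lemma wp_skip_run [simp]: "wp skip_run (mem \<Phi> h w ss) R = R (mem \<Phi> (Suc h) w ss)"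
  by (simp add: skip_run_def mem_def scan_def out_tape_unchanged)

lemma write_out_tape: "write_tape (out_tape w) (Chr c, GoRight) = out_tape (w @ [c])"
  by (auto simp: out_tape_def fun_eq_iff nth_append)

lemma write_marked_tape: "write_tape (marked_tape n) (read_tape (marked_tape n), d) = marked_tape (move_head d n)"
  by (auto simp: marked_tape_def fun_eq_iff)

lemma wp_put_out:
  "v (scan (snd (snd (mem \<Phi> h w ss)))) = Chr c \<Longrightarrow>
     wp (put_out v) (mem \<Phi> h w ss) R = R (mem \<Phi> h (w @ [c]) ss)"
  by (simp add: put_out_def mem_def write_out_tape) (simp add: scan_def write_marked_tape)

lemma wp_out [simp]: "wp (out c) (mem \<Phi> h w ss) R = R (mem \<Phi> h (w @ [c]) ss)"
  unfolding out_def by (rule wp_put_out) simp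

lemma wp_out_top [simp]:
  "i < length ss \<Longrightarrow> top (ss ! i) = Chr c \<Longrightarrow> wp (out_top i) (mem \<Phi> h w ss) R = R (mem \<Phi> h (w @ [c]) ss)"
  unfolding out_top_def by (rule wp_put_out) (simp add: mem_def scan_def)

text \<open>The induction passes through tapes already erased to the right of the head; a complete
  output tape is the case \<open>m = length w\<close>.\<close>

lemma wp_rewind_aux:
  assumes "m \<le> length w"
  shows "wp rewind (\<Phi>, h, (\<lambda>n. if n \<le> m \<and> n < length w then Chr (w ! n) else Blank, m) # marked_tape m # ts) R =
    R (\<Phi>, h, out_tape [] # marked_tape 0 # ts)"
  using assms
proof (induction m)
  case 0
  have "(\<lambda>n. if n \<le> 0 \<and> n < length w then Chr (w ! n) else Blank)(0 := Blank) = (\<lambda>n. Blank)" by auto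
  then show ?case unfolding rewind_def
    by (simp add: wp_While scan_def marked_tape_def out_tape_def)
next
  case (Suc m)
  have "(\<lambda>n. if n \<le> Suc m \<and> n < length w then Chr (w ! n) else Blank)(Suc m := Blank) =
      (\<lambda>n. if n \<le> m \<and> n < length w then Chr (w ! n) else Blank)" by auto
  moreover have "read_tape (marked_tape (Suc m)) = Blank" by (simp add: marked_tape_def)
  ultimately show ?case using Suc write_marked_tape[of "Suc m" GoLeft]
    unfolding rewind_def by (subst wp_Seq, subst wp_While) (simp add: scan_def)
qed

lemma wp_rewind [simp]: "wp rewind (mem \<Phi> h w ss) R = R (mem \<Phi> h [] ss)"
proof -
  have "out_tape w = (\<lambda>n. if n \<le> length w \<and> n < length w then Chr (w ! n) else Blank, length w)"
    by (auto simp: out_tape_def)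
  then show ?thesis using wp_rewind_aux[of "length w" w] by (simp add: mem_def)
qed

lemma tape_word_out_tape [simp]: "tape_word (out_tape w) = w"
proof -
  have "(LEAST n. fst (out_tape w) n \<notin> range Chr) = length w"
    by (rule Least_equality) (auto simp: out_tape_def not_less[symmetric])
  then show ?thesis unfolding tape_word_def
    by (auto intro!: nth_equalityI simp: out_tape_def)
qed

lemma wp_flush [simp]:
  "wp flush (mem \<Phi> h w ss) R = R (mem (\<Phi> @ [(Machine, w)]) h [] ss)"
proof -
  have "wp Emit (mem \<Phi> h w ss) S = S (mem (\<Phi> @ [(Machine, w)]) h w ss)" for S
    by (simp add: mem_def)
  then show ?thesis by (simp add: flush_def)
qed

definition if_top :: "nat \<Rightarrow> (symbol \<Rightarrow> bool) \<Rightarrow> cmd \<Rightarrow> cmd \<Rightarrow> cmd" where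
  "if_top i Q = Ite (\<lambda>_ r. Q (r (i + 2)))"

definition while_top :: "nat \<Rightarrow> (symbol \<Rightarrow> bool) \<Rightarrow> cmd \<Rightarrow> cmd" where
  "while_top i Q = While (\<lambda>_ r. Q (r (i + 2)))"

lemma wp_if_top [simp]:
  "i < length ss \<Longrightarrow> wp (if_top i Q A B) (mem \<Phi> h w ss) R =
     (if Q (top (ss ! i)) then wp A (mem \<Phi> h w ss) R else wp B (mem \<Phi> h w ss) R)"
  by (simp add: if_top_def mem_def scan_def)

lemma wp_while_top:
  "i < length ss \<Longrightarrow> wp (while_top i Q A) (mem \<Phi> h w ss) R =
     (if Q (top (ss ! i)) then wp A (mem \<Phi> h w ss) (\<lambda>C. wp (while_top i Q A) C R) else R (mem \<Phi> h w ss))"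
  unfolding while_top_def by (subst wp_While) (simp add: mem_def scan_def)

definition noop :: cmd where
  "noop = single Stay 0 (\<lambda>_ r. r 0) Stay"

lemma wp_noop [simp]: "wp noop (mem \<Phi> h w ss) R = R (mem \<Phi> h w ss)"
  by (simp add: noop_def mem_def scan_def out_tape_unchanged)

lemma cmd_ok_stack [simp]:
  "cmd_ok (pop i)" "cmd_ok (copy i k)" "cmd_ok (read_run k)" "cmd_ok skip_run" "cmd_ok (out c)"
  "cmd_ok (out_top i)" "cmd_ok rewind" "cmd_ok flush" "cmd_ok noop"
  "cmd_ok (push i (Chr c))" "cmd_ok (push i (Label p))"
  "cmd_ok (if_top i Q A B) \<longleftrightarrow> cmd_ok A \<and> cmd_ok B" "cmd_ok (while_top i Q A) \<longleftrightarrow> cmd_ok A"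
  by (auto simp: pop_def copy_def read_run_def skip_run_def out_def out_top_def put_out_def rewind_def
      flush_def noop_def push_def if_top_def while_top_def intro!: cmd_ok_single)


subsection \<open>Reading the run tape\<close>

definition spell :: "position \<Rightarrow> symbol list" where
  "spell \<Phi> = concat (map (\<lambda>(p, \<alpha>). Label p # map Chr \<alpha>) \<Phi>)"

lemma spell_append [simp]: "spell (\<Phi> @ \<Psi>) = spell \<Phi> @ spell \<Psi>"
  by (simp add: spell_def)

lemma spell_Cons [simp]: "spell ((p, \<alpha>) # \<Phi>) = Label p # map Chr \<alpha> @ spell \<Phi>"
  by (simp add: spell_def)

lemma spell_Nil [simp]: "spell [] = []"
  by (simp add: spell_def)

lemma run_tape_spell: "run_tape \<Phi> i = (if i < length (spell \<Phi>) then spell \<Phi> ! i else Blank)"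
  by (simp add: run_tape_def spell_def Let_def)

lemma Blank_notin_spell: "Blank \<notin> set (spell \<Phi>)"
  by (auto simp: spell_def)

lemma test_mem [simp]: "test (\<lambda>a _. Q a) (mem \<Phi> h w ss) = Q (run_tape \<Phi> h)"
  by (simp add: mem_def)

lemma wp_read_chars:
  assumes "spell \<Phi> = \<pi> @ map Chr \<beta>" "0 < length ss"
  shows "wp (While (\<lambda>a _. a \<in> range Chr) (read_run 0)) (mem \<Phi> (length \<pi>) w ss) R =
    R (mem \<Phi> (length (spell \<Phi>)) w (ss[0 := rev (map Chr \<beta>) @ ss ! 0]))"
  using assms
proof (induction \<beta> arbitrary: \<pi> ss)
  case Nil
  then show ?case by (subst wp_While) (auto simp: run_tape_spell)
next
  case (Cons c \<beta>)
  have "run_tape \<Phi> (length \<pi>) = Chr c" using Cons.prems(1) by (simp add: run_tape_spell)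
  then show ?case using Cons.IH[of "\<pi> @ [Chr c]" "ss[0 := Chr c # ss ! 0]"] Cons.prems
    by (subst wp_While) simp
qed

lemma wp_skip_moves:
  assumes "h \<le> length (spell \<Phi>)"
  shows "wp (While (\<lambda>a _. a \<noteq> Blank) skip_run) (mem \<Phi> h w ss) R = R (mem \<Phi> (length (spell \<Phi>)) w ss)"
  using assms
proof (induction h rule: inc_induct)
  case base
  then show ?case by (subst wp_While) (simp add: run_tape_spell)
next
  case (step h)
  have "run_tape \<Phi> h \<noteq> Blank"
    using step.hyps Blank_notin_spell[of \<Phi>] by (auto simp: run_tape_spell in_set_conv_nth)
  then show ?case using step.IH by (subst wp_While) simp
qed

text \<open>After the reply the run tape also holds the machine's own moves. They are skipped, so
  that the head waits on the first blank: the next move of the environment will start there, and a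
  blank means that it passed.\<close>

definition round_program :: "cmd \<Rightarrow> cmd" where
  "round_program body = Ite (\<lambda>a _. a = Label Environment)
     (Seq skip_run (Seq (While (\<lambda>a _. a \<in> range Chr) (read_run 0))
       (Seq body (While (\<lambda>a _. a \<noteq> Blank) skip_run)))) noop"

definition round_memory :: "('s \<Rightarrow> symbol list list) \<Rightarrow> position \<times> 's \<Rightarrow> memory" where
  "round_memory enc p = mem (fst p) (length (spell (fst p))) [] ([] # enc (snd p))"

lemma exec_round_program:
  assumes body: "\<And>\<Phi> h s \<beta>. exec body (mem \<Phi> h [] (rev (map Chr \<beta>) # enc s))
      (mem (\<Phi> @ map (Pair Machine) (fst (\<rho> s \<beta>))) h [] ([] # enc (snd (\<rho> s \<beta>))))"
  shows "exec (round_program body) (add_move m (round_memory enc p)) (round_memory enc (next_round \<rho> m p))"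
proof (cases m)
  case None
  have "run_tape (fst p) (length (spell (fst p))) = Blank" by (simp add: run_tape_spell)
  then show ?thesis
    by (simp add: None add_move_def round_memory_def next_round_def round_program_def exec_wp)
next
  case (Some \<beta>)
  define \<Phi> where "\<Phi> = fst p"
  define \<Phi>1 where "\<Phi>1 = \<Phi> @ [(Environment, \<beta>)]"
  have am: "add_move m (round_memory enc p) = mem \<Phi>1 (length (spell \<Phi>)) [] ([] # enc (snd p))"
    by (simp add: Some add_move_def round_memory_def mem_def \<Phi>1_def \<Phi>_def)
  have lab: "run_tape \<Phi>1 (length (spell \<Phi>)) = Label Environment"
    by (simp add: run_tape_spell \<Phi>1_def)
  have rd: "wp (While (\<lambda>a _. a \<in> range Chr) (read_run 0)) (mem \<Phi>1 (Suc (length (spell \<Phi>))) [] ([] # enc (snd p))) R =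
      R (mem \<Phi>1 (length (spell \<Phi>1)) [] (rev (map Chr \<beta>) # enc (snd p)))" for R
    using wp_read_chars[of \<Phi>1 "spell \<Phi> @ [Label Environment]" \<beta> "[] # enc (snd p)"] by (simp add: \<Phi>1_def)
  show ?thesis
    unfolding am exec_wp round_program_def
    by (simp add: lab rd wp_eq[OF body] wp_skip_moves)
      (simp add: Some round_memory_def next_round_def \<Phi>1_def \<Phi>_def add.assoc)
qed

subsection \<open>Loops over stacks\<close>

definition move_stack :: "nat \<Rightarrow> nat \<Rightarrow> cmd" where
  "move_stack i k = while_top i (\<lambda>a. a \<noteq> Blank) (Seq (copy i k) (pop i))"

lemma wp_move_stack [simp]:
  assumes "i < length ss" "k < length ss" "i \<noteq> k" "Blank \<notin> set (ss ! i)"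
  shows "wp (move_stack i k) (mem \<Phi> h w ss) R = R (mem \<Phi> h w (ss[k := rev (ss ! i) @ ss ! k, i := []]))"
  using assms
proof (induction "ss ! i" arbitrary: ss)
  case Nil
  then have "ss[i := []] = ss" by (metis list_update_id)
  then show ?case using Nil unfolding move_stack_def
    by (subst wp_while_top) (simp_all add: list_update_swap[of k i])
next
  case (Cons c xs)
  let ?ss = "ss[k := c # ss ! k, i := xs]"
  have c: "ss ! i = c # xs" using Cons.hyps(2) by simp
  have "wp (move_stack i k) (mem \<Phi> h w ?ss) R = R (mem \<Phi> h w (?ss[k := rev (?ss ! i) @ ?ss ! k, i := []]))"
    by (rule Cons.hyps(1)) (use Cons.prems c in auto)
  moreover have "wp (move_stack i k) (mem \<Phi> h w ss) R = wp (move_stack i k) (mem \<Phi> h w ?ss) R"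
    unfolding move_stack_def using Cons.prems c by (subst wp_while_top) auto
  moreover have "?ss[k := rev (?ss ! i) @ ?ss ! k, i := []] = ss[k := rev (ss ! i) @ ss ! k, i := []]"
    using Cons.prems c by (simp add: list_update_swap[of i k])
  ultimately show ?case by simp
qed

definition clear :: "nat \<Rightarrow> cmd" where
  "clear i = while_top i (\<lambda>a. a \<noteq> Blank) (pop i)"

lemma wp_clear [simp]:
  assumes "i < length ss" "Blank \<notin> set (ss ! i)"
  shows "wp (clear i) (mem \<Phi> h w ss) R = R (mem \<Phi> h w (ss[i := []]))"
  using assms
proof (induction "ss ! i" arbitrary: ss)
  case Nil
  then have "ss[i := []] = ss" by (metis list_update_id)
  then show ?case using Nil unfolding clear_def by (subst wp_while_top) simp_all
next
  case (Cons c xs)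
  have c: "ss ! i = c # xs" using Cons.hyps(2) by simp
  have "wp (clear i) (mem \<Phi> h w (ss[i := xs])) R = R (mem \<Phi> h w (ss[i := xs, i := []]))"
    by (rule Cons.hyps(1)) (use Cons.prems c in auto)
  moreover have "wp (clear i) (mem \<Phi> h w ss) R = wp (clear i) (mem \<Phi> h w (ss[i := xs])) R"
    unfolding clear_def using Cons.prems c by (subst wp_while_top) auto
  ultimately show ?case by simp
qed

text \<open>The text of the move serves as a counter, \<open>A\<close> being run once per character.
  The transfer to stack 1 also restores the reading order, since reading had left the last character
  on top.\<close>

definition for_each_symbol :: "cmd \<Rightarrow> cmd" where
  "for_each_symbol A = while_top 0 (\<lambda>a. a \<noteq> Blank) (Seq A (Seq (copy 0 1) (pop 0)))"

primrec iterate_output :: "('s \<Rightarrow> 'a list) \<Rightarrow> ('s \<Rightarrow> 's) \<Rightarrow> nat \<Rightarrow> 's \<Rightarrow> 'a list" where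
  "iterate_output F G 0 s = []"
| "iterate_output F G (Suc n) s = F s @ iterate_output F G n (G s)"

lemma wp_for_each_symbol:
  assumes "\<And>\<Phi> b c s R. wp A (mem \<Phi> h [] (b # c # enc s)) R = R (mem (\<Phi> @ F s) h [] (b # c # enc (G s)))"
    and "Blank \<notin> set b"
  shows "wp (for_each_symbol A) (mem \<Phi> h [] (b # c # enc s)) R =
    R (mem (\<Phi> @ iterate_output F G (length b) s) h [] ([] # (rev b @ c) # enc ((G ^^ length b) s)))"
  using assms(2)
proof (induction b arbitrary: \<Phi> c s)
  case Nil
  then show ?case unfolding for_each_symbol_def by (subst wp_while_top) simp_all
next
  case (Cons a b)
  then show ?case unfolding for_each_symbol_def
    by (subst wp_while_top) (auto simp: assms(1) funpow_swap1)
qed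

lemma cmd_ok_loops [simp]:
  "cmd_ok (move_stack i k)" "cmd_ok (clear i)" "cmd_ok (for_each_symbol A) \<longleftrightarrow> cmd_ok A"
  "cmd_ok (round_program A) \<longleftrightarrow> cmd_ok A"
  by (simp_all add: move_stack_def clear_def for_each_symbol_def round_program_def)

definition mark_bottom :: cmd where
  "mark_bottom = single Stay 1 (\<lambda>_ _. Label Machine) Stay"

lemma wp_mark_bottom:
  "wp mark_bottom ([], 0, replicate (Suc (Suc n)) (\<lambda>_. Blank, 0)) R = R (mem [] 0 [] (replicate n []))"
proof -
  have "stack_tape [] = (\<lambda>_. Blank, 0)" "out_tape [] = (\<lambda>_. Blank, 0)" "marked_tape 0 = ((\<lambda>_. Blank)(0 := Label Machine), 0)"
    by (auto simp: stack_tape_def out_tape_def marked_tape_def)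
  then show ?thesis by (simp add: mark_bottom_def mem_def)
qed

lemma cmd_ok_mark_bottom [simp]: "cmd_ok mark_bottom"
  unfolding mark_bottom_def by (rule cmd_ok_single) auto


subsection \<open>The machine for Rec\_T to Rec\_L\<close>

text \<open>Stack 2 spells the replicative moves at the leaves of the left tree. The new leaves are collected,
  in reverse, on stacks 3 and 4.\<close>

definition leaves_stack :: "bitstring list \<Rightarrow> symbol list" where
  "leaves_stack ls = map Chr (concat (map (\<lambda>w. ''0.'' @ replicative w) ls))"

text \<open>Reading a stack consumes it, so the text of a leaf goes to the output and to both child
  stacks in one pass. At the colon the split is emitted and each child gets its last bit.\<close>

definition split_leaves :: cmd where
  "split_leaves = while_top 2 (\<lambda>a. a \<noteq> Blank)
     (if_top 2 (\<lambda>a. a = Chr CHR '':'')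
       (Seq (out CHR '':'') (Seq flush (Seq (push 3 (Chr CHR ''0'')) (Seq (push 3 (Chr CHR '':''))
         (Seq (push 4 (Chr CHR ''1'')) (Seq (push 4 (Chr CHR '':'')) (pop 2)))))))
       (Seq (out_top 2) (Seq (copy 2 3) (Seq (copy 2 4) (pop 2)))))"

text \<open>Stack 4 is emptied first, so that the 0-children from stack 3 end on top, in the order
  of \<open>expand\<close>.\<close>

definition expand_leaves :: cmd where
  "expand_leaves = Seq split_leaves (Seq (move_stack 4 2) (move_stack 3 2))"

lemma wp_split_leaf:
  "CHR '':'' \<notin> set xs \<Longrightarrow>
   wp split_leaves (mem \<Phi> h v [b, c, map Chr xs @ Chr CHR '':'' # e, e1, e2]) R =
   wp split_leaves (mem (\<Phi> @ [(Machine, v @ xs @ '':'')]) h [] [b, c, e,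
     Chr CHR '':'' # Chr CHR ''0'' # rev (map Chr xs) @ e1,
     Chr CHR '':'' # Chr CHR ''1'' # rev (map Chr xs) @ e2]) R"
proof (induction xs arbitrary: v e1 e2)
  case Nil
  show ?case
    by (subst (1) split_leaves_def, subst wp_while_top) (simp_all add: split_leaves_def[symmetric])
next
  case (Cons a xs)
  have "wp split_leaves (mem \<Phi> h v [b, c, map Chr (a # xs) @ Chr CHR '':'' # e, e1, e2]) R =
      wp split_leaves (mem \<Phi> h (v @ [a]) [b, c, map Chr xs @ Chr CHR '':'' # e, Chr a # e1, Chr a # e2]) R"
    using Cons.prems
    by (subst (1) split_leaves_def, subst wp_while_top) (auto simp: split_leaves_def[symmetric])
  then show ?case using Cons by simp
qed

lemma wp_split_leaves:
  "wp split_leaves (mem \<Phi> h [] [b, c, leaves_stack ls, e1, e2]) R =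
   R (mem (\<Phi> @ map (\<lambda>w. (Machine, ''0.'' @ replicative w)) ls) h [] [b, c, [],
     rev (leaves_stack (map (\<lambda>w. w @ [False]) ls)) @ e1,
     rev (leaves_stack (map (\<lambda>w. w @ [True]) ls)) @ e2])"
proof (induction ls arbitrary: \<Phi> e1 e2)
  case Nil
  show ?case by (subst split_leaves_def, subst wp_while_top) (simp_all add: leaves_stack_def)
next
  case (Cons w ls)
  have w: "leaves_stack (w # ls) = map Chr (''0.'' @ map bit_char w) @ Chr CHR '':'' # leaves_stack ls" for w ls
    by (simp add: leaves_stack_def replicative_def)
  have "CHR '':'' \<notin> set (''0.'' @ map bit_char w)" by auto
  from wp_split_leaf[OF this, of \<Phi> h "[]" b c "leaves_stack ls" e1 e2 R] show ?case
    unfolding w by (simp add: Cons.IH) (simp add: w bit_char_def replicative_def)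
qed

lemma leaves_stack_append: "leaves_stack (ls @ ls') = leaves_stack ls @ leaves_stack ls'"
  by (simp add: leaves_stack_def)

lemma Blank_notin_leaves_stack: "Blank \<notin> set (leaves_stack ls)"
  by (auto simp: leaves_stack_def)

lemma wp_expand_leaves:
  "wp expand_leaves (mem \<Phi> h [] (b # c # [leaves_stack ls, [], []])) R =
   R (mem (\<Phi> @ map (\<lambda>w. (Machine, ''0.'' @ replicative w)) ls) h [] (b # c # [leaves_stack (expand ls), [], []]))"
  by (simp add: expand_leaves_def wp_split_leaves Blank_notin_leaves_stack leaves_stack_append expand_def)

lemma expansions_iterate:
  "fst (expansions k ls) = iterate_output (map (\<lambda>w. ''0.'' @ replicative w)) expand k ls"
  "snd (expansions k ls) = (expand ^^ k) ls"
  by (induction k arbitrary: ls) (simp_all add: funpow_swap1)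

lemma map_iterate_output: "map f (iterate_output F G n s) = iterate_output (map f \<circ> F) G n s"
  by (induction n arbitrary: s) simp_all

definition out_stack :: "nat \<Rightarrow> cmd" where
  "out_stack i = while_top i (\<lambda>a. a \<noteq> Blank) (Seq (out_top i) (pop i))"

lemma wp_out_stack [simp]:
  "i < length ss \<Longrightarrow> ss ! i = map Chr xs \<Longrightarrow>
     wp (out_stack i) (mem \<Phi> h v ss) R = R (mem \<Phi> h (v @ xs) (ss[i := []]))"
proof (induction xs arbitrary: v ss)
  case Nil
  then have "ss[i := []] = ss" by (metis list.map(1) list_update_id)
  then show ?case using Nil unfolding out_stack_def by (subst wp_while_top) simp_all
next
  case (Cons c xs)
  have "wp (out_stack i) (mem \<Phi> h (v @ [c]) (ss[i := map Chr xs])) R = R (mem \<Phi> h (v @ c # xs) (ss[i := []]))"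
    using Cons.IH[of "ss[i := map Chr xs]" "v @ [c]"] Cons.prems by simp
  moreover have "wp (out_stack i) (mem \<Phi> h v ss) R = wp (out_stack i) (mem \<Phi> h (v @ [c]) (ss[i := map Chr xs])) R"
    unfolding out_stack_def using Cons.prems by (subst wp_while_top) simp_all
  ultimately show ?case by simp
qed

text \<open>The \<open>noop\<close> is for the empty move, which has no side to flip. Illegal moves
  are covered too, because the simulation is required for every \<beta>.\<close>

definition body_TL :: cmd where
  "body_TL = Seq (for_each_symbol expand_leaves)
     (Seq (if_top 1 (\<lambda>a. a = Chr CHR ''0'') (Seq (out CHR ''1'') (pop 1))
            (if_top 1 (\<lambda>a. a \<noteq> Blank) (Seq (out CHR ''0'') (pop 1)) noop))
       (Seq (out_stack 1) flush))"

lemma exec_body_TL: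
  "exec body_TL (mem \<Phi> h [] (rev (map Chr \<beta>) # [[], leaves_stack ls, [], []]))
    (mem (\<Phi> @ map (Pair Machine) (fst (react_TL ls \<beta>))) h [] ([] # [[], leaves_stack (snd (react_TL ls \<beta>)), [], []]))"
proof -
  have "wp (for_each_symbol expand_leaves) (mem \<Phi> h [] (rev (map Chr \<beta>) # [] # [leaves_stack ls, [], []])) R =
      R (mem (\<Phi> @ map (Pair Machine) (fst (expansions (length \<beta>) ls))) h []
        ([] # map Chr \<beta> # [leaves_stack (snd (expansions (length \<beta>) ls)), [], []]))" for R
    using wp_for_each_symbol[where enc = "\<lambda>ls. [leaves_stack ls, [], []]" and b = "rev (map Chr \<beta>)"
        and c = "[]", OF wp_expand_leaves]
    by (auto simp: expansions_iterate map_iterate_output comp_def rev_map)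
  then show ?thesis unfolding exec_wp body_TL_def
    by (cases \<beta>) (simp_all add: react_TL_def)
qed

definition init_TL :: cmd where
  "init_TL = Seq mark_bottom (Seq (push 2 (Chr CHR '':'')) (Seq (push 2 (Chr CHR ''.'')) (push 2 (Chr CHR ''0''))))"

definition program_TL :: cmd where
  "program_TL = strategy_program init_TL (round_program body_TL)"

lemma cmd_ok_program_TL: "cmd_ok program_TL"
  by (auto simp: program_TL_def strategy_program_def init_TL_def body_TL_def out_stack_def expand_leaves_def
      split_leaves_def)

lemma exec_init_TL:
  "exec init_TL ([], 0, replicate 7 (\<lambda>_. Blank, 0))
     (round_memory (\<lambda>ls. [[], leaves_stack ls, [], []]) ([], [[]]))"
  using wp_mark_bottom[of 5]
  by (simp add: exec_wp init_TL_def round_memory_def numeral_eq_Suc leaves_stack_def replicative_def)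

lemma program_TL_runs_strategy:
  "\<exists>r. spelled_run (branch (compile 7 program_TL) env) = play_run react_TL [[]] r \<and>
     fair (compile 7 program_TL) (branch (compile 7 program_TL) env)"
  unfolding program_TL_def
  by (rule strategy_program_runs_strategy[OF exec_init_TL _ exec_round_program[OF exec_body_TL]])
    (simp add: round_memory_def mem_def)


subsection \<open>The machine for Rec\_L to Rec\_T\<close>

text \<open>Stack 2 lists the entries, each enclosed by a dot and a colon. Stack 1 holds the part of the
  environment's move that has not yet been matched with the current entry, headed by a label after
  a mismatch; the matched part is kept on stack 0. The new entries are collected, in reverse, on
  stacks 3 and 4.\<close>

fun bit_symbol :: "bool option \<Rightarrow> symbol" where
  "bit_symbol None = Label Machine"
| "bit_symbol (Some b) = Chr (bit_char b)"

text \<open>\<open>bit_symbol\<close> writes padding as \<open>Label Machine\<close>, which tells it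
  from a genuine 0. The closing colon marks both where new bits are inserted and where
  \<open>discard_copy\<close> stops.\<close>

definition entry_stack :: "entry \<Rightarrow> symbol list" where
  "entry_stack e = Chr CHR ''.'' # map bit_symbol e @ [Chr CHR '':'']"

definition entries_stack :: "entry list \<Rightarrow> symbol list" where
  "entries_stack s = concat (map entry_stack s)"

lemma entries_stack_simps [simp]:
  "entries_stack [] = []" "entries_stack (e # s) = entry_stack e @ entries_stack s"
  "entries_stack (s @ s') = entries_stack s @ entries_stack s'"
  by (simp_all add: entries_stack_def)

lemma bit_symbol_neq [simp]:
  "bit_symbol b \<noteq> Blank" "bit_symbol b \<noteq> Chr CHR ''.''" "bit_symbol b \<noteq> Chr CHR '':''"
  "Blank \<noteq> bit_symbol b" "Chr CHR ''.'' \<noteq> bit_symbol b" "Chr CHR '':'' \<noteq> bit_symbol b"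
  by (cases b; simp)+

lemma Blank_notin_image_Chr [simp]: "Blank \<notin> Chr ` A"
  by auto

lemma Blank_notin_entries_stack: "Blank \<notin> set (entries_stack s)"
  by (auto simp: entries_stack_def entry_stack_def)

text \<open>The padding symbol goes onto stack 3 before the colon, so that after turning the stack
  it stands between the last bit and the colon.\<close>

definition pad_entries :: cmd where
  "pad_entries = Seq (while_top 2 (\<lambda>a. a \<noteq> Blank)
       (Seq (if_top 2 (\<lambda>a. a = Chr CHR '':'') (push 3 (Label Machine)) noop) (Seq (copy 2 3) (pop 2))))
     (move_stack 3 2)"

lemma wp_pad_entries:
  "wp pad_entries (mem \<Phi> h [] (b # c # [entries_stack s, [], []])) R =
   R (mem (\<Phi> @ []) h [] (b # c # [entries_stack (pad 1 s), [], []]))"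
proof -
  define f where "f a = (if a = Chr CHR '':'' then [Label Machine, a] else [a])" for a
  define A where "A = while_top 2 (\<lambda>a. a \<noteq> Blank)
       (Seq (if_top 2 (\<lambda>a. a = Chr CHR '':'') (push 3 (Label Machine)) noop) (Seq (copy 2 3) (pop 2)))"
  have A: "wp A (mem \<Phi> h [] [b, c, xs, e1, []]) R' = R' (mem \<Phi> h [] [b, c, [], rev (concat (map f xs)) @ e1, []])"
    if "Blank \<notin> set xs" for xs e1 R'
    using that
  proof (induction xs arbitrary: e1)
    case Nil
    then show ?case unfolding A_def by (subst wp_while_top) simp_all
  next
    case (Cons a xs)
    have "wp A (mem \<Phi> h [] [b, c, a # xs, e1, []]) R' = wp A (mem \<Phi> h [] [b, c, xs, rev (f a) @ e1, []]) R'"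
      using Cons.prems by (subst (1) A_def, subst wp_while_top) (auto simp: A_def[symmetric] f_def)
    then show ?case using Cons by simp
  qed
  have "f (bit_symbol x) = [bit_symbol x]" for x by (simp add: f_def)
  then have "concat (map f (map bit_symbol e)) = map bit_symbol e" for e by (induction e) simp_all
  then have "concat (map f (entry_stack e)) = entry_stack (e @ [None])" for e
    by (simp add: entry_stack_def) (simp add: f_def)
  then have "concat (map f (entries_stack s)) = entries_stack (pad 1 s)"
    by (induction s) (simp_all add: pad_def)
  moreover have "Blank \<notin> set (entries_stack (pad 1 s))" by (rule Blank_notin_entries_stack)
  ultimately show ?thesis
    unfolding pad_entries_def A_def[symmetric] by (simp add: A Blank_notin_entries_stack)
qed

definition compare_bit :: "bool \<Rightarrow> cmd" where
  "compare_bit b = if_top 1 (\<lambda>a. a = Chr (bit_char b)) (Seq (copy 1 0) (pop 1))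
     (if_top 1 (\<lambda>a. a = Chr CHR ''.'' \<or> a = Label Machine) noop (push 1 (Label Machine)))"

fun compare_step :: "bool \<Rightarrow> symbol list \<times> symbol list \<Rightarrow> symbol list \<times> symbol list" where
  "compare_step b (xs, ys) =
     (if top ys = Chr (bit_char b) then (top ys # xs, tl ys)
      else if top ys = Chr CHR ''.'' \<or> top ys = Label Machine then (xs, ys)
      else (xs, Label Machine # ys))"

lemma wp_compare_bit [simp]:
  "wp (compare_bit b) (mem \<Phi> h v (x # y # ss)) R =
   R (mem \<Phi> h v (fst (compare_step b (x, y)) # snd (compare_step b (x, y)) # ss))"
  by (simp add: compare_bit_def)

lemma fold_compare_step_stuck:
  "a = Chr CHR ''.'' \<or> a = Label Machine \<Longrightarrow> fold compare_step u (xs, a # ys) = (xs, a # ys)"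
  by (induction u) auto

text \<open>Comparison freezes on a dot or a mark, so running it over the whole address computes
  \<open>advance\<close>. A mismatch only adds a mark on top; as no character is lost, the move can
  be restored for the next entry.\<close>

lemma fold_compare_step:
  "\<exists>\<delta> r. fold compare_step u (rev (map Chr \<pi>), map Chr \<gamma>) =
     (rev (map Chr \<delta>), (if advance u \<gamma> = None then [Label Machine] else []) @ map Chr r) \<and>
     \<delta> @ r = \<pi> @ \<gamma> \<and> (\<forall>r'. advance u \<gamma> = Some r' \<longrightarrow> r' = r)"
proof (induction u \<gamma> arbitrary: \<pi> rule: advance.induct)
  case (1 cs)
  show ?case by (rule exI[of _ \<pi>], rule exI[of _ cs]) simp
next
  \<comment> \<open>The exhausted move reads as \<open>Blank\<close> and is marked as a mismatch, in
    agreement with \<open>advance\<close>.\<close>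
  case (2 b u)
  show ?case
    by (rule exI[of _ \<pi>], rule exI[of _ "[]"]) (simp add: fold_compare_step_stuck)
next
  case (3 b u c cs)
  show ?case
  proof (cases "c = bit_char b")
    case True
    then show ?thesis using "3.IH"[OF True, of "\<pi> @ [c]"] by simp
  next
    case False
    then show ?thesis
      by (intro exI[of _ \<pi>] exI[of _ "c # cs"]) (auto simp: fold_compare_step_stuck)
  qed
qed

text \<open>Whether an entry splits is known only after it has been read, so every entry is copied
  to stack 4 and withdrawn if it does not. The colon of the last copy kept, or the bottom, ends the
  removal.\<close>

definition discard_copy :: cmd where
  "discard_copy = while_top 4 (\<lambda>a. a \<noteq> Blank \<and> a \<noteq> Chr CHR '':'') (pop 4)"

lemma wp_discard_copy:
  assumes "top e2 = Blank \<or> top e2 = Chr CHR '':''" "Blank \<notin> set xs" "Chr CHR '':'' \<notin> set xs"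
  shows "wp discard_copy (mem \<Phi> h v [b, c, e, e1, xs @ e2]) R = R (mem \<Phi> h v [b, c, e, e1, e2])"
  using assms(2,3)
proof (induction xs)
  case Nil
  then show ?case unfolding discard_copy_def using assms(1) by (subst wp_while_top) auto
next
  case (Cons a xs)
  then show ?case unfolding discard_copy_def by (subst wp_while_top) auto
qed

definition copy_out :: cmd where
  "copy_out = while_top 1 (\<lambda>a. a \<noteq> Blank) (Seq (out_top 1) (Seq (copy 1 0) (pop 1)))"

lemma wp_copy_out:
  "wp copy_out (mem \<Phi> h v (x # map Chr r # ss)) R = R (mem \<Phi> h (v @ r) ((rev (map Chr r) @ x) # [] # ss))"
proof (induction r arbitrary: v x)
  case Nil
  show ?case unfolding copy_out_def by (subst wp_while_top) simp_all
next
  case (Cons a r)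
  have "wp copy_out (mem \<Phi> h v (x # map Chr (a # r) # ss)) R =
      wp copy_out (mem \<Phi> h (v @ [a]) ((Chr a # x) # map Chr r # ss)) R"
    unfolding copy_out_def by (subst wp_while_top) simp_all
  then show ?case by (simp add: Cons.IH)
qed

text \<open>The common tail prepares for the next entry: an unsent draft is erased, a mismatch mark
  removed, and the matched part of the move put back on stack 1.\<close>

definition finish_entry :: cmd where
  "finish_entry = Seq
     (if_top 1 (\<lambda>a. a = Chr CHR ''.'')
       (Seq copy_out (Seq flush (Seq (push 3 (Chr CHR '':'')) discard_copy)))
       (if_top 1 (\<lambda>a. a = Chr CHR '':'')
         (Seq (push 3 (Chr CHR ''0'')) (Seq (push 3 (Chr CHR '':''))
           (Seq (push 4 (Chr CHR ''1'')) (push 4 (Chr CHR '':'')))))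
         (Seq (push 3 (Chr CHR '':'')) discard_copy)))
     (Seq rewind (Seq (if_top 1 (\<lambda>a. a = Label Machine) (pop 1) noop) (Seq (move_stack 0 1) (pop 2))))"

definition keep_symbol :: cmd where
  "keep_symbol = Seq (copy 2 3) (Seq (copy 2 4) (pop 2))"

text \<open>One pass drafts the address of the reply and compares the other address. Padding belongs
  to the left address only: it is drafted if the reply goes left and compared as a 0
  otherwise.\<close>

definition process_symbol :: "bool \<Rightarrow> cmd" where
  "process_symbol d =
     if_top 2 (\<lambda>a. a = Chr CHR '':'') finish_entry
     (if_top 2 (\<lambda>a. a = Chr CHR ''.'') (Seq (out (bit_char (\<not> d))) (Seq (out CHR ''.'') keep_symbol))
     (if_top 2 (\<lambda>a. a = Label Machine)
       (Seq (if d then out CHR ''0'' else compare_bit False) keep_symbol)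
     (if_top 2 (\<lambda>a. a = Chr CHR ''1'')
       (Seq (out CHR ''1'') (Seq (compare_bit True) keep_symbol))
       (Seq (out CHR ''0'') (Seq (compare_bit False) keep_symbol)))))"

definition process_entries :: "bool \<Rightarrow> cmd" where
  "process_entries d = while_top 2 (\<lambda>a. a \<noteq> Blank) (process_symbol d)"

lemma wp_process_entries:
  "wp (process_entries d) (mem \<Phi> h v [x, y, a # e, e1, e2]) R =
   (if a \<noteq> Blank then wp (process_symbol d) (mem \<Phi> h v [x, y, a # e, e1, e2]) (\<lambda>C. wp (process_entries d) C R)
    else R (mem \<Phi> h v [x, y, a # e, e1, e2]))"
  "wp (process_entries d) (mem \<Phi> h v [x, y, [], e1, e2]) R = R (mem \<Phi> h v [x, y, [], e1, e2])"
  unfolding process_entries_def by (subst wp_while_top; simp)+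

lemma wp_keep_symbol [simp]:
  "wp keep_symbol (mem \<Phi> h v [b, c, a # e, e1, e2]) R = R (mem \<Phi> h v [b, c, e, a # e1, a # e2])"
  by (simp add: keep_symbol_def)

lemma wp_process_bits:
  "wp (process_entries d) (mem \<Phi> h v [x, y, map bit_symbol e @ rest, e1, e2]) R =
   wp (process_entries d) (mem \<Phi> h (v @ map bit_char (key (\<not> d) e))
     [fst (fold compare_step (key d e) (x, y)), snd (fold compare_step (key d e) (x, y)), rest,
      rev (map bit_symbol e) @ e1, rev (map bit_symbol e) @ e2]) R"
proof (induction e arbitrary: v x y e1 e2)
  case Nil
  show ?case by (simp add: key_def)
next
  case (Cons b e)
  define v' where "v' = v @ map bit_char (key (\<not> d) [b])"
  define xy where "xy = fold compare_step (key d [b]) (x, y)"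
  have "wp (process_entries d) (mem \<Phi> h v [x, y, map bit_symbol (b # e) @ rest, e1, e2]) R =
      wp (process_entries d) (mem \<Phi> h v' [fst xy, snd xy, map bit_symbol e @ rest, bit_symbol b # e1, bit_symbol b # e2]) R"
  proof (cases b)
    case None
    then show ?thesis
      by (simp add: wp_process_entries(1) process_symbol_def v'_def xy_def key_def bit_char_def[of False]
          del: compare_step.simps)
  next
    case (Some c)
    then show ?thesis
      by (cases c) (simp_all add: wp_process_entries(1) process_symbol_def v'_def xy_def key_def bit_char_def
          del: compare_step.simps)
  qed
  moreover have "key d' (b # e) = key d' [b] @ key d' e" for d'
    by (cases b) (simp_all add: key_def)
  ultimately show ?case using Cons.IH by (simp add: v'_def xy_def del: compare_step.simps)
qed

lemma wp_process_entry:
  assumes e2: "top e2 = Blank \<or> top e2 = Chr CHR '':''"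
  shows "wp (process_entries d) (mem \<Phi> h [] [[], map Chr \<gamma>, entry_stack e @ rest, e1, e2]) R =
    wp (process_entries d) (mem (\<Phi> @ map (Pair Machine) (reply d \<gamma> e)) h [] [[], map Chr \<gamma>, rest,
      rev (entry_stack (if splits d \<gamma> e then e @ [Some False] else e)) @ e1,
      (if splits d \<gamma> e then rev (entry_stack (e @ [Some True])) else []) @ e2]) R"
proof -
  define xs where "xs = rev (map bit_symbol e) @ [Chr CHR ''.'']"
  have xs: "Blank \<notin> set xs" "Chr CHR '':'' \<notin> set xs" by (auto simp: xs_def)
  define v where "v = bit_char (\<not> d) # CHR ''.'' # map bit_char (key (\<not> d) e)"
  obtain \<delta> r where r: "fold compare_step (key d e) ([], map Chr \<gamma>) =
      (rev (map Chr \<delta>), (if advance (key d e) \<gamma> = None then [Label Machine] else []) @ map Chr r)"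
      "\<delta> @ r = \<gamma>" "\<And>r'. advance (key d e) \<gamma> = Some r' \<Longrightarrow> r' = r"
    using fold_compare_step[of "key d e" "[]" \<gamma>] by auto
  have \<gamma>: "rev (rev (map Chr \<delta>)) @ map Chr r = map Chr \<gamma>" using r(2) by auto
  define y where "y = (if advance (key d e) \<gamma> = None then [Label Machine] else []) @ map Chr r"
  have "wp (process_entries d) (mem \<Phi> h [] [[], map Chr \<gamma>, entry_stack e @ rest, e1, e2]) R =
    wp (process_entries d) (mem \<Phi> h [bit_char (\<not> d), CHR ''.''] [[], map Chr \<gamma>,
      map bit_symbol e @ Chr CHR '':'' # rest, Chr CHR ''.'' # e1, Chr CHR ''.'' # e2]) R"
    by (simp add: entry_stack_def wp_process_entries(1) process_symbol_def)
  also have "\<dots> = wp (process_entries d) (mem \<Phi> h v [rev (map Chr \<delta>), y, Chr CHR '':'' # rest, xs @ e1, xs @ e2]) R"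
    unfolding wp_process_bits r(1) y_def[symmetric] by (simp add: v_def xs_def)
  also have "\<dots> = wp finish_entry (mem \<Phi> h v [rev (map Chr \<delta>), y, Chr CHR '':'' # rest, xs @ e1, xs @ e2])
      (\<lambda>C. wp (process_entries d) C R)"
    by (simp add: wp_process_entries(1) process_symbol_def)
  also have "\<dots> = wp (process_entries d) (mem (\<Phi> @ map (Pair Machine) (reply d \<gamma> e)) h [] [[], map Chr \<gamma>, rest,
      rev (entry_stack (if splits d \<gamma> e then e @ [Some False] else e)) @ e1,
      (if splits d \<gamma> e then rev (entry_stack (e @ [Some True])) else []) @ e2]) R"
  proof -
    \<comment> \<open>In the last case the address is used up while the rest of the move starts with
      neither sign or is empty; the entry is kept and nothing is sent.\<close>
    consider (dot) \<alpha> where "advance (key d e) \<gamma> = Some (CHR ''.'' # \<alpha>)"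
      | (colon) \<alpha> where "advance (key d e) \<gamma> = Some (CHR '':'' # \<alpha>)"
      | (mismatch) "advance (key d e) \<gamma> = None"
      | (other) "advance (key d e) \<gamma> = Some r" "top (map Chr r) \<noteq> Chr CHR ''.''" "top (map Chr r) \<noteq> Chr CHR '':''"
    proof (cases "advance (key d e) \<gamma>")
      case (Some r')
      then have "r' = r" by (rule r(3))
      then show ?thesis using Some that by (cases r) auto
    qed (use that in blast)
    then show ?thesis
    proof cases
      case dot
      then have r': "r = CHR ''.'' # \<alpha>" using r(3) by metis
      have "reply d \<gamma> e = [v @ r]" "\<not> splits d \<gamma> e"
        using dot by (auto simp: reply_def splits_def v_def r' move_at_def)
      moreover have "map Chr \<delta> @ Chr CHR ''.'' # map Chr \<alpha> = map Chr \<gamma>" using \<gamma> r' by simp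
      ultimately show ?thesis using dot wp_copy_out[of \<Phi> h v "rev (map Chr \<delta>)" r]
        by (simp add: finish_entry_def y_def r' wp_discard_copy[OF e2 xs]) (auto simp: entry_stack_def xs_def)
    next
      case colon
      then have r': "r = CHR '':'' # \<alpha>" using r(3) by metis
      have "reply d \<gamma> e = []" "splits d \<gamma> e"
        using colon by (auto simp: reply_def splits_def)
      moreover have "map Chr \<delta> @ Chr CHR '':'' # map Chr \<alpha> = map Chr \<gamma>" using \<gamma> r' by simp
      ultimately show ?thesis using colon
        by (simp add: finish_entry_def y_def r') (auto simp: entry_stack_def xs_def bit_char_def)
    next
      case mismatch
      then have "reply d \<gamma> e = []" "\<not> splits d \<gamma> e"
        by (auto simp: reply_def splits_def)
      moreover have "map Chr \<delta> @ map Chr r = map Chr \<gamma>" using \<gamma> by simp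
      ultimately show ?thesis using mismatch
        by (simp add: finish_entry_def y_def wp_discard_copy[OF e2 xs]) (auto simp: entry_stack_def xs_def)
    next
      case other
      then have "reply d \<gamma> e = []" "\<not> splits d \<gamma> e"
        by (auto simp: reply_def splits_def split: list.split)
      moreover have "map Chr \<delta> @ map Chr r = map Chr \<gamma>" using \<gamma> by simp
      moreover have "top (map Chr r) \<noteq> Label Machine" by (cases r) auto
      ultimately show ?thesis using other
        by (simp add: finish_entry_def y_def wp_discard_copy[OF e2 xs]) (auto simp: entry_stack_def xs_def)
    qed
  qed
  finally show ?thesis .
qed

lemma wp_process_all:
  "top e2 = Blank \<or> top e2 = Chr CHR '':'' \<Longrightarrow>
   wp (process_entries d) (mem \<Phi> h [] [[], map Chr \<gamma>, entries_stack s, e1, e2]) R =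
   R (mem (\<Phi> @ map (Pair Machine) (concat (map (reply d \<gamma>) s))) h [] [[], map Chr \<gamma>, [],
     rev (entries_stack (map (\<lambda>e. if splits d \<gamma> e then e @ [Some False] else e) s)) @ e1,
     rev (entries_stack (map (\<lambda>e. e @ [Some True]) (filter (splits d \<gamma>) s))) @ e2])"
proof (induction s arbitrary: \<Phi> e1 e2)
  case Nil
  show ?case by (simp add: wp_process_entries(2))
next
  case (Cons e s)
  have "top ((if splits d \<gamma> e then rev (entry_stack (e @ [Some True])) else []) @ e2) = Blank \<or>
      top ((if splits d \<gamma> e then rev (entry_stack (e @ [Some True])) else []) @ e2) = Chr CHR '':''"
    using Cons.prems by (simp add: entry_stack_def)
  from Cons.IH[OF this] show ?case
    by (simp add: wp_process_entry[OF Cons.prems])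
qed

definition answer_program :: "bool \<Rightarrow> cmd" where
  "answer_program d = Seq (process_entries d) (Seq (move_stack 4 2) (move_stack 3 2))"

lemma wp_answer_program:
  "wp (answer_program d) (mem \<Phi> h [] [[], map Chr \<gamma>, entries_stack s, [], []]) R =
   R (mem (\<Phi> @ map (Pair Machine) (fst (answer d \<gamma> s))) h [] [[], map Chr \<gamma>, entries_stack (snd (answer d \<gamma> s)), [], []])"
  by (simp add: answer_program_def wp_process_all Blank_notin_entries_stack answer_def split_entries_def)

definition body_LT :: cmd where
  "body_LT = Seq (for_each_symbol pad_entries)
     (Seq (if_top 1 (\<lambda>a. a = Chr CHR ''0'')
            (Seq (pop 1) (if_top 1 (\<lambda>a. a = Chr CHR ''.'') (Seq (pop 1) (answer_program False)) noop))
          (if_top 1 (\<lambda>a. a = Chr CHR ''1'')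
            (Seq (pop 1) (if_top 1 (\<lambda>a. a = Chr CHR ''.'') (Seq (pop 1) (answer_program True)) noop)) noop))
       (clear 1))"

lemma pad_funpow: "(pad 1 ^^ k) s = pad k s"
  by (induction k) (simp_all add: pad_def replicate_append_same)

lemma exec_body_LT:
  "exec body_LT (mem \<Phi> h [] (rev (map Chr \<beta>) # [[], entries_stack s, [], []]))
    (mem (\<Phi> @ map (Pair Machine) (fst (react_LT s \<beta>))) h [] ([] # [[], entries_stack (snd (react_LT s \<beta>)), [], []]))"
proof -
  have "iterate_output (\<lambda>s. [] :: position) G k s = []" for G :: "entry list \<Rightarrow> entry list" and k and s :: "entry list"
    by (induction k arbitrary: s) simp_all
  then have pad: "wp (for_each_symbol pad_entries) (mem \<Phi> h [] (rev (map Chr \<beta>) # [] # [entries_stack s, [], []])) R =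
      R (mem \<Phi> h [] ([] # map Chr \<beta> # [entries_stack (pad (length \<beta>) s), [], []]))" for R
    using wp_for_each_symbol[where enc = "\<lambda>s. [entries_stack s, [], []]" and b = "rev (map Chr \<beta>)"
        and c = "[]", OF wp_pad_entries]
    by (simp add: pad_funpow[unfolded One_nat_def])
  consider \<gamma> where "\<beta> = CHR ''0'' # CHR ''.'' # \<gamma>" | \<gamma> where "\<beta> = CHR ''1'' # CHR ''.'' # \<gamma>"
    | "\<not> prefix ''0.'' \<beta>" "\<not> prefix ''1.'' \<beta>"
    using prefix_01_cases by blast
  then show ?thesis
  proof cases
    case 1
    then show ?thesis using pad unfolding exec_wp body_LT_def
      by (simp add: wp_answer_program react_LT_def)
  next
    case 2
    then show ?thesis using pad unfolding exec_wp body_LT_def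
      by (simp add: wp_answer_program react_LT_def)
  next
    case 3
    then have react: "react_LT s \<beta> = ([], pad (length \<beta>) s)" by (simp add: react_LT_def)
    show ?thesis
    proof (cases \<beta>)
      case Nil
      then show ?thesis using pad unfolding exec_wp body_LT_def react by simp
    next
      case (Cons c \<beta>')
      then show ?thesis using 3 pad unfolding exec_wp body_LT_def react by (cases \<beta>') auto
    qed
  qed
qed

definition init_LT :: cmd where
  "init_LT = Seq mark_bottom (Seq (push 2 (Chr CHR '':'')) (push 2 (Chr CHR ''.'')))"

definition program_LT :: cmd where
  "program_LT = strategy_program init_LT (round_program body_LT)"

lemma cmd_ok_program_LT: "cmd_ok program_LT"
  by (auto simp: program_LT_def strategy_program_def init_LT_def body_LT_def pad_entries_def
      answer_program_def process_entries_def process_symbol_def finish_entry_def keep_symbol_def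
      compare_bit_def copy_out_def discard_copy_def)

lemma exec_init_LT:
  "exec init_LT ([], 0, replicate 7 (\<lambda>_. Blank, 0))
     (round_memory (\<lambda>s. [[], entries_stack s, [], []]) ([], [[]]))"
  using wp_mark_bottom[of 5]
  by (simp add: exec_wp init_LT_def round_memory_def numeral_eq_Suc entry_stack_def)

lemma program_LT_runs_strategy:
  "\<exists>r. spelled_run (branch (compile 7 program_LT) env) = play_run react_LT [[]] r \<and>
     fair (compile 7 program_LT) (branch (compile 7 program_LT) env)"
  unfolding program_LT_def
  by (rule strategy_program_runs_strategy[OF exec_init_LT _ exec_round_program[OF exec_body_LT]])
    (simp add: round_memory_def mem_def)

section \<open>Uniform validity\<close>

text \<open>Seven tapes: output, marker and five stacks. The machine is chosen before the
  interpretation, and fairness against every environment settles the second condition of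
  \<open>wins\<close>.\<close>

lemma uniformly_validI:
  assumes "cmd_ok P"
    and "\<And>env. \<exists>r. spelled_run (branch (compile 7 P) env) = play_run \<rho> s r \<and>
      fair (compile 7 P) (branch (compile 7 P) env)"
    and "\<And>I r. (\<And>a. static (I a)) \<Longrightarrow> Wn (interp I G) (play_run \<rho> s r) = Machine"
  shows "uniformly_valid G"
  unfolding uniformly_valid_def wins_def Let_def
proof (intro exI[of _ "compile 7 P"] conjI allI impI)
  show "is_epm (compile 7 P)" using assms(1) by (rule is_epm_compile) simp
  fix I :: "nat \<Rightarrow> game" and env assume "\<forall>a. static (I a)"
  then show "Wn (interp I G) (spelled_run (branch (compile 7 P) env)) = Machine"
    "fair (compile 7 P) (branch (compile 7 P) env) \<or>
      illegal_by Environment (Lr (interp I G)) (spelled_run (branch (compile 7 P) env))"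
    using assms(2)[of env] assms(3)[of I] by auto
qed

theorem theorem3p4:
  fixes F :: formula
  shows "uniformly_valid (Imp (RecT F) (RecL F)) \<and> uniformly_valid (Imp (RecL F) (RecT F))"
proof
  show "uniformly_valid (Imp (RecT F) (RecL F))"
    by (rule uniformly_validI[OF cmd_ok_program_TL program_TL_runs_strategy])
      (simp add: play_TL_wins prefix_closed_interp Fin_Nil_interp)
  show "uniformly_valid (Imp (RecL F) (RecT F))"
    by (rule uniformly_validI[OF cmd_ok_program_LT program_LT_runs_strategy])
      (simp add: play_LT_wins prefix_closed_interp Fin_Nil_interp)
qed

end
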